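(* Let $\mathcal N$ be a semifinite von Neumann algebra on a separable Hilbert space with a faithful normal semifinite trace $\tau$. Let $T\in\mathcal N$ be positive with $\tau(T^s)<\infty$ for all $s>1$. If the (finite) limit $\lim_{r\to\infty}\frac1r\tau(T^{1+\frac1r})$ exists, then $T\in\mathcal L^{(1,\infty)}(\mathcal N,\tau)$.
   Context: For $A\in\mathcal N$ and $t\ge0$, $\mu_t(A)=\inf\{s\ge 0:\tau(E^{|A|}(s,\infty))\le t\}$, where $E^{|A|}$ is the spectral measure of $|A|$. Let $\psi_1(t)=t\log 2$ for $0\le t\le 1$ and $\psi_1(t)=\log(1+t)$ for $t\ge 1$. Then $\mathcal L^{(1,\infty)}(\mathcal N,\tau)$ is the set of $A\in\mathcal N$ with $\sup_{t>0}\frac{1}{\psi_1(t)}\int_0^t\mu_s(A)\,ds<\infty$. *)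

theory Defs
  imports "HOL-Analysis.Analysis"
begin

subsection \<open>Complex Hilbert spaces\<close>

text \<open>
  The norm and metric come from the real inner product \<open>x \<bullet> y\<close>, which is tied to the complex one
  by \<open>x \<bullet> y = Re (cinner x y)\<close>; hence \<open>cinner x x = (norm x)\<^sup>2\<close>.
  The complex inner product is linear in the first argument.
\<close>

class complex_inner = real_inner +
  fixes scaleC :: "complex \<Rightarrow> 'a \<Rightarrow> 'a"  (infixr "*\<^sub>C" 75)
    and cinner :: "'a \<Rightarrow> 'a \<Rightarrow> complex"
  assumes scaleC_add_right: "c *\<^sub>C (x + y) = c *\<^sub>C x + c *\<^sub>C y"
    and scaleC_add_left: "(c + d) *\<^sub>C x = c *\<^sub>C x + d *\<^sub>C x"
    and scaleC_scaleC: "c *\<^sub>C d *\<^sub>C x = (c * d) *\<^sub>C x"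
    and scaleC_of_real: "complex_of_real r *\<^sub>C x = r *\<^sub>R x"
    and cinner_commute: "cinner x y = cnj (cinner y x)"
    and cinner_add_left: "cinner (x + y) z = cinner x z + cinner y z"
    and cinner_scaleC_left: "cinner (c *\<^sub>C x) y = c * cinner x y"
    and inner_eq_Re_cinner: "x \<bullet> y = Re (cinner x y)"

class chilbert_space = complex_inner + complete_space

instantiation complex :: chilbert_space
begin

definition scaleC_complex :: "complex \<Rightarrow> complex \<Rightarrow> complex"
  where "scaleC_complex c x = c * x"

definition cinner_complex :: "complex \<Rightarrow> complex \<Rightarrow> complex"
  where "cinner_complex x y = x * cnj y"

instance
  by standard
    (simp_all add: scaleC_complex_def cinner_complex_def inner_complex_def algebra_simps scaleR_conv_of_real)

end


subsection \<open>Bounded operators\<close>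

text \<open>
  Bounded operators are the complex-linear elements of the library type \<open>'h \<Rightarrow>\<^sub>L 'h\<close>
  of bounded real-linear maps.
\<close>

definition bounded_ops :: "('h::chilbert_space \<Rightarrow>\<^sub>L 'h) set"
  where "bounded_ops = {A. \<forall>c x. blinfun_apply A (c *\<^sub>C x) = c *\<^sub>C blinfun_apply A x}"

definition op_adjoint :: "('h::chilbert_space \<Rightarrow>\<^sub>L 'h) \<Rightarrow> ('h \<Rightarrow>\<^sub>L 'h)"
  where "op_adjoint A = (THE B. \<forall>x y. cinner (blinfun_apply A x) y = cinner x (blinfun_apply B y))"

definition positive_op :: "('h::chilbert_space \<Rightarrow>\<^sub>L 'h) \<Rightarrow> bool"
  where "positive_op A \<longleftrightarrow> A \<in> bounded_ops \<and> (\<forall>x. cinner (blinfun_apply A x) x \<in> \<real>\<^sub>\<ge>\<^sub>0)"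

definition op_le :: "('h::chilbert_space \<Rightarrow>\<^sub>L 'h) \<Rightarrow> ('h \<Rightarrow>\<^sub>L 'h) \<Rightarrow> bool"  (infix "\<preceq>" 50)
  where "A \<preceq> B \<longleftrightarrow> positive_op (B - A)"

definition is_projection :: "('h::chilbert_space \<Rightarrow>\<^sub>L 'h) \<Rightarrow> bool"
  where "is_projection P \<longleftrightarrow> P \<in> bounded_ops \<and> P o\<^sub>L P = P \<and> op_adjoint P = P"

definition op_abs :: "('h::chilbert_space \<Rightarrow>\<^sub>L 'h) \<Rightarrow> ('h \<Rightarrow>\<^sub>L 'h)"
  where "op_abs A = (THE B. positive_op B \<and> B o\<^sub>L B = op_adjoint A o\<^sub>L A)"


subsection \<open>Von Neumann algebras and traces\<close>

definition commutant :: "('h::chilbert_space \<Rightarrow>\<^sub>L 'h) set \<Rightarrow> ('h \<Rightarrow>\<^sub>L 'h) set"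
  where "commutant M = {B \<in> bounded_ops. \<forall>A\<in>M. A o\<^sub>L B = B o\<^sub>L A}"

definition von_neumann_algebra :: "('h::chilbert_space \<Rightarrow>\<^sub>L 'h) set \<Rightarrow> bool"
  where "von_neumann_algebra N \<longleftrightarrow>
    N \<subseteq> bounded_ops \<and> (\<forall>A\<in>N. op_adjoint A \<in> N) \<and> commutant (commutant N) = N"

definition positive_part :: "('h::chilbert_space \<Rightarrow>\<^sub>L 'h) set \<Rightarrow> ('h \<Rightarrow>\<^sub>L 'h) set"
  where "positive_part N = {A \<in> N. positive_op A}"

text \<open>
  A trace is a weight \<open>positive_part N \<rightarrow> [0, \<infinity>]\<close>; the values of \<open>\<tau>\<close> outside \<open>positive_part N\<close> are
  irrelevant.  In \<open>ennreal\<close> one has \<open>0 * \<infinity> = 0\<close>, so homogeneity includes \<open>\<tau> 0 = 0\<close>.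
\<close>

definition is_trace :: "('h::chilbert_space \<Rightarrow>\<^sub>L 'h) set \<Rightarrow> (('h \<Rightarrow>\<^sub>L 'h) \<Rightarrow> ennreal) \<Rightarrow> bool"
  where "is_trace N \<tau> \<longleftrightarrow>
    (\<forall>A\<in>positive_part N. \<forall>B\<in>positive_part N. \<tau> (A + B) = \<tau> A + \<tau> B) \<and>
    (\<forall>A\<in>positive_part N. \<forall>c::real. 0 \<le> c \<longrightarrow> \<tau> (c *\<^sub>R A) = ennreal c * \<tau> A) \<and>
    (\<forall>A\<in>N. \<tau> (op_adjoint A o\<^sub>L A) = \<tau> (A o\<^sub>L op_adjoint A))"

definition faithful :: "('h::chilbert_space \<Rightarrow>\<^sub>L 'h) set \<Rightarrow> (('h \<Rightarrow>\<^sub>L 'h) \<Rightarrow> ennreal) \<Rightarrow> bool"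
  where "faithful N \<tau> \<longleftrightarrow> (\<forall>A\<in>positive_part N. \<tau> A = 0 \<longrightarrow> A = 0)"

text \<open>
  Increasing nets are represented by their ranges, i.e. by upward directed sets.
\<close>

definition normal :: "('h::chilbert_space \<Rightarrow>\<^sub>L 'h) set \<Rightarrow> (('h \<Rightarrow>\<^sub>L 'h) \<Rightarrow> ennreal) \<Rightarrow> bool"
  where "normal N \<tau> \<longleftrightarrow>
    (\<forall>D A. D \<subseteq> positive_part N \<and> D \<noteq> {} \<and>
       (\<forall>B\<in>D. \<forall>C\<in>D. \<exists>F\<in>D. B \<preceq> F \<and> C \<preceq> F) \<and>
       A \<in> positive_part N \<and> (\<forall>B\<in>D. B \<preceq> A) \<and>
       (\<forall>C\<in>positive_part N. (\<forall>B\<in>D. B \<preceq> C) \<longrightarrow> A \<preceq> C)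
       \<longrightarrow> \<tau> A = (SUP B\<in>D. \<tau> B))"

definition semifinite :: "('h::chilbert_space \<Rightarrow>\<^sub>L 'h) set \<Rightarrow> (('h \<Rightarrow>\<^sub>L 'h) \<Rightarrow> ennreal) \<Rightarrow> bool"
  where "semifinite N \<tau> \<longleftrightarrow>
    (\<forall>A\<in>positive_part N. A \<noteq> 0 \<longrightarrow> (\<exists>B\<in>positive_part N. B \<noteq> 0 \<and> B \<preceq> A \<and> \<tau> B < \<infinity>))"


subsection \<open>Spectral measures and Borel functional calculus\<close>

text \<open>
  Projection-valued measures on the Borel sets of the real line; by convention \<open>E S = 0\<close> for
  non-Borel \<open>S\<close>, which makes the spectral measure of an operator unique as a function on all sets.
\<close>

definition projection_valued_measure :: "(real set \<Rightarrow> ('h::chilbert_space \<Rightarrow>\<^sub>L 'h)) \<Rightarrow> bool"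
  where "projection_valued_measure E \<longleftrightarrow>
    (\<forall>S. S \<notin> sets borel \<longrightarrow> E S = 0) \<and>
    (\<forall>S\<in>sets borel. is_projection (E S)) \<and>
    E UNIV = id_blinfun \<and>
    (\<forall>S\<in>sets borel. \<forall>S'\<in>sets borel. E (S \<inter> S') = E S o\<^sub>L E S') \<and>
    (\<forall>F :: nat \<Rightarrow> real set. range F \<subseteq> sets borel \<and> disjoint_family F \<longrightarrow>
       (\<forall>x. (\<lambda>n. blinfun_apply (E (F n)) x) sums blinfun_apply (E (\<Union>n. F n)) x))"

text \<open>The scalar measure \<open>S \<mapsto> \<langle>E(S) x, x\<rangle>\<close>.\<close>

definition scalar_measure :: "(real set \<Rightarrow> ('h::chilbert_space \<Rightarrow>\<^sub>L 'h)) \<Rightarrow> 'h \<Rightarrow> real measure"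
  where "scalar_measure E x =
    measure_of UNIV (sets borel) (\<lambda>S. ennreal (Re (cinner (blinfun_apply (E S) x) x)))"

text \<open>
  \<open>A = \<integral> \<lambda> dE(\<lambda>)\<close> for a bounded self-adjoint operator \<open>A\<close>, in the weak sense (the quadratic form
  determines a complex-linear operator).  The measure of a bounded operator has bounded support,
  so all the integrals converge.
\<close>

definition is_spectral_measure ::
  "('h::chilbert_space \<Rightarrow>\<^sub>L 'h) \<Rightarrow> (real set \<Rightarrow> ('h \<Rightarrow>\<^sub>L 'h)) \<Rightarrow> bool"
  where "is_spectral_measure A E \<longleftrightarrow>
    projection_valued_measure E \<and>
    (\<exists>R. E {-R..R} = id_blinfun) \<and>
    (\<forall>x. cinner (blinfun_apply A x) x = complex_of_real (\<integral>l. l \<partial>scalar_measure E x))"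

definition spectral_measure :: "('h::chilbert_space \<Rightarrow>\<^sub>L 'h) \<Rightarrow> real set \<Rightarrow> ('h \<Rightarrow>\<^sub>L 'h)"
  where "spectral_measure A = (THE E. is_spectral_measure A E)"

definition op_fun :: "(real \<Rightarrow> real) \<Rightarrow> ('h::chilbert_space \<Rightarrow>\<^sub>L 'h) \<Rightarrow> ('h \<Rightarrow>\<^sub>L 'h)"
  where "op_fun f A = (THE B. B \<in> bounded_ops \<and>
    (\<forall>x. integrable (scalar_measure (spectral_measure A) x) f \<and>
      cinner (blinfun_apply B x) x =
        complex_of_real (\<integral>l. f l \<partial>scalar_measure (spectral_measure A) x)))"

text \<open>
  For positive \<open>A\<close> and \<open>s > 0\<close>; the spectral measure then vanishes on \<open>{..<0}\<close>, and
  \<open>0 powr s = 0\<close>.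
\<close>

definition op_powr :: "('h::chilbert_space \<Rightarrow>\<^sub>L 'h) \<Rightarrow> real \<Rightarrow> ('h \<Rightarrow>\<^sub>L 'h)"
  where "op_powr A s = op_fun (\<lambda>l. l powr s) A"


subsection \<open>Generalised singular values and the dual Macaev ideal\<close>

definition singular_value :: "(('h::chilbert_space \<Rightarrow>\<^sub>L 'h) \<Rightarrow> ennreal) \<Rightarrow> real \<Rightarrow> ('h \<Rightarrow>\<^sub>L 'h) \<Rightarrow> real"
  where "singular_value \<tau> t A =
    Inf {s. 0 \<le> s \<and> \<tau> (spectral_measure (op_abs A) {s<..}) \<le> ennreal t}"

definition psi1 :: "real \<Rightarrow> real"
  where "psi1 t = (if t \<le> 1 then t * ln 2 else ln (1 + t))"

definition L_one_infinity ::
  "('h::chilbert_space \<Rightarrow>\<^sub>L 'h) set \<Rightarrow> (('h \<Rightarrow>\<^sub>L 'h) \<Rightarrow> ennreal) \<Rightarrow> ('h \<Rightarrow>\<^sub>L 'h) set"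
  where "L_one_infinity N \<tau> = {A \<in> N.
    (SUP t\<in>{0<..}. ennreal (1 / psi1 t) *
       (\<integral>\<^sup>+s\<in>{0..t}. ennreal (singular_value \<tau> s A) \<partial>lborel)) < \<infinity>}"

end

theory Submission
  imports Defs "HOL-Probability.Distribution_Functions"
begin

text \<open>
  Fix \<open>M > \<parallel>T\<parallel>\<close> and let \<open>n l = \<tau> (E {l<..})\<close>, where \<open>E\<close> is the spectral measure of \<open>T\<close>. By the
  layer-cake formula \<open>\<integral>\<^sub>0\<^sup>t \<mu>\<^sub>s ds\<close> is at most \<open>t \<epsilon>\<close> plus a dyadic sum of the numbers \<open>l * n l\<close> over
  \<open>\<epsilon> \<le> l < M\<close>, and \<open>l \<le> \<epsilon>\<^sup>-\<^sup>q l\<^sup>1\<^sup>+\<^sup>q\<close> on \<open>{\<epsilon>..}\<close> bounds that sum by \<open>2 \<epsilon>\<^sup>-\<^sup>q \<tau> (T\<^sup>1\<^sup>+\<^sup>q)\<close>. With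
  \<open>q = 1 / ln t\<close> and \<open>\<epsilon>\<close> of order \<open>1 / t\<close>, the factor \<open>\<epsilon>\<^sup>-\<^sup>q\<close> stays bounded, while convergence of
  \<open>\<tau> (T\<^sup>1\<^sup>+\<^sup>q) * q\<close> makes the bound \<open>O(ln t)\<close>.

  The spectral theorem is proved for symmetric operators on a real Hilbert space with inner product
  \<open>Re (cinner x y)\<close>. All spectral projections commute with the commutant of the operator, in
  particular with multiplication by \<open>\<i>\<close>, which makes them complex linear and places them in \<open>N\<close>.
\<close>

section \<open>Symmetric operators on real Hilbert spaces\<close>

text \<open>\<open>spectral_measure\<close>, \<open>op_powr\<close> and \<open>op_abs\<close> are
  definite descriptions, so nothing can be said about the trace of a spectral projection until
  existence and uniqueness are proved for each; this is why most of the work is spectral theory. The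
  construction keeps everything in the bicommutant of the operator: \<open>E {s<..}\<close> is built
  from a strong limit of polynomials in \<open>A - s\<close>, its distribution functions yield
  scalar measures, and the remaining projections are recovered from their quadratic forms. A
  symmetric operator is determined by its form, which turns operator identities into identities
  between measures. In the estimate the exponent has to move with \<open>t\<close>: for a fixed
  \<open>q\<close> the bound grows like \<open>t powr q\<close>. The coupling
  \<open>q = 1 / ln t\<close> exploits \<open>t powr (1 / ln t) = exp 1\<close>; its price is the
  factor \<open>1 / q = ln t\<close> in the bound on the trace of the power, which is exactly the
  growth that \<open>psi1\<close> allows.\<close>

definition symmetric_op :: "('a::real_inner \<Rightarrow>\<^sub>L 'a) \<Rightarrow> bool"
  where "symmetric_op A \<longleftrightarrow> (\<forall>x y. A x \<bullet> y = x \<bullet> A y)"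

definition nonneg_op :: "('a::real_inner \<Rightarrow>\<^sub>L 'a) \<Rightarrow> bool"
  where "nonneg_op A \<longleftrightarrow> symmetric_op A \<and> (\<forall>x. 0 \<le> A x \<bullet> x)"

lemma symmetric_opD: "symmetric_op A \<Longrightarrow> A x \<bullet> y = x \<bullet> A y"
  by (simp add: symmetric_op_def)

lemma nonneg_opD: "nonneg_op A \<Longrightarrow> symmetric_op A" "nonneg_op A \<Longrightarrow> 0 \<le> A x \<bullet> x"
  by (simp_all add: nonneg_op_def)

lemma symmetric_op_0 [simp]: "symmetric_op 0"
  and symmetric_op_id [simp]: "symmetric_op id_blinfun"
  and symmetric_op_add: "symmetric_op A \<Longrightarrow> symmetric_op B \<Longrightarrow> symmetric_op (A + B)"
  and symmetric_op_diff: "symmetric_op A \<Longrightarrow> symmetric_op B \<Longrightarrow> symmetric_op (A - B)"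
  and symmetric_op_scaleR: "symmetric_op A \<Longrightarrow> symmetric_op (c *\<^sub>R A)"
  by (simp_all add: symmetric_op_def blinfun.bilinear_simps inner_simps)

lemma symmetric_op_sum: "(\<And>i. i \<in> I \<Longrightarrow> symmetric_op (A i)) \<Longrightarrow> symmetric_op (\<Sum>i\<in>I. A i)"
  by (induction I rule: infinite_finite_induct) (simp_all add: symmetric_op_add)

lemma symmetric_op_compose:
  "symmetric_op A \<Longrightarrow> symmetric_op B \<Longrightarrow> A o\<^sub>L B = B o\<^sub>L A \<Longrightarrow> symmetric_op (A o\<^sub>L B)"
  unfolding symmetric_op_def by (metis blinfun_apply_blinfun_compose)

text \<open>The quadratic \<open>r \<mapsto> A (x + r y) \<bullet> (x + r y)\<close> is nonnegative,
  hence has nonpositive discriminant. The form may be degenerate, so a vanishing leading coefficient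
  is a separate case: there the quadratic is affine in \<open>r\<close> and would take the value -1
  unless \<open>b = 0\<close>.\<close>

lemma nonneg_op_Cauchy_Schwarz:
  assumes "nonneg_op A"
  shows "(A x \<bullet> y)\<^sup>2 \<le> (A x \<bullet> x) * (A y \<bullet> y)"
proof -
  define a b c where "a = A x \<bullet> x" and "b = A x \<bullet> y" and "c = A y \<bullet> y"
  have nn: "0 \<le> a" "0 \<le> c"
    using nonneg_opD(2)[OF assms] by (auto simp: a_def c_def)
  have b': "A y \<bullet> x = b"
    using assms by (metis b_def inner_commute nonneg_opD(1) symmetric_opD)
  have quad: "0 \<le> a + 2 * r * b + r\<^sup>2 * c" for r
  proof -
    have "0 \<le> A (x + r *\<^sub>R y) \<bullet> (x + r *\<^sub>R y)"
      using nonneg_opD(2)[OF assms] .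
    also have "\<dots> = a + 2 * r * b + r\<^sup>2 * c"
      by (simp add: blinfun.bilinear_simps inner_simps b' power2_eq_square algebra_simps
          flip: a_def b_def c_def)
    finally show ?thesis .
  qed
  have "b\<^sup>2 \<le> a * c"
  proof (cases "c = 0")
    case True
    have "b = 0"
    proof (rule ccontr)
      assume "b \<noteq> 0"
      have "a + 2 * (- (a + 1) / (2 * b)) * b = - 1"
        using \<open>b \<noteq> 0\<close> by (simp add: field_simps)
      with quad[of "- (a + 1) / (2 * b)"] True show False
        by simp
    qed
    with True show ?thesis by simp
  next
    case False
    with nn have "c > 0" by simp
    have "0 \<le> c * (a + 2 * (- b / c) * b + (- b / c)\<^sup>2 * c)"
      using quad[of "- b / c"] nn by simp
    also have "\<dots> = a * c - b\<^sup>2"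
      using \<open>c > 0\<close> by (simp add: field_simps power2_eq_square)
    finally show ?thesis by simp
  qed
  then show ?thesis
    by (simp add: a_def b_def c_def)
qed

text \<open>This is \<open>A^2 \<le> c A\<close>: Cauchy-Schwarz for the form of \<open>A\<close>
  with \<open>y = A x\<close>, the upper bound used at \<open>A x\<close>, and one factor
  \<open>A x \<bullet> A x\<close> cancelled.\<close>

lemma nonneg_op_norm_le:
  assumes "nonneg_op A" and "\<And>x. A x \<bullet> x \<le> c * (x \<bullet> x)"
  shows "(norm (A x))\<^sup>2 \<le> c * (A x \<bullet> x)"
proof (cases "A x = 0")
  case False
  let ?n = "A x \<bullet> A x"
  have pos: "?n > 0" using False by simp
  have "?n\<^sup>2 \<le> (A x \<bullet> x) * (A (A x) \<bullet> A x)"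
    using nonneg_op_Cauchy_Schwarz[OF assms(1), of x "A x"] .
  also have "\<dots> \<le> (A x \<bullet> x) * (c * ?n)"
    using assms(2) nonneg_opD(2)[OF assms(1)] by (intro mult_left_mono)
  finally have "?n * ?n \<le> (c * (A x \<bullet> x)) * ?n"
    by (simp add: power2_eq_square algebra_simps)
  then show ?thesis
    using pos by (simp add: power2_norm_eq_inner)
qed simp

lemma nonneg_op_apply_eq_0:
  assumes "nonneg_op A" "A x \<bullet> x = 0"
  shows "A x = 0"
  using nonneg_op_Cauchy_Schwarz[OF assms(1), of x "A x"] assms(2) by simp

lemma symmetric_op_eqI:
  assumes "symmetric_op A" "symmetric_op B" "\<And>x. A x \<bullet> x = B x \<bullet> x"
  shows "A = B"
proof -
  have "nonneg_op (A - B)"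
    using assms by (auto simp: nonneg_op_def symmetric_op_diff blinfun.bilinear_simps inner_simps)
  from nonneg_op_apply_eq_0[OF this] have "(A - B) x = 0" for x
    using assms by (auto simp: blinfun.bilinear_simps inner_simps)
  then show ?thesis
    by (auto intro!: blinfun_eqI simp: blinfun.bilinear_simps)
qed

lemma abs_inner_op_le: "\<bar>A x \<bullet> x\<bar> \<le> norm A * (x \<bullet> x)" for A :: "'a::real_inner \<Rightarrow>\<^sub>L 'a"
proof -
  have "\<bar>A x \<bullet> x\<bar> \<le> norm (A x) * norm x"
    by (rule Cauchy_Schwarz_ineq2)
  also have "\<dots> \<le> (norm A * norm x) * norm x"
    by (intro mult_right_mono norm_blinfun norm_ge_zero)
  finally show ?thesis
    by (simp add: power2_norm_eq_inner[symmetric] power2_eq_square algebra_simps)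
qed

lemma inner_op_le: "A x \<bullet> x \<le> norm A * (x \<bullet> x)" for A :: "'a::real_inner \<Rightarrow>\<^sub>L 'a"
  using abs_inner_op_le[of A x] by linarith

section \<open>Strong limits of bounded operators\<close>

lemma tendsto_blinfun_apply_right:
  "X \<longlonglongrightarrow> x \<Longrightarrow> (\<lambda>n. blinfun_apply A (X n)) \<longlonglongrightarrow> A x"
  by (intro tendsto_intros)

text \<open>Squares are nonnegative, so the hypothesis already makes \<open>a\<close> increasing;
  being bounded above it converges, and its increments control the distances. Every completeness
  argument below is brought to this shape.\<close>

lemma Cauchy_of_dist_sq_le:
  fixes X :: "nat \<Rightarrow> 'a::metric_space" and a :: "nat \<Rightarrow> real"
  assumes le: "\<And>m n. m \<le> n \<Longrightarrow> (dist (X m) (X n))\<^sup>2 \<le> a n - a m" and bound: "\<And>n. a n \<le> K"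
  shows "Cauchy X"
proof (rule metric_CauchyI)
  fix e :: real assume "e > 0"
  have mono: "a m \<le> a n" if "m \<le> n" for m n
    using le[OF that] zero_le_power2[of "dist (X m) (X n)"] by linarith
  have "Bseq a"
  proof (rule BseqI')
    show "norm (a n) \<le> \<bar>K\<bar> + \<bar>a 0\<bar>" for n
      using bound[of n] mono[of 0 n] by simp
  qed
  then have "convergent a"
    using mono by (intro Bseq_mono_convergent) auto
  then obtain M where M: "\<And>m n. m \<ge> M \<Longrightarrow> n \<ge> M \<Longrightarrow> dist (a m) (a n) < e\<^sup>2"
    using convergent_Cauchy[of a] \<open>e > 0\<close> unfolding Cauchy_def by (meson zero_less_power)
  have less: "dist (X m) (X n) < e" if "M \<le> m" "m \<le> n" for m n
  proof -
    have "(dist (X m) (X n))\<^sup>2 < e\<^sup>2"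
      using le[OF that(2)] M[of m n] that by (simp add: dist_real_def)
    then show ?thesis
      using \<open>e > 0\<close> by (simp add: power2_less_imp_less)
  qed
  show "\<exists>M. \<forall>m\<ge>M. \<forall>n\<ge>M. dist (X m) (X n) < e"
  proof (intro exI allI impI)
    fix m n assume "m \<ge> M" "n \<ge> M"
    then show "dist (X m) (X n) < e"
      using less[of m n] less[of n m] by (cases "m \<le> n") (auto simp: dist_commute)
  qed
qed

lemma pointwise_limit_blinfun:
  fixes B :: "nat \<Rightarrow> 'a::real_normed_vector \<Rightarrow>\<^sub>L 'b::real_normed_vector"
  assumes conv: "\<And>v. convergent (\<lambda>n. B n v)" and bound: "\<And>n v. norm (B n v) \<le> K * norm v"
  obtains L :: "'a \<Rightarrow>\<^sub>L 'b" where "\<And>v. (\<lambda>n. B n v) \<longlonglongrightarrow> blinfun_apply L v"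
proof -
  define l where "l v = lim (\<lambda>n. B n v)" for v
  have l: "(\<lambda>n. B n v) \<longlonglongrightarrow> l v" for v
    using conv by (simp add: l_def convergent_LIMSEQ_iff)
  have "bounded_linear l"
  proof (rule bounded_linear_intro)
    show "l (x + y) = l x + l y" for x y
      using LIMSEQ_unique[of "\<lambda>n. B n (x + y)", OF l] tendsto_add[OF l l, of x y]
      by (simp add: blinfun.bilinear_simps)
    show "l (r *\<^sub>R x) = r *\<^sub>R l x" for r x
      using LIMSEQ_unique[of "\<lambda>n. B n (r *\<^sub>R x)", OF l] tendsto_scaleR[OF tendsto_const l, of r x]
      by (simp add: blinfun.bilinear_simps)
    show "norm (l x) \<le> norm x * K" for x
      using tendsto_norm[OF l] by (rule LIMSEQ_le_const2) (use bound in \<open>auto simp: mult.commute\<close>)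
  qed
  then have "(\<lambda>n. B n v) \<longlonglongrightarrow> Blinfun l v" for v
    by (simp add: bounded_linear_Blinfun_apply l)
  then show ?thesis
    using that by blast
qed

lemma symmetric_op_limit:
  assumes "\<And>n. symmetric_op (B n)" "\<And>v. (\<lambda>n. B n v) \<longlonglongrightarrow> blinfun_apply L v"
  shows "symmetric_op L"
  unfolding symmetric_op_def
proof (intro allI)
  fix x y
  have "(\<lambda>n. B n x \<bullet> y) \<longlonglongrightarrow> L x \<bullet> y" "(\<lambda>n. B n x \<bullet> y) \<longlonglongrightarrow> x \<bullet> L y"
    using tendsto_inner[OF assms(2) tendsto_const] tendsto_inner[OF tendsto_const assms(2), of x y]
    by (simp_all add: symmetric_opD[OF assms(1)])
  then show "L x \<bullet> y = x \<bullet> L y"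
    by (rule LIMSEQ_unique)
qed

lemma commute_limit:
  assumes "\<And>n. C o\<^sub>L B n = B n o\<^sub>L C" "\<And>v. (\<lambda>n. B n v) \<longlonglongrightarrow> blinfun_apply L v"
  shows "C o\<^sub>L L = L o\<^sub>L C"
proof (rule blinfun_eqI)
  fix v
  have "(\<lambda>n. C (B n v)) \<longlonglongrightarrow> C (L v)"
    by (intro tendsto_blinfun_apply_right assms)
  moreover have "(\<lambda>n. C (B n v)) \<longlonglongrightarrow> L (C v)"
    using assms(1)[THEN arg_cong, of "\<lambda>X. blinfun_apply X v"] assms(2)[of "C v"] by simp
  ultimately show "(C o\<^sub>L L) v = (L o\<^sub>L C) v"
    by (simp add: LIMSEQ_unique)
qed

text \<open>Since \<open>0 \<le> D \<le> c\<close> implies \<open>D\<^sup>2 \<le> c D\<close>, convergence of the quadratic forms forces strong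
  convergence.\<close>

lemma incseq_op_strong_limit:
  fixes B :: "nat \<Rightarrow> 'a::{real_inner,complete_space} \<Rightarrow>\<^sub>L 'a"
  assumes sym: "\<And>n. symmetric_op (B n)"
    and mono: "\<And>m n v. m \<le> n \<Longrightarrow> B m v \<bullet> v \<le> B n v \<bullet> v"
    and lower: "\<And>n v. 0 \<le> B n v \<bullet> v" and upper: "\<And>n v. B n v \<bullet> v \<le> c * (v \<bullet> v)"
  obtains L :: "'a \<Rightarrow>\<^sub>L 'a" where "symmetric_op L" "\<And>v. (\<lambda>n. B n v) \<longlonglongrightarrow> blinfun_apply L v"
proof -
  \<comment> \<open>The absolute value of \<open>c\<close> covers the trivial space, the only case
    in which \<open>lower\<close> and \<open>upper\<close> allow a negative
    \<open>c\<close>.\<close>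
  have diff: "(norm (B n v - B m v))\<^sup>2 \<le> \<bar>c\<bar> * (B n v \<bullet> v - B m v \<bullet> v)" if "m \<le> n" for m n v
  proof -
    have nn: "nonneg_op (B n - B m)"
      using sym mono[OF that]
      by (auto simp: nonneg_op_def symmetric_op_diff blinfun.bilinear_simps inner_simps)
    have "(B n - B m) x \<bullet> x \<le> \<bar>c\<bar> * (x \<bullet> x)" for x
    proof -
      have "c * (x \<bullet> x) \<le> \<bar>c\<bar> * (x \<bullet> x)" by (intro mult_right_mono) auto
      then show ?thesis
        using upper[of n x] lower[of m x] by (simp add: blinfun.bilinear_simps inner_simps)
    qed
    from nonneg_op_norm_le[OF nn this] show ?thesis
      by (simp add: blinfun.bilinear_simps inner_simps)
  qed
  have "Cauchy (\<lambda>n. B n v)" for v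
  proof (rule Cauchy_of_dist_sq_le)
    show "(dist (B m v) (B n v))\<^sup>2 \<le> \<bar>c\<bar> * (B n v \<bullet> v) - \<bar>c\<bar> * (B m v \<bullet> v)" if "m \<le> n" for m n
      using diff[OF that, of v] by (simp add: dist_norm norm_minus_commute right_diff_distrib)
    show "\<bar>c\<bar> * (B n v \<bullet> v) \<le> \<bar>c\<bar> * (c * (v \<bullet> v))" for n
      using upper by (intro mult_left_mono) auto
  qed
  then have conv: "convergent (\<lambda>n. B n v)" for v
    by (simp add: Cauchy_convergent_iff)
  have "norm (B n v) \<le> \<bar>c\<bar> * norm v" for n v
  proof (rule power2_le_imp_le)
    have *: "B n x \<bullet> x \<le> \<bar>c\<bar> * (x \<bullet> x)" for x
      using upper[of n x] by (rule order_trans) (intro mult_right_mono, auto)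
    have "(norm (B n v))\<^sup>2 \<le> \<bar>c\<bar> * (B n v \<bullet> v)"
      by (rule nonneg_op_norm_le) (use sym lower * in \<open>auto simp: nonneg_op_def\<close>)
    also have "\<dots> \<le> \<bar>c\<bar> * (\<bar>c\<bar> * (v \<bullet> v))"
      using * by (intro mult_left_mono) auto
    finally show "(norm (B n v))\<^sup>2 \<le> (\<bar>c\<bar> * norm v)\<^sup>2"
      by (simp add: power2_norm_eq_inner[symmetric] power2_eq_square algebra_simps)
  qed auto
  from pointwise_limit_blinfun[OF conv this] obtain L where L: "\<And>v. (\<lambda>n. B n v) \<longlonglongrightarrow> blinfun_apply L v"
    by blast
  then show ?thesis
    using that symmetric_op_limit[OF sym L] by blast
qed

text \<open>F. Riesz's argument: for \<open>0 \<le> A \<le> 1\<close> the recursion \<open>A\<^sub>0 = A\<close>, \<open>A\<^sub>n\<^sub>+\<^sub>1 = A\<^sub>n - A\<^sub>n\<^sup>2\<close> writes \<open>A\<close> as the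
  strongly convergent sum of the squares \<open>A\<^sub>n\<^sup>2\<close>.\<close>

lemma nonneg_op_compose_contraction:
  assumes A: "nonneg_op A" "\<And>x. A x \<bullet> x \<le> x \<bullet> x" and B: "nonneg_op B" and AB: "A o\<^sub>L B = B o\<^sub>L A"
  shows "0 \<le> A (B x) \<bullet> x"
proof -
  define R where "R n = ((\<lambda>X. X - (X o\<^sub>L X)) ^^ n) A" for n
  have R0: "R 0 = A" and RS: "R (Suc n) = R n - (R n o\<^sub>L R n)" for n
    by (simp_all add: R_def)
  have RSv: "R (Suc n) v = R n v - R n (R n v)" for n v
    by (simp add: RS blinfun.bilinear_simps)
  have RB: "R n (B v) = B (R n v)" for n v
  proof (induction n arbitrary: v)
    case 0
    then show ?case using AB[THEN arg_cong, of "\<lambda>X. blinfun_apply X v"] by (simp add: R0)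
  qed (simp add: RSv blinfun.bilinear_simps)
  have "nonneg_op (R n) \<and> (\<forall>x. R n x \<bullet> x \<le> x \<bullet> x)" for n
  proof (induction n)
    case 0
    then show ?case using A by (simp add: R0)
  next
    case (Suc n)
    then have s: "symmetric_op (R n)" and pos: "\<And>x. 0 \<le> R n x \<bullet> x" and le: "\<And>x. R n x \<bullet> x \<le> x \<bullet> x"
      by (auto simp: nonneg_op_def)
    have sym: "symmetric_op (R (Suc n))"
      using s by (simp add: RS symmetric_op_diff symmetric_op_compose)
    have "0 \<le> R (Suc n) x \<bullet> x" for x
    proof -
      \<comment> \<open>Behind the identity is
        \<open>R - R^2 = R (1 - R) R + (1 - R) R (1 - R)\<close>, a sum of two operators with
        nonnegative form.\<close>
      let ?y = "x - R n x"
      have "R (Suc n) x \<bullet> x = (R n x \<bullet> R n x - R n (R n x) \<bullet> R n x) + R n ?y \<bullet> ?y"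
        by (simp add: RSv blinfun.bilinear_simps inner_simps symmetric_opD[OF s] inner_commute)
      then show ?thesis using le[of "R n x"] pos[of ?y] by simp
    qed
    moreover have "R (Suc n) x \<bullet> x \<le> x \<bullet> x" for x
    proof -
      have "R n (R n x) \<bullet> x = R n x \<bullet> R n x" by (simp add: symmetric_opD[OF s])
      moreover have "0 \<le> R n x \<bullet> R n x" by simp
      ultimately show ?thesis using le[of x] unfolding RSv inner_diff_left by linarith
    qed
    ultimately show ?case using sym by (simp add: nonneg_op_def)
  qed
  then have s: "symmetric_op (R n)" and pos: "0 \<le> R n x \<bullet> x" for n x
    by (auto simp: nonneg_op_def)
  have tele: "(\<Sum>k<n. R k (R k v)) = A v - R n v" for n v
    by (induction n) (simp_all add: R0 RSv)
  have "summable (\<lambda>k. R k x \<bullet> R k x)"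
  proof (rule summableI_nonneg_bounded)
    show "(\<Sum>k<n. R k x \<bullet> R k x) \<le> A x \<bullet> x" for n
    proof -
      have "(\<Sum>k<n. R k x \<bullet> R k x) = (\<Sum>k<n. R k (R k x)) \<bullet> x"
        by (simp add: inner_sum_left symmetric_opD[OF s])
      also have "\<dots> = A x \<bullet> x - R n x \<bullet> x" by (simp add: tele inner_simps)
      finally show ?thesis using pos[of n x] by simp
    qed
  qed simp
  then have "(\<lambda>k. R k x \<bullet> R k x) \<longlonglongrightarrow> 0"
    by (rule summable_LIMSEQ_zero)
  then have "(\<lambda>k. (norm (R k x))\<^sup>2) \<longlonglongrightarrow> 0" by (simp add: power2_norm_eq_inner)
  then have "(\<lambda>k. norm (R k x)) \<longlonglongrightarrow> 0"
    using tendsto_real_sqrt by fastforce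
  then have "(\<lambda>k. R k x) \<longlonglongrightarrow> 0" by (rule tendsto_norm_zero_cancel)
  then have "(\<lambda>n. B (A x - R n x) \<bullet> x) \<longlonglongrightarrow> B (A x - 0) \<bullet> x"
    by (intro tendsto_intros)
  moreover have "0 \<le> B (A x - R n x) \<bullet> x" for n
  proof -
    have "B (A x - R n x) \<bullet> x = (\<Sum>k<n. B (R k (R k x)) \<bullet> x)"
      by (simp flip: tele add: blinfun.sum_right inner_sum_left)
    also have "\<dots> = (\<Sum>k<n. B (R k x) \<bullet> R k x)"
      by (simp add: RB[symmetric] symmetric_opD[OF s])
    finally show ?thesis using nonneg_opD(2)[OF B] by (simp add: sum_nonneg)
  qed
  ultimately have "0 \<le> B (A x) \<bullet> x"
    by (simp add: LIMSEQ_le_const)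
  then show ?thesis
    using AB[THEN arg_cong, of "\<lambda>X. blinfun_apply X x"] by simp
qed

lemma nonneg_op_compose:
  assumes A: "nonneg_op A" and B: "nonneg_op B" and AB: "A o\<^sub>L B = B o\<^sub>L A"
  shows "nonneg_op (A o\<^sub>L B)"
proof -
  \<comment> \<open>The \<open>+ 1\<close> keeps \<open>c\<close> defined and positive for
    \<open>A = 0\<close>.\<close>
  define c where "c = inverse (norm A + 1)"
  have c: "c > 0" by (simp add: c_def add_nonneg_pos)
  have "0 \<le> A (B x) \<bullet> x" for x
  proof -
    have nn: "nonneg_op (c *\<^sub>R A)"
      using A c by (simp add: nonneg_op_def symmetric_op_scaleR blinfun.bilinear_simps)
    have le: "(c *\<^sub>R A) x \<bullet> x \<le> x \<bullet> x" for x
    proof -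
      have "(c *\<^sub>R A) x \<bullet> x \<le> c * ((norm A + 1) * (x \<bullet> x))"
        using inner_op_le[of A x] c
        by (simp add: blinfun.bilinear_simps) (simp add: distrib_right add_increasing2)
      also have "\<dots> = x \<bullet> x"
        using c by (simp add: c_def)
      finally show ?thesis .
    qed
    have "(c *\<^sub>R A) o\<^sub>L B = B o\<^sub>L (c *\<^sub>R A)"
    proof (rule blinfun_eqI)
      fix v show "((c *\<^sub>R A) o\<^sub>L B) v = (B o\<^sub>L (c *\<^sub>R A)) v"
        using AB[THEN arg_cong, of "\<lambda>X. blinfun_apply X v"] by (simp add: blinfun.bilinear_simps)
    qed
    from nonneg_op_compose_contraction[OF nn le B this, of x] c show ?thesis
      by (simp add: blinfun.bilinear_simps zero_le_mult_iff)
  qed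
  then show ?thesis
    using symmetric_op_compose[OF nonneg_opD(1)[OF A] nonneg_opD(1)[OF B] AB]
    by (simp add: nonneg_op_def)
qed

text \<open>\<open>A\<close> and \<open>B\<close> are not assumed to commute. Equality of the
  squares gives \<open>D B = - A D\<close> and \<open>D A = - B D\<close> for
  \<open>D = A - B\<close>, so \<open>A\<close> commutes with \<open>D^2\<close>. Then
  \<open>A D^2 = - D B D\<close> is both nonnegative and nonpositive, whence \<open>B D = 0\<close>
  and \<open>D^3 = 0\<close>, and a nilpotent symmetric operator vanishes. This identifies
  \<open>op_abs\<close> on positive operators.\<close>

lemma nonneg_op_square_eq:
  assumes A: "nonneg_op A" and B: "nonneg_op B" and eq: "A o\<^sub>L A = B o\<^sub>L B"
  shows "A = B"
proof -
  define D where "D = A - B"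
  have sA: "symmetric_op A" and sB: "symmetric_op B" using A B by (auto simp: nonneg_op_def)
  have sD: "symmetric_op D" using sA sB by (simp add: D_def symmetric_op_diff)
  have eqv: "A (A v) = B (B v)" for v
    using eq[THEN arg_cong, of "\<lambda>X. blinfun_apply X v"] by simp
  have DB: "D (B v) = - A (D v)" and DA: "D (A v) = - B (D v)" for v
    by (simp_all add: D_def blinfun.bilinear_simps eqv)
  have "A o\<^sub>L (D o\<^sub>L D) = (D o\<^sub>L D) o\<^sub>L A"
    by (rule blinfun_eqI) (simp add: DA DB blinfun.bilinear_simps)
  moreover have "nonneg_op (D o\<^sub>L D)"
    using sD symmetric_opD[OF sD, of "D x" x for x]
    by (simp add: nonneg_op_def symmetric_op_compose)
  ultimately have "nonneg_op (A o\<^sub>L (D o\<^sub>L D))"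
    using nonneg_op_compose[OF A] by blast
  then have "0 \<le> A (D (D v)) \<bullet> v" for v by (auto simp: nonneg_op_def)
  moreover have "A (D (D v)) \<bullet> v = - (B (D v) \<bullet> D v)" for v
    using DB[of "D v"] by (simp add: symmetric_opD[OF sD, symmetric])
  moreover have "0 \<le> B (D v) \<bullet> D v" for v
    using nonneg_opD(2)[OF B] .
  ultimately have BD: "B (D v) = 0" for v
    by (intro nonneg_op_apply_eq_0[OF B]) (metis antisym neg_0_le_iff_le)
  have "D (D (D v)) = 0" for v
    using DB[of "D v"] DA[of "D v"] BD[of v] BD[of "D v"]
    by (simp add: D_def blinfun.bilinear_simps)
  then have "D (D v) \<bullet> D (D v) = 0" for v
    by (simp add: symmetric_opD[OF sD] blinfun.bilinear_simps)
  then have "D (D v) \<bullet> v = 0" for v by simp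
  then have "D v \<bullet> D v = 0" for v
    by (simp add: symmetric_opD[OF sD])
  then have "D v = 0" for v by simp
  then show ?thesis by (auto intro!: blinfun_eqI simp: D_def blinfun.bilinear_simps)
qed

section \<open>The sign projection of a symmetric operator\<close>

text \<open>Horner evaluation of a polynomial at an operator. Identities proved in the ring
  \<open>real poly\<close> transfer to operators through it.\<close>

definition op_poly :: "('a::real_normed_vector \<Rightarrow>\<^sub>L 'a) \<Rightarrow> real poly \<Rightarrow> ('a \<Rightarrow>\<^sub>L 'a)"
  where "op_poly C p = fold_coeffs (\<lambda>a B. a *\<^sub>R id_blinfun + (C o\<^sub>L B)) p 0"

lemma op_poly_0 [simp]: "op_poly C 0 = 0"
  by (simp add: op_poly_def)

lemma op_poly_pCons: "op_poly C (pCons a p) v = a *\<^sub>R v + C (op_poly C p v)"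
  by (cases "p = 0 \<and> a = 0") (auto simp: op_poly_def blinfun.bilinear_simps)

lemma op_poly_1 [simp]: "op_poly C 1 v = v"
  by (simp add: one_pCons op_poly_pCons blinfun.bilinear_simps)

lemma op_poly_const: "op_poly C [:c:] v = c *\<^sub>R v"
  by (simp add: op_poly_pCons blinfun.bilinear_simps)

lemma op_poly_X [simp]: "op_poly C [:0, 1:] v = C v"
  by (simp add: op_poly_pCons blinfun.bilinear_simps)

lemma op_poly_add: "op_poly C (p + q) v = op_poly C p v + op_poly C q v"
  by (induction p q rule: poly_induct2)
    (simp_all add: op_poly_pCons blinfun.bilinear_simps algebra_simps)

lemma op_poly_smult: "op_poly C (smult c p) v = c *\<^sub>R op_poly C p v"
  by (induction p) (simp_all add: op_poly_pCons blinfun.bilinear_simps algebra_simps)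

lemma op_poly_diff: "op_poly C (p - q) v = op_poly C p v - op_poly C q v"
  using op_poly_add[of C "p - q" q v] by simp

lemma op_poly_mult: "op_poly C (p * q) v = op_poly C p (op_poly C q v)"
  by (induction p)
    (simp_all add: op_poly_pCons op_poly_add op_poly_smult blinfun.bilinear_simps)

lemma op_poly_commute:
  assumes "C o\<^sub>L B = B o\<^sub>L C"
  shows "op_poly C p o\<^sub>L B = B o\<^sub>L op_poly C p"
proof (rule blinfun_eqI)
  fix v
  have "C (B w) = B (C w)" for w
    using assms[THEN arg_cong, of "\<lambda>X. blinfun_apply X w"] by simp
  then have "op_poly C p (B v) = B (op_poly C p v)"
    by (induction p) (simp_all add: op_poly_pCons blinfun.bilinear_simps)
  then show "(op_poly C p o\<^sub>L B) v = (B o\<^sub>L op_poly C p) v" by simp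
qed

lemma op_poly_commute_op_poly: "op_poly C p o\<^sub>L op_poly C q = op_poly C q o\<^sub>L op_poly C p"
  by (intro op_poly_commute) (metis op_poly_commute)

lemma symmetric_op_poly:
  assumes "symmetric_op C"
  shows "symmetric_op (op_poly C p)"
proof (induction p)
  case (pCons a p)
  have "C (op_poly C p v) = op_poly C p (C v)" for v
    using op_poly_commute[of C C p, THEN arg_cong, of "\<lambda>X. blinfun_apply X v"] by simp
  with pCons(2) assms show ?case
    by (simp add: symmetric_op_def op_poly_pCons inner_simps)
qed simp

text \<open>The iteration \<open>x \<mapsto> x (3 - x\<^sup>2) / 2\<close> converges to \<open>sgn x\<close> on \<open>[-1, 1]\<close>. All its iterates are
  multiples \<open>x g\<^sub>n(x)\<close> of the identity.\<close>

primrec sign_factor :: "nat \<Rightarrow> real poly" where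
  "sign_factor 0 = 1"
| "sign_factor (Suc n) = [:1/2:] * (sign_factor n * (3 - ([:0, 1:] * sign_factor n)\<^sup>2))"

abbreviation sign_poly :: "nat \<Rightarrow> real poly"
  where "sign_poly n \<equiv> [:0, 1:] * sign_factor n"

text \<open>Nonnegativity of the operator \<open>p(C)\<close>, a substitute for nonnegativity of
  \<open>p\<close> on the spectrum before any spectral theory exists. It is preserved by sums and
  products and holds for squares and nonnegative constants, so an inequality reduces to a polynomial
  identity that exhibits such a combination.\<close>

definition nonneg_on_op :: "('a::real_inner \<Rightarrow>\<^sub>L 'a) \<Rightarrow> real poly \<Rightarrow> bool"
  where "nonneg_on_op C p \<longleftrightarrow> nonneg_op (op_poly C p)"

lemma nonneg_on_opD: "nonneg_on_op C p \<Longrightarrow> 0 \<le> op_poly C p v \<bullet> v"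
  by (simp add: nonneg_on_op_def nonneg_opD)

context
  fixes C :: "'a::{real_inner,complete_space} \<Rightarrow>\<^sub>L 'a"
  assumes sym: "symmetric_op C"
begin

lemma nonneg_on_op_add: "nonneg_on_op C p \<Longrightarrow> nonneg_on_op C q \<Longrightarrow> nonneg_on_op C (p + q)"
  by (simp add: nonneg_on_op_def nonneg_op_def symmetric_op_poly[OF sym] op_poly_add inner_simps)

lemma nonneg_on_op_const: "0 \<le> c \<Longrightarrow> nonneg_on_op C [:c:]"
  by (simp add: nonneg_on_op_def nonneg_op_def symmetric_op_poly[OF sym] op_poly_pCons
      blinfun.bilinear_simps)

lemma nonneg_on_op_mult:
  assumes "nonneg_on_op C p" "nonneg_on_op C q"
  shows "nonneg_on_op C (p * q)"
proof -
  have "nonneg_op (op_poly C p o\<^sub>L op_poly C q)"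
    using assms nonneg_op_compose[OF _ _ op_poly_commute_op_poly] by (auto simp: nonneg_on_op_def)
  moreover have "op_poly C p o\<^sub>L op_poly C q = op_poly C (p * q)"
    by (rule blinfun_eqI) (simp add: op_poly_mult)
  ultimately show ?thesis by (simp add: nonneg_on_op_def)
qed

lemma inner_op_poly_square: "op_poly C (p\<^sup>2) v \<bullet> v = (norm (op_poly C p v))\<^sup>2"
  using symmetric_opD[OF symmetric_op_poly[OF sym], of p "op_poly C p v" v]
  by (simp add: power2_eq_square[of p] op_poly_mult power2_norm_eq_inner)

lemma nonneg_on_op_square: "nonneg_on_op C (p\<^sup>2)"
  by (simp add: nonneg_on_op_def nonneg_op_def inner_op_poly_square symmetric_op_poly[OF sym])

context
  assumes norm_le: "norm C \<le> 1"
begin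

text \<open>One step of the iteration sends \<open>z = 1 - p^2\<close> to
  \<open>z^2 (3 + z) / 4\<close>, a product of nonnegative factors. The start is
  \<open>1 - C^2 \<ge> 0\<close>, which is the contraction hypothesis.\<close>

lemma nonneg_on_op_one_minus_sign: "nonneg_on_op C (1 - (sign_poly n)\<^sup>2)"
proof (induction n)
  case 0
  have "op_poly C (1 - (sign_poly 0)\<^sup>2) v \<bullet> v = v \<bullet> v - C v \<bullet> C v" for v
    using inner_op_poly_square[of "[:0, 1:]" v]
    by (simp add: op_poly_diff inner_diff_left power2_norm_eq_inner)
  moreover have "C v \<bullet> C v \<le> v \<bullet> v" for v
  proof -
    have "norm (C v) \<le> norm v"
      using norm_blinfun[of C v] norm_le mult_right_mono[OF norm_le norm_ge_zero[of v]] by linarith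
    then show ?thesis by (simp add: norm_le_square power2_norm_eq_inner)
  qed
  ultimately show ?case
    by (simp add: nonneg_on_op_def nonneg_op_def symmetric_op_poly[OF sym])
next
  case (Suc n)
  let ?h = "[:1/2:] :: real poly"
  define z where "z = 1 - (sign_poly n)\<^sup>2"
  have h: "2 * ?h = 1" by (simp add: numeral_poly one_pCons)
  have "1 - (sign_poly (Suc n))\<^sup>2 = ?h * ?h * (z * z * ([:3:] + z))"
    using h unfolding z_def sign_factor.simps numeral_poly[symmetric] by algebra
  moreover have "nonneg_on_op C (?h * ?h * (z * z * ([:3:] + z)))"
    using Suc by (intro nonneg_on_op_mult nonneg_on_op_add nonneg_on_op_const) (auto simp: z_def)
  ultimately show ?case by simp
qed

lemma nonneg_on_op_sign_factor: "nonneg_on_op C (sign_factor n)"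
proof (induction n)
  case 0
  then show ?case using nonneg_on_op_const[of 1] by (simp add: one_pCons)
next
  case (Suc n)
  have "sign_factor (Suc n) = [:1/2:] * (sign_factor n * ([:2:] + (1 - (sign_poly n)\<^sup>2)))"
    unfolding sign_factor.simps numeral_poly[symmetric] by algebra
  also have "nonneg_on_op C \<dots>"
    using Suc
    by (intro nonneg_on_op_mult nonneg_on_op_add nonneg_on_op_const nonneg_on_op_one_minus_sign) auto
  finally show ?case .
qed

text \<open>Each step adds half of \<open>g (1 - p^2)\<close> to the factor \<open>g\<close>.
  Monotonicity is stated for the factors because the iterates \<open>x g(x)\<close> themselves
  increase only in absolute value.\<close>

lemma nonneg_on_op_sign_factor_diff:
  assumes "m \<le> n"
  shows "nonneg_on_op C (sign_factor n - sign_factor m)"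
  using assms
proof (induction n rule: dec_induct)
  case base
  then show ?case using nonneg_on_op_const[of 0] by simp
next
  case (step n)
  let ?h = "[:1/2:] :: real poly"
  have h: "2 * ?h = 1" by (simp add: numeral_poly one_pCons)
  have "sign_factor (Suc n) - sign_factor m =
      (sign_factor n - sign_factor m) + ?h * (sign_factor n * (1 - (sign_poly n)\<^sup>2))"
    using h unfolding sign_factor.simps by algebra
  also have "nonneg_on_op C \<dots>"
    using step
    by (intro nonneg_on_op_mult nonneg_on_op_add nonneg_on_op_const nonneg_on_op_one_minus_sign
        nonneg_on_op_sign_factor) auto
  finally show ?case .
qed

text \<open>\<open>p^2 - q^2 - (p - q)^2 = 2 q (p - q)\<close>, and after factoring out
  \<open>x^2\<close> only the nonnegative and increasing factors remain. The squared norms thus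
  serve as the bounded increasing sequence of \<open>Cauchy_of_dist_sq_le\<close>.\<close>

lemma sign_poly_norm_mono_diff:
  assumes "m \<le> n"
  shows "(norm (op_poly C (sign_poly n) v - op_poly C (sign_poly m) v))\<^sup>2
    \<le> (norm (op_poly C (sign_poly n) v))\<^sup>2 - (norm (op_poly C (sign_poly m) v))\<^sup>2"
proof -
  define p where "p = sign_poly n"
  define q where "q = sign_poly m"
  have "p\<^sup>2 - q\<^sup>2 - (p - q)\<^sup>2 =
      [:2:] * ([:0, 1:]\<^sup>2 * (sign_factor m * (sign_factor n - sign_factor m)))"
    unfolding p_def q_def numeral_poly[symmetric] by algebra
  also have "nonneg_on_op C \<dots>"
    using assms
    by (intro nonneg_on_op_mult nonneg_on_op_const nonneg_on_op_square nonneg_on_op_sign_factor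
        nonneg_on_op_sign_factor_diff) auto
  finally have "0 \<le> op_poly C (p\<^sup>2 - q\<^sup>2 - (p - q)\<^sup>2) v \<bullet> v"
    by (rule nonneg_on_opD)
  then show ?thesis
    by (simp add: op_poly_diff inner_diff_left inner_op_poly_square p_def q_def del: mult_pCons_left)
qed

lemma norm_sign_poly_le: "norm (op_poly C (sign_poly n) v) \<le> norm v"
proof (rule power2_le_imp_le)
  show "(norm (op_poly C (sign_poly n) v))\<^sup>2 \<le> (norm v)\<^sup>2"
    using nonneg_on_opD[OF nonneg_on_op_one_minus_sign, of n v]
    by (simp add: op_poly_diff inner_diff_left inner_op_poly_square power2_norm_eq_inner[of v]
        del: mult_pCons_left)
qed simp

text \<open>\<open>p^2 - x^2 = x^2 (g - 1) (g + 1)\<close> with \<open>g \<ge> 1\<close>. The lower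
  bound survives the limit, so the sign operator can vanish only on the kernel of
  \<open>C\<close>.\<close>

lemma norm_le_norm_sign_poly: "norm (C v) \<le> norm (op_poly C (sign_poly n) v)"
proof (rule power2_le_imp_le)
  have "(sign_poly n)\<^sup>2 - [:0, 1:]\<^sup>2 =
      [:0, 1:]\<^sup>2 * ((sign_factor n - sign_factor 0) * (sign_factor n + sign_factor 0))"
    by (simp only: sign_factor.simps) algebra
  also have "nonneg_on_op C \<dots>"
    by (intro nonneg_on_op_mult nonneg_on_op_square nonneg_on_op_sign_factor_diff
        nonneg_on_op_add nonneg_on_op_sign_factor) auto
  finally have "0 \<le> op_poly C ((sign_poly n)\<^sup>2 - [:0, 1:]\<^sup>2) v \<bullet> v"
    by (rule nonneg_on_opD)
  then show "(norm (C v))\<^sup>2 \<le> (norm (op_poly C (sign_poly n) v))\<^sup>2"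
    by (simp add: op_poly_diff inner_diff_left inner_op_poly_square del: mult_pCons_left)
qed simp

lemma sign_op_exists:
  obtains S :: "'a \<Rightarrow>\<^sub>L 'a" where
    "\<And>v. (\<lambda>n. op_poly C (sign_poly n) v) \<longlonglongrightarrow> S v"
proof -
  have "Cauchy (\<lambda>n. op_poly C (sign_poly n) v)" for v
  proof (rule Cauchy_of_dist_sq_le)
    show "(dist (op_poly C (sign_poly m) v) (op_poly C (sign_poly n) v))\<^sup>2
        \<le> (norm (op_poly C (sign_poly n) v))\<^sup>2 - (norm (op_poly C (sign_poly m) v))\<^sup>2"
      if "m \<le> n" for m n
      using sign_poly_norm_mono_diff[OF that, of v] by (simp add: dist_norm norm_minus_commute)
    show "(norm (op_poly C (sign_poly n) v))\<^sup>2 \<le> (norm v)\<^sup>2" for n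
      by (intro power_mono norm_sign_poly_le) simp
  qed
  then have "convergent (\<lambda>n. op_poly C (sign_poly n) v)" for v
    by (simp add: Cauchy_convergent_iff)
  moreover have "norm (op_poly C (sign_poly n) v) \<le> 1 * norm v" for n v
    using norm_sign_poly_le by simp
  ultimately show ?thesis
    using pointwise_limit_blinfun[of "\<lambda>n. op_poly C (sign_poly n)" 1] that by blast
qed

text \<open>\<open>S\<close> plays the role of \<open>sgn C\<close>, with value 0 on the kernel of
  \<open>C\<close>, so \<open>Q\<close> is the projection onto the strictly positive part. The last
  property excludes the kernel; it is what later attaches \<open>upper_proj A s\<close> to the open
  half-line \<open>{s<..}\<close>.\<close>

lemma sign_projection_contraction:
  obtains Q :: "'a \<Rightarrow>\<^sub>L 'a" where
    "symmetric_op Q" "\<And>v. Q (Q v) = Q v" "\<And>B. C o\<^sub>L B = B o\<^sub>L C \<Longrightarrow> B o\<^sub>L Q = Q o\<^sub>L B"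
    "\<And>v. 0 \<le> C (Q v) \<bullet> Q v" "\<And>v. C (v - Q v) \<bullet> (v - Q v) \<le> 0" "\<And>v. C v = 0 \<Longrightarrow> Q v = 0"
proof -
  let ?X = "\<lambda>n. op_poly C (sign_poly n)"
  obtain S :: "'a \<Rightarrow>\<^sub>L 'a" where S: "\<And>v. (\<lambda>n. ?X n v) \<longlonglongrightarrow> S v"
    using sign_op_exists by blast
  have symS: "symmetric_op S"
    using symmetric_op_poly[OF sym] S by (rule symmetric_op_limit)
  have comm: "B o\<^sub>L S = S o\<^sub>L B" if "C o\<^sub>L B = B o\<^sub>L C" for B
    by (rule commute_limit[OF op_poly_commute[OF that, symmetric] S])
  \<comment> \<open>Operator and argument vary together; the iterates are contractions, so the
    change of the argument is negligible.\<close>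
  have XX: "(\<lambda>n. ?X n (Y n)) \<longlonglongrightarrow> S y" if "Y \<longlonglongrightarrow> y" for Y y
  proof -
    have "(\<lambda>n. norm (?X n (Y n - y))) \<longlonglongrightarrow> 0"
    proof (rule tendsto_sandwich[where f="\<lambda>_. 0" and h="\<lambda>n. norm (Y n - y)"])
      show "(\<lambda>n. norm (Y n - y)) \<longlonglongrightarrow> 0"
        using that by (simp add: LIM_zero tendsto_norm_zero)
    qed (simp, rule always_eventually, rule allI, rule norm_sign_poly_le, simp)
    then have "(\<lambda>n. ?X n (Y n - y) + ?X n y) \<longlonglongrightarrow> 0 + S y"
      by (intro tendsto_add S) (rule tendsto_norm_zero_cancel)
    then show ?thesis by (simp add: blinfun.bilinear_simps del: mult_pCons_left)
  qed
  \<comment> \<open>The limit of the recursion reads \<open>S = (3 S - S^3) / 2\<close>, that is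
    \<open>S^3 = S\<close>.\<close>
  have S3: "S (S (S v)) = S v" for v
  proof -
    have "?X (Suc n) v = (1/2) *\<^sub>R (3 *\<^sub>R ?X n v - ?X n (?X n (?X n v)))" for n
    proof -
      define P where "P = sign_poly n"
      have "sign_poly (Suc n) = [:1/2:] * (P + P + P - P * (P * P))"
        unfolding sign_factor.simps P_def by algebra
      then have "?X (Suc n) v = (1/2) *\<^sub>R (?X n v + ?X n v + ?X n v - ?X n (?X n (?X n v)))"
        by (simp only: op_poly_const op_poly_add op_poly_diff op_poly_mult P_def)
      also have "?X n v + ?X n v + ?X n v = (1 + 1 + 1) *\<^sub>R ?X n v"
        by (simp only: scaleR_left_distrib scaleR_one)
      finally show ?thesis by (simp del: mult_pCons_left)
    qed
    then have "(\<lambda>n. (1/2) *\<^sub>R (3 *\<^sub>R ?X n v - ?X n (?X n (?X n v)))) \<longlonglongrightarrow> S v"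
      using LIMSEQ_Suc[OF S[of v]] by (simp only:)
    moreover have "(\<lambda>n. (1/2) *\<^sub>R (3 *\<^sub>R ?X n v - ?X n (?X n (?X n v))))
        \<longlonglongrightarrow> (1/2) *\<^sub>R (3 *\<^sub>R S v - S (S (S v)))"
      by (intro tendsto_intros XX S)
    ultimately have half: "S v = (1/2) *\<^sub>R (3 *\<^sub>R S v - S (S (S v)))"
      by (rule LIMSEQ_unique)
    have "S (S (S v)) = 3 *\<^sub>R S v - 2 *\<^sub>R ((1/2) *\<^sub>R (3 *\<^sub>R S v - S (S (S v))))" by simp
    also have "\<dots> = 3 *\<^sub>R S v - 2 *\<^sub>R S v" by (simp only: half[symmetric])
    finally show ?thesis by (simp flip: scaleR_left_diff_distrib)
  qed
  have CSpos: "0 \<le> C (S v) \<bullet> v" for v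
  proof (rule LIMSEQ_le_const)
    show "(\<lambda>n. C (?X n v) \<bullet> v) \<longlonglongrightarrow> C (S v) \<bullet> v"
      by (intro tendsto_intros S)
    have "0 \<le> C (?X n v) \<bullet> v" for n
    proof -
      have "0 \<le> op_poly C ([:0, 1:]\<^sup>2 * sign_factor n) v \<bullet> v"
        by (intro nonneg_on_opD nonneg_on_op_mult nonneg_on_op_square nonneg_on_op_sign_factor)
      moreover have "[:0, 1:]\<^sup>2 * sign_factor n = [:0, 1:] * sign_poly n"
        by algebra
      ultimately show ?thesis by (simp add: op_poly_mult del: mult_pCons_left)
    qed
    then show "\<exists>N. \<forall>n\<ge>N. 0 \<le> C (?X n v) \<bullet> v" by blast
  qed
  have ker: "C v = 0" if "S v = 0" for v
  proof -
    have "norm (C v) \<le> norm (S v)"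
      using tendsto_norm[OF S] by (rule LIMSEQ_le_const) (use norm_le_norm_sign_poly in blast)
    with that show ?thesis by simp
  qed
  \<comment> \<open>The polynomial \<open>(s^2 + s) / 2\<close> takes the value 1 at 1 and 0 at both
    0 and -1.\<close>
  define Q where "Q = (1/2) *\<^sub>R ((S o\<^sub>L S) + S)"
  have Q: "Q v = (1/2) *\<^sub>R (S (S v) + S v)" for v
    by (simp add: Q_def blinfun.bilinear_simps)
  have SQ: "S (Q v) = Q v" for v
    by (simp add: Q S3 blinfun.bilinear_simps add.commute)
  have QQ: "Q (Q v) = Q v" for v
    by (simp add: Q[of "Q v"] SQ flip: scaleR_2)
  have symQ: "symmetric_op Q"
    by (simp add: Q_def symmetric_op_scaleR symmetric_op_add symmetric_op_compose symS)
  have CQ: "0 \<le> C (Q v) \<bullet> Q v" for v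
    using CSpos[of "Q v"] by (simp add: SQ)
  have CR: "C (v - Q v) \<bullet> (v - Q v) \<le> 0" for v
  proof -
    let ?w = "v - Q v"
    \<comment> \<open>On the complement \<open>w\<close> of \<open>Q\<close>,
      \<open>S^2 w = - S w\<close>. Moreover \<open>w - S^2 w\<close> is killed by \<open>S\<close>,
      hence by \<open>C\<close>, so \<open>C w = - C (S w)\<close> and the sign follows from
      \<open>CSpos\<close>.\<close>
    have "S (S v) + S v = Q v + Q v"
      by (simp add: Q flip: scaleR_2)
    then have "S (S ?w) = - S ?w"
      by (simp add: blinfun.diff_right SQ algebra_simps)
    moreover have "C (?w - S (S ?w)) = 0"
      by (intro ker) (simp only: blinfun.diff_right S3 diff_self)
    ultimately have "C ?w = - C (S ?w)"
      by (simp only: blinfun.diff_right[of C] blinfun.minus_right) (simp add: eq_neg_iff_add_eq_0)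
    then show ?thesis using CSpos[of ?w] by simp
  qed
  have comQ: "B o\<^sub>L Q = Q o\<^sub>L B" if "C o\<^sub>L B = B o\<^sub>L C" for B
  proof (rule blinfun_eqI)
    fix v
    have "B (S w) = S (B w)" for w
      using comm[OF that, THEN arg_cong, of "\<lambda>X. blinfun_apply X w"] by simp
    then show "(B o\<^sub>L Q) v = (Q o\<^sub>L B) v" by (simp add: Q blinfun.bilinear_simps)
  qed
  have kerQ: "Q v = 0" if "C v = 0" for v
  proof -
    have "S v = 0"
    proof (rule LIMSEQ_unique[OF S])
      have "?X n v = 0" for n
      proof -
        have "?X n v = op_poly C (sign_factor n * [:0, 1:]) v" by (simp add: mult.commute)
        then show ?thesis using that by (simp only: op_poly_mult op_poly_X blinfun.zero_right)
      qed
      then show "(\<lambda>n. ?X n v) \<longlonglongrightarrow> 0" by simp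
    qed
    then show ?thesis by (simp add: Q)
  qed
  show ?thesis
    using that[OF symQ QQ comQ CQ CR kerQ] .
qed

end

end

lemma sign_projection:
  fixes C :: "'a::{real_inner,complete_space} \<Rightarrow>\<^sub>L 'a"
  assumes sym: "symmetric_op C"
  obtains Q :: "'a \<Rightarrow>\<^sub>L 'a" where
    "symmetric_op Q" "\<And>v. Q (Q v) = Q v" "\<And>B. C o\<^sub>L B = B o\<^sub>L C \<Longrightarrow> B o\<^sub>L Q = Q o\<^sub>L B"
    "\<And>v. 0 \<le> C (Q v) \<bullet> Q v" "\<And>v. C (v - Q v) \<bullet> (v - Q v) \<le> 0" "\<And>v. C v = 0 \<Longrightarrow> Q v = 0"
proof -
  define c where "c = inverse (norm C + 1)"
  have c: "c > 0" by (simp add: c_def add_nonneg_pos)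
  have "norm (c *\<^sub>R C) \<le> 1"
  proof -
    have "c * norm C \<le> c * (norm C + 1)" using c by simp
    also have "\<dots> = 1" using c by (simp add: c_def)
    finally show ?thesis using c by simp
  qed
  with sym obtain Q :: "'a \<Rightarrow>\<^sub>L 'a" where Q:
    "symmetric_op Q" "\<And>v. Q (Q v) = Q v" "\<And>B. (c *\<^sub>R C) o\<^sub>L B = B o\<^sub>L (c *\<^sub>R C) \<Longrightarrow> B o\<^sub>L Q = Q o\<^sub>L B"
    "\<And>v. 0 \<le> (c *\<^sub>R C) (Q v) \<bullet> Q v" "\<And>v. (c *\<^sub>R C) (v - Q v) \<bullet> (v - Q v) \<le> 0"
    "\<And>v. (c *\<^sub>R C) v = 0 \<Longrightarrow> Q v = 0"
    using sign_projection_contraction[of "c *\<^sub>R C"] by (metis symmetric_op_scaleR)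
  show ?thesis
  proof (rule that[of Q])
    show "B o\<^sub>L Q = Q o\<^sub>L B" if "C o\<^sub>L B = B o\<^sub>L C" for B
    proof (rule Q(3), rule blinfun_eqI)
      fix v show "((c *\<^sub>R C) o\<^sub>L B) v = (B o\<^sub>L (c *\<^sub>R C)) v"
        using that[THEN arg_cong, of "\<lambda>X. blinfun_apply X v"] by (simp add: blinfun.bilinear_simps)
    qed
    show "0 \<le> C (Q v) \<bullet> Q v" for v
      using Q(4)[of v] c by (simp add: blinfun.scaleR_left zero_le_mult_iff)
    show "C (v - Q v) \<bullet> (v - Q v) \<le> 0" for v
      using Q(5)[of v] c by (simp only: blinfun.scaleR_left inner_scaleR_left mult_le_0_iff) auto
    show "Q v = 0" if "C v = 0" for v
      using Q(6)[of v] that by (simp add: blinfun.scaleR_left)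
  qed (use Q(1,2) in auto)
qed

text \<open>These six properties are all that is used of the sign iteration from here on.\<close>

definition pos_proj :: "('a::{real_inner,complete_space} \<Rightarrow>\<^sub>L 'a) \<Rightarrow> ('a \<Rightarrow>\<^sub>L 'a)"
  where "pos_proj C = (SOME Q. symmetric_op Q \<and> (\<forall>v. Q (Q v) = Q v) \<and>
    (\<forall>B. C o\<^sub>L B = B o\<^sub>L C \<longrightarrow> B o\<^sub>L Q = Q o\<^sub>L B) \<and>
    (\<forall>v. 0 \<le> C (Q v) \<bullet> Q v) \<and> (\<forall>v. C (v - Q v) \<bullet> (v - Q v) \<le> 0) \<and> (\<forall>v. C v = 0 \<longrightarrow> Q v = 0))"

lemma pos_proj:
  fixes C :: "'a::{real_inner,complete_space} \<Rightarrow>\<^sub>L 'a"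
  assumes "symmetric_op C"
  shows symmetric_pos_proj: "symmetric_op (pos_proj C)"
    and pos_proj_idem: "pos_proj C (pos_proj C v) = pos_proj C v"
    and pos_proj_commute: "C o\<^sub>L B = B o\<^sub>L C \<Longrightarrow> B o\<^sub>L pos_proj C = pos_proj C o\<^sub>L B"
    and pos_proj_nonneg: "0 \<le> C (pos_proj C v) \<bullet> pos_proj C v"
    and pos_proj_nonpos: "C (v - pos_proj C v) \<bullet> (v - pos_proj C v) \<le> 0"
    and pos_proj_kernel: "C v = 0 \<Longrightarrow> pos_proj C v = 0"
proof -
  have "\<exists>Q. symmetric_op Q \<and> (\<forall>v. blinfun_apply Q (Q v) = Q v) \<and>
    (\<forall>B. C o\<^sub>L B = B o\<^sub>L C \<longrightarrow> B o\<^sub>L Q = Q o\<^sub>L B) \<and>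
    (\<forall>v. 0 \<le> C (Q v) \<bullet> Q v) \<and> (\<forall>v. C (v - Q v) \<bullet> (v - Q v) \<le> 0) \<and> (\<forall>v. C v = 0 \<longrightarrow> Q v = 0)"
    by (rule sign_projection[OF assms]) blast
  from someI_ex[OF this, folded pos_proj_def]
  show "symmetric_op (pos_proj C)" "pos_proj C (pos_proj C v) = pos_proj C v"
    "C o\<^sub>L B = B o\<^sub>L C \<Longrightarrow> B o\<^sub>L pos_proj C = pos_proj C o\<^sub>L B"
    "0 \<le> C (pos_proj C v) \<bullet> pos_proj C v" "C (v - pos_proj C v) \<bullet> (v - pos_proj C v) \<le> 0"
    "C v = 0 \<Longrightarrow> pos_proj C v = 0"
    by blast+
qed

section \<open>The spectral family of a symmetric operator\<close>

text \<open>The spectral projection of \<open>A\<close> for the half-line \<open>{s<..}\<close>.\<close>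

definition upper_proj :: "('a::{real_inner,complete_space} \<Rightarrow>\<^sub>L 'a) \<Rightarrow> real \<Rightarrow> ('a \<Rightarrow>\<^sub>L 'a)"
  where "upper_proj A s = pos_proj (A - s *\<^sub>R id_blinfun)"

locale symmetric_operator =
  fixes A :: "'a::{real_inner,complete_space} \<Rightarrow>\<^sub>L 'a"
  assumes sym: "symmetric_op A"
begin

lemma symmetric_op_shift: "symmetric_op (A - s *\<^sub>R id_blinfun)"
  using sym by (simp add: symmetric_op_diff symmetric_op_scaleR)

lemma symmetric_upper_proj: "symmetric_op (upper_proj A s)"
  by (simp add: upper_proj_def symmetric_pos_proj symmetric_op_shift)

lemma upper_proj_idem: "upper_proj A s (upper_proj A s v) = upper_proj A s v"
  by (simp add: upper_proj_def pos_proj_idem symmetric_op_shift)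

lemma upper_proj_commute:
  assumes "A o\<^sub>L B = B o\<^sub>L A"
  shows "B o\<^sub>L upper_proj A s = upper_proj A s o\<^sub>L B"
  unfolding upper_proj_def
proof (rule pos_proj_commute[OF symmetric_op_shift], rule blinfun_eqI)
  fix v show "((A - s *\<^sub>R id_blinfun) o\<^sub>L B) v = (B o\<^sub>L (A - s *\<^sub>R id_blinfun)) v"
    using assms[THEN arg_cong, of "\<lambda>X. blinfun_apply X v"] by (simp add: blinfun.bilinear_simps)
qed

lemma upper_proj_commute_apply: "upper_proj A s (upper_proj A t v) = upper_proj A t (upper_proj A s v)"
proof -
  have "A o\<^sub>L upper_proj A t = upper_proj A t o\<^sub>L A"
    by (rule upper_proj_commute) simp
  from upper_proj_commute[OF this, of s, THEN arg_cong, of "\<lambda>X. blinfun_apply X v"] show ?thesis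
    by simp
qed

lemma upper_proj_ge:
  assumes "upper_proj A s v = v"
  shows "s * (v \<bullet> v) \<le> A v \<bullet> v"
  using pos_proj_nonneg[OF symmetric_op_shift, of s v] assms
  by (simp add: upper_proj_def blinfun.bilinear_simps inner_simps)

lemma upper_proj_le:
  assumes "upper_proj A s v = 0"
  shows "A v \<bullet> v \<le> s * (v \<bullet> v)"
  using pos_proj_nonpos[OF symmetric_op_shift, of s v] assms
  by (simp add: upper_proj_def blinfun.bilinear_simps inner_simps)

text \<open>On the range of \<open>upper_proj A s\<close> the form of \<open>A - s\<close> is
  strictly positive: \<open>(A - s) upper_proj A s\<close> is a nonnegative operator, so a vector of
  its range with vanishing form lies in the kernel of \<open>A - s\<close>, and
  \<open>upper_proj\<close> kills that kernel.\<close>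

lemma upper_proj_strict:
  assumes "upper_proj A s v = v" "A v \<bullet> v \<le> s * (v \<bullet> v)"
  shows "v = 0"
proof -
  let ?C = "A - s *\<^sub>R id_blinfun"
  let ?B = "?C o\<^sub>L upper_proj A s"
  have comm: "?C o\<^sub>L upper_proj A s = upper_proj A s o\<^sub>L ?C"
    unfolding upper_proj_def by (rule pos_proj_commute[OF symmetric_op_shift]) simp
  have "0 \<le> ?B w \<bullet> w" for w
  proof -
    have "?B w \<bullet> w = ?B (upper_proj A s w) \<bullet> w"
      by (simp add: upper_proj_idem)
    also have "\<dots> = upper_proj A s (?C (upper_proj A s w)) \<bullet> w"
      using comm by simp
    also have "\<dots> = ?C (upper_proj A s w) \<bullet> upper_proj A s w"
      by (rule symmetric_opD[OF symmetric_upper_proj])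
    also have "0 \<le> \<dots>"
      by (simp add: upper_proj_def pos_proj_nonneg[OF symmetric_op_shift])
    finally show ?thesis .
  qed
  then have nn: "nonneg_op ?B"
    by (simp add: nonneg_op_def symmetric_op_compose[OF symmetric_op_shift symmetric_upper_proj comm])
  moreover have "?B v \<bullet> v = 0"
    using nonneg_opD(2)[OF nn, of v] assms by (simp add: blinfun.bilinear_simps inner_simps)
  ultimately have "?B v = 0"
    by (rule nonneg_op_apply_eq_0)
  then have "?C v = 0" by (simp add: assms(1))
  then have "upper_proj A s v = 0"
    unfolding upper_proj_def by (rule pos_proj_kernel[OF symmetric_op_shift])
  with assms show ?thesis by simp
qed

text \<open>The part \<open>w\<close> of the range at level \<open>t\<close> that level
  \<open>s\<close> misses has form at most \<open>s\<close>, hence at most \<open>t\<close>, which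
  strictness at level \<open>t\<close> forbids unless \<open>w = 0\<close>.\<close>

lemma upper_proj_mono:
  assumes "s \<le> t"
  shows "upper_proj A s (upper_proj A t v) = upper_proj A t v"
proof -
  let ?w = "upper_proj A t v - upper_proj A s (upper_proj A t v)"
  have "upper_proj A s ?w = 0"
    by (simp add: blinfun.diff_right upper_proj_idem)
  then have "A ?w \<bullet> ?w \<le> s * (?w \<bullet> ?w)" by (rule upper_proj_le)
  also have "\<dots> \<le> t * (?w \<bullet> ?w)" using assms by (intro mult_right_mono) auto
  finally have "A ?w \<bullet> ?w \<le> t * (?w \<bullet> ?w)" .
  moreover have "upper_proj A t ?w = ?w"
    by (simp add: blinfun.diff_right upper_proj_commute_apply[of t s] upper_proj_idem)
  ultimately have "?w = 0" using upper_proj_strict by blast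
  then show ?thesis by simp
qed

lemma upper_proj_max: "upper_proj A s (upper_proj A t v) = upper_proj A (max s t) v"
  using upper_proj_mono[of s t v] upper_proj_mono[of t s v] upper_proj_commute_apply[of s t v]
  by (auto simp: max_def)

lemma upper_proj_eq_0:
  assumes "norm A \<le> s"
  shows "upper_proj A s v = 0"
proof (rule upper_proj_strict)
  let ?w = "upper_proj A s v"
  have "A ?w \<bullet> ?w \<le> norm A * (?w \<bullet> ?w)" by (rule inner_op_le)
  also have "\<dots> \<le> s * (?w \<bullet> ?w)" using assms by (intro mult_right_mono) auto
  finally show "A ?w \<bullet> ?w \<le> s * (?w \<bullet> ?w)" .
qed (rule upper_proj_idem)

lemma upper_proj_eq_id:
  assumes lower: "\<And>v. c * (v \<bullet> v) \<le> A v \<bullet> v" and "s < c"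
  shows "upper_proj A s v = v"
proof -
  let ?w = "v - upper_proj A s v"
  have "upper_proj A s ?w = 0"
    by (simp add: blinfun.diff_right upper_proj_idem)
  then have "c * (?w \<bullet> ?w) \<le> s * (?w \<bullet> ?w)"
    using upper_proj_le[of s ?w] lower[of ?w] by linarith
  then have "(c - s) * (?w \<bullet> ?w) \<le> 0" by (simp add: algebra_simps)
  then have "?w \<bullet> ?w \<le> 0"
    using \<open>s < c\<close> by (simp add: mult_le_0_iff)
  then have "?w \<bullet> ?w = 0" by (intro antisym) auto
  then show ?thesis by (simp only: inner_eq_zero_iff) simp
qed

lemma inner_upper_proj: "upper_proj A s v \<bullet> v = (norm (upper_proj A s v))\<^sup>2"
  using symmetric_opD[OF symmetric_upper_proj, of s "upper_proj A s v" v]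
  by (simp add: upper_proj_idem power2_norm_eq_inner)

lemma upper_proj_dist:
  assumes "s \<le> t"
  shows "(dist (upper_proj A t v) (upper_proj A s v))\<^sup>2 = upper_proj A s v \<bullet> v - upper_proj A t v \<bullet> v"
proof -
  have "upper_proj A s v \<bullet> upper_proj A t v = (norm (upper_proj A t v))\<^sup>2"
    using inner_upper_proj[of t v]
    by (simp add: symmetric_opD[OF symmetric_upper_proj] upper_proj_mono[OF assms] inner_commute)
  then show ?thesis
    unfolding inner_upper_proj
    by (simp add: dist_norm power2_norm_eq_inner inner_simps inner_commute)
qed

text \<open>The defect \<open>w\<close> of the limit lies in the range at level \<open>s\<close> but
  is killed at every level \<open>t n\<close>. Hence
  \<open>A w \<bullet> w \<le> t n * (w \<bullet> w)\<close>, in the limit with \<open>s\<close> in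
  place of \<open>t n\<close>, and strictness gives \<open>w = 0\<close>.\<close>

lemma upper_proj_right_continuous:
  assumes gt: "\<And>n. s < t n" and t: "decseq t" "t \<longlonglongrightarrow> s"
  shows "(\<lambda>n. upper_proj A (t n) v) \<longlonglongrightarrow> upper_proj A s v"
proof -
  have "Cauchy (\<lambda>n. upper_proj A (t n) v)"
  proof (rule Cauchy_of_dist_sq_le)
    show "(dist (upper_proj A (t m) v) (upper_proj A (t n) v))\<^sup>2
        \<le> upper_proj A (t n) v \<bullet> v - upper_proj A (t m) v \<bullet> v" if "m \<le> n" for m n
      using upper_proj_dist[of "t n" "t m" v] t(1) that by (simp add: decseq_def)
    show "upper_proj A (t n) v \<bullet> v \<le> upper_proj A s v \<bullet> v" for n
      using upper_proj_dist[of s "t n" v] gt[of n] zero_le_power2[of "dist (upper_proj A (t n) v) (upper_proj A s v)"]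
      by linarith
  qed
  then obtain u where u: "(\<lambda>n. upper_proj A (t n) v) \<longlonglongrightarrow> u"
    by (auto simp: Cauchy_convergent_iff convergent_def)
  define w where "w = upper_proj A s v - u"
  have "(\<lambda>n. upper_proj A s (upper_proj A (t n) v)) \<longlonglongrightarrow> upper_proj A s u"
    by (intro tendsto_blinfun_apply_right u)
  then have "upper_proj A s u = u"
    using gt by (intro LIMSEQ_unique[OF _ u]) (simp add: upper_proj_mono less_imp_le)
  then have sw: "upper_proj A s w = w"
    by (simp add: w_def blinfun.diff_right upper_proj_idem)
  have "upper_proj A (t n) u = upper_proj A (t n) v" for n
  proof (rule LIMSEQ_unique)
    show "(\<lambda>m. upper_proj A (t n) (upper_proj A (t m) v)) \<longlonglongrightarrow> upper_proj A (t n) u"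
      by (intro tendsto_blinfun_apply_right u)
    have "upper_proj A (t n) (upper_proj A (t m) v) = upper_proj A (t n) v" if "n \<le> m" for m
      using t(1) that by (simp add: upper_proj_max decseq_def max_absorb1)
    then show "(\<lambda>m. upper_proj A (t n) (upper_proj A (t m) v)) \<longlonglongrightarrow> upper_proj A (t n) v"
      by (intro tendsto_eventually eventually_sequentiallyI)
  qed
  then have "upper_proj A (t n) w = 0" for n
    using gt[of n] by (simp add: w_def blinfun.diff_right upper_proj_max max_absorb1)
  then have "A w \<bullet> w \<le> t n * (w \<bullet> w)" for n
    by (rule upper_proj_le)
  moreover have "(\<lambda>n. t n * (w \<bullet> w)) \<longlonglongrightarrow> s * (w \<bullet> w)"
    by (intro tendsto_intros t)
  ultimately have "A w \<bullet> w \<le> s * (w \<bullet> w)"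
    by (intro LIMSEQ_le_const) auto
  with sw have "w = 0" by (rule upper_proj_strict)
  with u show ?thesis by (simp add: w_def)
qed

text \<open>The distribution function \<open>s \<mapsto> \<langle>E{..s} v, v\<rangle>\<close>.\<close>

definition spectral_cdf :: "'a \<Rightarrow> real \<Rightarrow> real"
  where "spectral_cdf v s = v \<bullet> v - upper_proj A s v \<bullet> v"

lemma spectral_cdf_mono: "s \<le> t \<Longrightarrow> spectral_cdf v s \<le> spectral_cdf v t"
  using upper_proj_dist[of s t v] zero_le_power2[of "dist (upper_proj A t v) (upper_proj A s v)"]
  by (simp add: spectral_cdf_def)

lemma spectral_cdf_right_continuous: "continuous (at_right a) (spectral_cdf v)"
  unfolding continuous_within spectral_cdf_def
  by (rule tendsto_at_right_sequentially[where b="a + 1"])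
    (auto intro!: tendsto_diff tendsto_inner tendsto_const upper_proj_right_continuous)

lemma spectral_cdf_at_bot: "(spectral_cdf v \<longlongrightarrow> 0) at_bot"
proof (rule tendsto_eventually)
  have "- norm A * (v \<bullet> v) \<le> A v \<bullet> v" for v
    using abs_inner_op_le[of A v] by (simp add: abs_le_iff)
  from upper_proj_eq_id[OF this] have "spectral_cdf v s = 0" if "s \<le> - norm A - 1" for s
    using that by (simp add: spectral_cdf_def)
  then show "\<forall>\<^sub>F s in at_bot. spectral_cdf v s = 0"
    by (auto simp: eventually_at_bot_linorder)
qed

lemma spectral_cdf_at_top: "(spectral_cdf v \<longlongrightarrow> v \<bullet> v) at_top"
proof (rule tendsto_eventually)
  have "spectral_cdf v s = v \<bullet> v" if "norm A \<le> s" for s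
    using upper_proj_eq_0[OF that] by (simp add: spectral_cdf_def)
  then show "\<forall>\<^sub>F s in at_top. spectral_cdf v s = v \<bullet> v"
    by (auto simp: eventually_at_top_linorder)
qed

definition form_measure :: "'a \<Rightarrow> real measure"
  where "form_measure v = interval_measure (spectral_cdf v)"

lemma finite_borel_form_measure: "finite_borel_measure (form_measure v)"
  unfolding form_measure_def
  by (rule finite_borel_measure_interval_measure[OF spectral_cdf_mono spectral_cdf_right_continuous
        spectral_cdf_at_bot spectral_cdf_at_top]) simp_all

lemma emeasure_form_measure_UNIV: "emeasure (form_measure v) UNIV = v \<bullet> v"
  unfolding form_measure_def
  by (rule interval_measure_UNIV[OF spectral_cdf_mono spectral_cdf_right_continuous
        spectral_cdf_at_bot spectral_cdf_at_top]) simp_all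

lemma measure_form_measure_Iic: "measure (form_measure v) {..s} = spectral_cdf v s"
  unfolding form_measure_def
  by (rule measure_interval_measure_Iic[OF spectral_cdf_mono spectral_cdf_right_continuous
        spectral_cdf_at_bot]) simp_all

lemma sets_form_measure [simp]: "sets (form_measure v) = sets borel"
  and space_form_measure [simp]: "space (form_measure v) = UNIV"
  by (simp_all add: form_measure_def)

end

section \<open>Projection-valued measures on real Hilbert spaces\<close>

text \<open>Dynkin's theorem for the intersection-stable generator of closed half-lines. Only
  complements and disjoint unions occur, the two operations under which quadratic forms given by
  measures behave additively.\<close>

lemma borel_real_induct [consumes 1, case_names atMost empty compl union]:
  fixes S :: "real set"
  assumes "S \<in> sets borel" "\<And>a. P {..a}" "P {}" "\<And>S. S \<in> sets borel \<Longrightarrow> P S \<Longrightarrow> P (- S)"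
    and "\<And>F :: nat \<Rightarrow> real set. disjoint_family F \<Longrightarrow> range F \<subseteq> sets borel \<Longrightarrow> (\<And>i. P (F i)) \<Longrightarrow> P (\<Union>i. F i)"
  shows "P S"
proof -
  have eq: "sets borel = sigma_sets UNIV (range (\<lambda>a::real. {..a}))"
    by (subst borel_eq_atMost) simp
  have "Int_stable (range (\<lambda>a::real. {..a}))"
    by (auto simp: Int_stable_def)
  moreover have "range (\<lambda>a::real. {..a}) \<subseteq> Pow UNIV" by simp
  moreover have "S \<in> sigma_sets UNIV (range (\<lambda>a::real. {..a}))"
    using assms(1) eq by simp
  ultimately show ?thesis
    by (induction rule: sigma_sets_induct_disjoint)
      (use assms in \<open>auto simp: eq simp flip: Compl_eq_Diff_UNIV\<close>)
qed

text \<open>The part of \<open>projection_valued_measure\<close> that makes sense over the reals;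
  idempotence is the case \<open>S = S'\<close> of the intersection clause.\<close>

definition real_pvm :: "(real set \<Rightarrow> ('a::real_inner \<Rightarrow>\<^sub>L 'a)) \<Rightarrow> bool"
  where "real_pvm E \<longleftrightarrow>
    (\<forall>S\<in>sets borel. symmetric_op (E S)) \<and> E UNIV = id_blinfun \<and>
    (\<forall>S\<in>sets borel. \<forall>S'\<in>sets borel. E (S \<inter> S') = E S o\<^sub>L E S') \<and>
    (\<forall>F :: nat \<Rightarrow> real set. range F \<subseteq> sets borel \<and> disjoint_family F \<longrightarrow>
       (\<forall>x. (\<lambda>n. E (F n) x) sums E (\<Union>n. F n) x))"

definition pvm_measure :: "(real set \<Rightarrow> ('a::real_inner \<Rightarrow>\<^sub>L 'a)) \<Rightarrow> 'a \<Rightarrow> real measure"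
  where "pvm_measure E v = measure_of UNIV (sets borel) (\<lambda>S. ennreal (E S v \<bullet> v))"

lemma sets_pvm_measure [simp, measurable_cong]: "sets (pvm_measure E v) = sets borel"
  and space_pvm_measure [simp]: "space (pvm_measure E v) = UNIV"
  using sets.sigma_sets_eq[of "borel :: real measure"] sets.space_closed[of "borel :: real measure"]
  by (simp_all add: pvm_measure_def)

lemma borel_measurable_pvm_measure [simp]:
  "f \<in> borel_measurable borel \<Longrightarrow> f \<in> borel_measurable (pvm_measure E v)"
  by (simp add: measurable_def)

context
  fixes E :: "real set \<Rightarrow> ('a::real_inner \<Rightarrow>\<^sub>L 'a)"
  assumes E: "real_pvm E"
begin

lemma symmetric_pvm: "S \<in> sets borel \<Longrightarrow> symmetric_op (E S)"
  using E by (simp add: real_pvm_def)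

lemma pvm_UNIV: "E UNIV v = v"
  using E by (simp add: real_pvm_def)

lemma pvm_Int: "S \<in> sets borel \<Longrightarrow> S' \<in> sets borel \<Longrightarrow> E S (E S' v) = E (S \<inter> S') v"
  using E by (auto simp: real_pvm_def)

lemma pvm_sums:
  "range F \<subseteq> sets borel \<Longrightarrow> disjoint_family F \<Longrightarrow> (\<lambda>n::nat. E (F n) v) sums E (\<Union>n. F n) v"
  using E by (simp add: real_pvm_def)

lemma inner_pvm: "S \<in> sets borel \<Longrightarrow> E S v \<bullet> v = (norm (E S v))\<^sup>2"
  using symmetric_opD[OF symmetric_pvm, of S "E S v" v] by (simp add: pvm_Int power2_norm_eq_inner)

lemma pvm_empty: "E {} v = 0"
proof -
  have "(\<lambda>n::nat. E {} v) sums E {} v"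
    using pvm_sums[of "\<lambda>_. {}" v] by (simp add: disjoint_family_on_def)
  then have "(\<lambda>n::nat. E {} v) \<longlonglongrightarrow> 0"
    by (intro summable_LIMSEQ_zero) (rule sums_summable)
  then show ?thesis by (simp add: LIMSEQ_const_iff)
qed

lemma emeasure_pvm_measure:
  assumes "S \<in> sets borel"
  shows "emeasure (pvm_measure E v) S = ennreal (E S v \<bullet> v)"
  unfolding pvm_measure_def
proof (rule emeasure_measure_of_sigma)
  show "sigma_algebra UNIV (sets (borel :: real measure))"
    using sets.sigma_algebra_axioms[of "borel :: real measure"] by simp
  show "positive (sets borel) (\<lambda>S. ennreal (E S v \<bullet> v))"
    by (simp add: positive_def pvm_empty)
  show "countably_additive (sets borel) (\<lambda>S. ennreal (E S v \<bullet> v))"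
    unfolding countably_additive_def
  proof (intro allI impI)
    fix F :: "nat \<Rightarrow> real set"
    assume F: "range F \<subseteq> sets borel" "disjoint_family F"
    have "(\<lambda>n. E (F n) v \<bullet> v) sums (E (\<Union>n. F n) v \<bullet> v)"
      using bounded_linear.sums[OF bounded_linear_inner_left pvm_sums[OF F]] .
    moreover have "0 \<le> E (F n) v \<bullet> v" for n
      using F by (subst inner_pvm) auto
    ultimately show "(\<Sum>i. ennreal (E (F i) v \<bullet> v)) = ennreal (E (\<Union>(range F)) v \<bullet> v)"
      by (intro suminf_ennreal_eq)
  qed
qed (rule assms)

lemma finite_borel_pvm_measure: "finite_borel_measure (pvm_measure E v)"
  by (simp add: finite_borel_measure_def finite_borel_measure_axioms_def)
    (rule finite_measureI, simp add: emeasure_pvm_measure)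

lemma measure_pvm_measure:
  assumes "S \<in> sets borel"
  shows "measure (pvm_measure E v) S = E S v \<bullet> v"
  using assms by (simp add: measure_def emeasure_pvm_measure inner_pvm)

lemma pvm_Compl:
  assumes "S \<in> sets borel"
  shows "E (- S) v = v - E S v"
proof -
  interpret finite_borel_measure "pvm_measure E v" for v
    by (rule finite_borel_pvm_measure)
  have "E (- S) = id_blinfun - E S"
  proof (rule symmetric_op_eqI)
    fix v
    have "E (- S) v \<bullet> v = measure (pvm_measure E v) (UNIV - S)"
      using assms by (simp add: measure_pvm_measure Compl_eq_Diff_UNIV)
    also have "\<dots> = E UNIV v \<bullet> v - E S v \<bullet> v"
      using assms by (subst finite_measure_Diff) (auto simp: measure_pvm_measure)
    finally show "E (- S) v \<bullet> v = (id_blinfun - E S) v \<bullet> v"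
      by (simp add: pvm_UNIV blinfun.diff_left inner_diff_left)
  qed (use assms in \<open>auto intro!: symmetric_op_diff symmetric_pvm\<close>)
  then show ?thesis by (simp add: blinfun.diff_left)
qed

lemma pvm_measure_restrict:
  assumes S: "S \<in> sets borel"
  shows "pvm_measure E (E S v) = density (pvm_measure E v) (indicator S)"
proof (rule measure_eqI)
  fix X assume "X \<in> sets (pvm_measure E (E S v))"
  then have X: "X \<in> sets borel" by simp
  have "E X (E S v) \<bullet> E S v = E S (E X (E S v)) \<bullet> v"
    using symmetric_opD[OF symmetric_pvm[OF S], of "E X (E S v)" v] by simp
  also have "\<dots> = E (S \<inter> X) v \<bullet> v"
    using X S by (simp add: pvm_Int Int_commute Int_left_commute)
  finally have "emeasure (pvm_measure E (E S v)) X = emeasure (pvm_measure E v) (S \<inter> X)"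
    using X S by (simp add: emeasure_pvm_measure)
  also have "\<dots> = emeasure (density (pvm_measure E v) (indicator S)) X"
    using X S by (simp add: emeasure_density flip: indicator_inter_arith)
  finally show "emeasure (pvm_measure E (E S v)) X = emeasure (density (pvm_measure E v) (indicator S)) X" .
qed simp

lemma integral_pvm_restrict:
  fixes f :: "real \<Rightarrow> real"
  assumes "S \<in> sets borel" "f \<in> borel_measurable borel"
  shows "(\<integral>l. f l \<partial>pvm_measure E (E S v)) = (\<integral>l. indicator S l * f l \<partial>pvm_measure E v)"
proof -
  have "pvm_measure E (E S v) = density (pvm_measure E v) (\<lambda>l. ennreal (indicator S l))"
    using assms(1) by (simp add: pvm_measure_restrict ennreal_indicator)
  then show ?thesis
    using assms by (simp add: integral_density)
qed

lemma AE_pvm_support: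
  assumes S: "S \<in> sets borel" and v: "E S v = v"
  shows "AE l in pvm_measure E v. l \<in> S"
proof -
  have "emeasure (pvm_measure E v) (- S) = 0"
    using assms by (simp add: emeasure_pvm_measure pvm_Compl)
  then show ?thesis
    using S by (intro AE_I[where N="- S"]) auto
qed

lemma integrable_pvm:
  fixes f :: "real \<Rightarrow> real"
  assumes "S \<in> sets borel" "E S v = v" "f \<in> borel_measurable borel" "\<And>l. l \<in> S \<Longrightarrow> \<bar>f l\<bar> \<le> K"
  shows "integrable (pvm_measure E v) f"
proof -
  interpret finite_borel_measure "pvm_measure E v"
    by (rule finite_borel_pvm_measure)
  show ?thesis
    using AE_pvm_support[OF assms(1,2)] assms(3,4)
    by (intro integrable_const_bound[where B=K]) auto
qed

lemma integral_pvm_bounds: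
  fixes f :: "real \<Rightarrow> real"
  assumes S: "S \<in> sets borel" "E S v = v" and f: "f \<in> borel_measurable borel"
    and bounds: "\<And>l. l \<in> S \<Longrightarrow> a \<le> f l \<and> f l \<le> b"
  shows "a * (v \<bullet> v) \<le> (\<integral>l. f l \<partial>pvm_measure E v)" "(\<integral>l. f l \<partial>pvm_measure E v) \<le> b * (v \<bullet> v)"
proof -
  interpret finite_borel_measure "pvm_measure E v"
    by (rule finite_borel_pvm_measure)
  have int: "integrable (pvm_measure E v) f"
    using bounds by (intro integrable_pvm[OF S f, of "\<bar>a\<bar> + \<bar>b\<bar>"]) force
  have const: "(\<integral>l. c \<partial>pvm_measure E v) = c * (v \<bullet> v)" for c :: real
    by (simp add: measure_pvm_measure pvm_UNIV)
  have "(\<integral>l. a \<partial>pvm_measure E v) \<le> (\<integral>l. f l \<partial>pvm_measure E v)"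
    using AE_pvm_support[OF S] bounds by (intro integral_mono_AE int) auto
  then show "a * (v \<bullet> v) \<le> (\<integral>l. f l \<partial>pvm_measure E v)" by (simp only: const)
  have "(\<integral>l. f l \<partial>pvm_measure E v) \<le> (\<integral>l. b \<partial>pvm_measure E v)"
    using AE_pvm_support[OF S] bounds by (intro integral_mono_AE int) auto
  then show "(\<integral>l. f l \<partial>pvm_measure E v) \<le> b * (v \<bullet> v)" by (simp only: const)
qed

lemma integral_pvm_split:
  fixes f :: "real \<Rightarrow> real"
  assumes S: "S \<in> sets borel" and f: "integrable (pvm_measure E v) f" "f \<in> borel_measurable borel"
  shows "(\<integral>l. f l \<partial>pvm_measure E v) =
    (\<integral>l. f l \<partial>pvm_measure E (E S v)) + (\<integral>l. f l \<partial>pvm_measure E (v - E S v))"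
proof -
  have "(\<integral>l. f l \<partial>pvm_measure E v) = (\<integral>l. indicator S l * f l + indicator (- S) l * f l \<partial>pvm_measure E v)"
    by (intro Bochner_Integration.integral_cong) (auto simp: indicator_def)
  also have "\<dots> = (\<integral>l. indicator S l * f l \<partial>pvm_measure E v) + (\<integral>l. indicator (- S) l * f l \<partial>pvm_measure E v)"
    using S f by (intro Bochner_Integration.integral_add integrable_mult_indicator[where 'b=real, unfolded real_scaleR_def]) auto
  also have "\<dots> = (\<integral>l. f l \<partial>pvm_measure E (E S v)) + (\<integral>l. f l \<partial>pvm_measure E (E (- S) v))"
    using S f by (simp add: integral_pvm_restrict)
  finally show ?thesis using S by (simp add: pvm_Compl)
qed

lemma norm_pvm_split:
  assumes "S \<in> sets borel"
  shows "v \<bullet> v = E S v \<bullet> E S v + (v - E S v) \<bullet> (v - E S v)"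
  using inner_pvm[OF assms, of v]
  by (simp add: inner_diff_left inner_diff_right inner_commute power2_norm_eq_inner)

text \<open>Both \<open>\<langle>A v, v\<rangle>\<close> and \<open>\<integral> \<lambda> d\<langle>E v, v\<rangle>\<close> are additive along the splitting of \<open>v\<close> by a half-line, so
  repeated bisection makes their difference arbitrarily small.\<close>

lemma inner_eq_integral_pvm:
  fixes A :: "'a \<Rightarrow>\<^sub>L 'a"
  assumes comm: "\<And>s v. A (E {..s} v) = E {..s} (blinfun_apply A v)"
    and bounds: "\<And>a b v. E {a<..b} v = v \<Longrightarrow> a * (v \<bullet> v) \<le> A v \<bullet> v \<and> A v \<bullet> v \<le> b * (v \<bullet> v)"
    and supp: "E {a<..b} v = v" and "a \<le> b"
  shows "A v \<bullet> v = (\<integral>l. l \<partial>pvm_measure E v)"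
proof -
  define D where "D v = A v \<bullet> v - (\<integral>l. l \<partial>pvm_measure E v)" for v
  have int: "integrable (pvm_measure E v) (\<lambda>l. l)" if "E {a<..b} v = v" for a b v
    by (rule integrable_pvm[OF _ that, of _ "\<bar>a\<bar> + \<bar>b\<bar>"]) auto
  have split: "D v = D (E {..s} v) + D (v - E {..s} v)" if "E {a<..b} v = v" for a b s v
  proof -
    let ?P = "E {..s}"
    have "A (v - ?P v) \<bullet> ?P v = 0" "A (?P v) \<bullet> (v - ?P v) = 0"
      using comm[of s v] symmetric_opD[OF symmetric_pvm, of "{..s}"]
      by (simp_all add: blinfun.diff_right inner_diff_left inner_diff_right pvm_Int)
    then have "A v \<bullet> v = A (?P v) \<bullet> ?P v + A (v - ?P v) \<bullet> (v - ?P v)"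
      by (simp add: blinfun.diff_right inner_diff_left inner_diff_right)
    with integral_pvm_split[OF _ int[OF that], of "{..s}"] show ?thesis
      by (simp add: D_def)
  qed
  have small: "\<bar>D v\<bar> \<le> (b - a) / 2 ^ n * (v \<bullet> v)" if "E {a<..b} v = v" "a \<le> b" for n a b v
    using that
  proof (induction n arbitrary: a b v)
    case 0
    have "a * (v \<bullet> v) \<le> (\<integral>l. l \<partial>pvm_measure E v)" "(\<integral>l. l \<partial>pvm_measure E v) \<le> b * (v \<bullet> v)"
      using integral_pvm_bounds[OF _ 0(1), of "\<lambda>l. l" a b] by auto
    with bounds[OF 0(1)] show ?case by (auto simp: D_def algebra_simps)
  next
    case (Suc n)
    define s where "s = (a + b) / 2"
    have ab: "a \<le> s" "s \<le> b" and half: "s - a = (b - a) / 2" "b - s = (b - a) / 2"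
      using Suc.prems by (auto simp: s_def field_simps)
    have "{..s} \<inter> {a<..b} = {a<..s}" "- {..s} \<inter> {a<..b} = {s<..b}" using ab by auto
    then have v12: "E {..s} v = E {a<..s} v" "v - E {..s} v = E {s<..b} v"
      using pvm_Int[of "{..s}" "{a<..b}" v] pvm_Int[of "- {..s}" "{a<..b}" v]
        pvm_Compl[of "{..s}" v] Suc.prems
      by simp_all
    have "\<bar>D (E {..s} v)\<bar> \<le> (b - a) / 2 ^ Suc n * (E {..s} v \<bullet> E {..s} v)"
      using Suc.IH[of a s "E {a<..s} v"] ab unfolding v12(1) half(1) by (simp add: pvm_Int)
    moreover have "\<bar>D (v - E {..s} v)\<bar> \<le> (b - a) / 2 ^ Suc n * ((v - E {..s} v) \<bullet> (v - E {..s} v))"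
      using Suc.IH[of s b "E {s<..b} v"] ab unfolding v12(2) half(2) by (simp add: pvm_Int)
    ultimately have "\<bar>D v\<bar> \<le> (b - a) / 2 ^ Suc n * (E {..s} v \<bullet> E {..s} v + (v - E {..s} v) \<bullet> (v - E {..s} v))"
      unfolding split[OF Suc.prems(1), of s] distrib_left by linarith
    also have "\<dots> = (b - a) / 2 ^ Suc n * (v \<bullet> v)"
      by (subst norm_pvm_split[of "{..s}" v]) simp_all
    finally show ?case .
  qed
  have "(\<lambda>n. (b - a) * (v \<bullet> v) * (1 / 2) ^ n) \<longlonglongrightarrow> (b - a) * (v \<bullet> v) * 0"
    by (intro tendsto_mult tendsto_const LIMSEQ_power_zero) simp
  moreover have "\<bar>D v\<bar> \<le> (b - a) * (v \<bullet> v) * (1 / 2) ^ n" for n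
    using small[OF supp \<open>a \<le> b\<close>, of n] by (simp add: power_divide)
  ultimately have "\<bar>D v\<bar> \<le> 0"
    by (intro LIMSEQ_le_const) auto
  then show ?thesis by (simp add: D_def)
qed

end

section \<open>The spectral theorem\<close>

context symmetric_operator
begin

text \<open>The partial sums have increasing quadratic forms bounded by the total mass
  \<open>v \<bullet> v\<close>, so they converge strongly; countable additivity of the scalar
  measures identifies the form of the limit.\<close>

lemma form_measure_partial_sums:
  fixes P :: "nat \<Rightarrow> 'a \<Rightarrow>\<^sub>L 'a"
  assumes P: "\<And>i. symmetric_op (P i)" "\<And>i v. P i v \<bullet> v = measure (form_measure v) (F i)"
    and F: "disjoint_family F" "range F \<subseteq> sets borel"
  obtains L :: "'a \<Rightarrow>\<^sub>L 'a" where "symmetric_op L" "\<And>v. (\<lambda>i. P i v) sums L v"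
    "\<And>v. L v \<bullet> v = measure (form_measure v) (\<Union>i. F i)"
proof -
  interpret finite_borel_measure "form_measure v" for v
    by (rule finite_borel_form_measure)
  let ?B = "\<lambda>n. \<Sum>i<n. P i"
  have B: "?B n v \<bullet> v = (\<Sum>i<n. measure (form_measure v) (F i))" for n v
    by (simp add: blinfun.sum_left inner_sum_left P)
  have upper: "?B n v \<bullet> v \<le> 1 * (v \<bullet> v)" for n v
  proof -
    have "?B n v \<bullet> v = measure (form_measure v) (\<Union>i<n. F i)"
      unfolding B using F
      by (intro finite_measure_finite_Union[symmetric]) (auto simp: disjoint_family_on_def)
    also have "\<dots> \<le> measure (form_measure v) UNIV"
      by (intro finite_measure_mono) auto
    also have "\<dots> = v \<bullet> v"
      by (simp add: measure_def emeasure_form_measure_UNIV)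
    finally show ?thesis by simp
  qed
  have mono: "?B m v \<bullet> v \<le> ?B n v \<bullet> v" if "m \<le> n" for m n v
    unfolding B using that by (intro sum_mono2) auto
  have lower: "0 \<le> ?B n v \<bullet> v" for n v
    unfolding B by (intro sum_nonneg) simp
  have sym: "symmetric_op (?B n)" for n
    by (intro symmetric_op_sum P)
  obtain L :: "'a \<Rightarrow>\<^sub>L 'a" where L: "symmetric_op L" "\<And>v. (\<lambda>n. ?B n v) \<longlonglongrightarrow> L v"
    by (rule incseq_op_strong_limit[of ?B, OF sym mono lower upper]) (assumption | rule that)+
  have sums: "(\<lambda>i. P i v) sums L v" for v
    using L(2)[of v] by (simp add: sums_def blinfun.sum_left)
  have "L v \<bullet> v = measure (form_measure v) (\<Union>i. F i)" for v
  proof (rule sums_unique2)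
    show "(\<lambda>i. P i v \<bullet> v) sums (L v \<bullet> v)"
      by (rule bounded_linear.sums[OF bounded_linear_inner_left sums])
    show "(\<lambda>i. P i v \<bullet> v) sums measure (form_measure v) (\<Union>i. F i)"
      unfolding P(2) using F by (intro finite_measure_UNION) auto
  qed
  with L(1) sums show ?thesis by (rule that)
qed

text \<open>The form clause determines \<open>P\<close>, and the commutation clause has to be
  carried through the induction over Borel sets. Idempotence is left out because disjoint unions do
  not display it; it follows later from \<open>spectral_proj_Int\<close>.\<close>

definition represents :: "('a \<Rightarrow>\<^sub>L 'a) \<Rightarrow> real set \<Rightarrow> bool"
  where "represents P S \<longleftrightarrow> symmetric_op P \<and> (\<forall>v. P v \<bullet> v = measure (form_measure v) S) \<and>
    (\<forall>B. A o\<^sub>L B = B o\<^sub>L A \<longrightarrow> B o\<^sub>L P = P o\<^sub>L B)"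

lemma represents_symmetric: "represents P S \<Longrightarrow> symmetric_op P"
  and represents_inner: "represents P S \<Longrightarrow> P v \<bullet> v = measure (form_measure v) S"
  and represents_commute: "represents P S \<Longrightarrow> A o\<^sub>L B = B o\<^sub>L A \<Longrightarrow> B o\<^sub>L P = P o\<^sub>L B"
  unfolding represents_def by blast+

lemma represents_unique: "represents P S \<Longrightarrow> represents Q S \<Longrightarrow> P = Q"
  by (rule symmetric_op_eqI) (auto simp: represents_symmetric represents_inner)

lemma represents_atMost: "represents (id_blinfun - upper_proj A s) {..s}"
  unfolding represents_def
proof (intro conjI allI impI)
  show "symmetric_op (id_blinfun - upper_proj A s)"
    by (intro symmetric_op_diff symmetric_upper_proj symmetric_op_id)
  show "(id_blinfun - upper_proj A s) v \<bullet> v = measure (form_measure v) {..s}" for v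
    by (simp add: measure_form_measure_Iic spectral_cdf_def blinfun.diff_left inner_diff_left)
  show "B o\<^sub>L (id_blinfun - upper_proj A s) = (id_blinfun - upper_proj A s) o\<^sub>L B" if "A o\<^sub>L B = B o\<^sub>L A" for B
  proof (rule blinfun_eqI)
    fix v show "(B o\<^sub>L (id_blinfun - upper_proj A s)) v = ((id_blinfun - upper_proj A s) o\<^sub>L B) v"
      using upper_proj_commute[OF that, of s, THEN arg_cong, of "\<lambda>X. blinfun_apply X v"]
      by (simp add: blinfun.bilinear_simps)
  qed
qed

lemma represents_Compl:
  assumes "represents P S" "S \<in> sets borel"
  shows "represents (id_blinfun - P) (- S)"
  unfolding represents_def
proof (intro conjI allI impI)
  interpret finite_borel_measure "form_measure v" for v
    by (rule finite_borel_form_measure)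
  show "symmetric_op (id_blinfun - P)"
    using assms by (simp add: represents_symmetric symmetric_op_diff)
  have "measure (form_measure v) (UNIV - S) = v \<bullet> v - measure (form_measure v) S" for v
    using assms(2)
    by (subst finite_measure_Diff) (auto simp: measure_def emeasure_form_measure_UNIV)
  then show "(id_blinfun - P) v \<bullet> v = measure (form_measure v) (- S)" for v
    by (simp add: represents_inner[OF assms(1)] blinfun.diff_left inner_diff_left Compl_eq_Diff_UNIV)
  show "B o\<^sub>L (id_blinfun - P) = (id_blinfun - P) o\<^sub>L B" if "A o\<^sub>L B = B o\<^sub>L A" for B
  proof (rule blinfun_eqI)
    fix v
    have "B o\<^sub>L P = P o\<^sub>L B" using assms(1) that by (rule represents_commute)
    from this[THEN arg_cong, of "\<lambda>X. blinfun_apply X v"]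
    show "(B o\<^sub>L (id_blinfun - P)) v = ((id_blinfun - P) o\<^sub>L B) v"
      by (simp add: blinfun.bilinear_simps)
  qed
qed

lemma represents_UN:
  assumes F: "disjoint_family F" "range F \<subseteq> sets borel" and P: "\<And>i::nat. represents (P i) (F i)"
  obtains L where "represents L (\<Union>i. F i)" "\<And>v. (\<lambda>i. P i v) sums blinfun_apply L v"
proof -
  from P have "symmetric_op (P i)" "P i v \<bullet> v = measure (form_measure v) (F i)" for i v
    by (auto simp: represents_inner intro: represents_symmetric)
  from form_measure_partial_sums[OF this F] obtain L where L: "symmetric_op L"
    "\<And>v. (\<lambda>i. P i v) sums blinfun_apply L v" "\<And>v. L v \<bullet> v = measure (form_measure v) (\<Union>i. F i)"
    by blast
  have "B o\<^sub>L L = L o\<^sub>L B" if "A o\<^sub>L B = B o\<^sub>L A" for B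
  proof (rule commute_limit)
    have "B (P i v) = P i (B v)" for i v
      using represents_commute[OF P that, of i, THEN arg_cong, of "\<lambda>X. blinfun_apply X v"] by simp
    then show "B o\<^sub>L (\<Sum>i<n. P i) = (\<Sum>i<n. P i) o\<^sub>L B" for n
      by (intro blinfun_eqI) (simp add: blinfun.sum_left blinfun.sum_right)
    show "(\<lambda>n. (\<Sum>i<n. P i) v) \<longlonglongrightarrow> L v" for v
      using L(2)[of v] by (simp add: sums_def blinfun.sum_left)
  qed
  with L have "represents L (\<Union>i. F i)" unfolding represents_def by blast
  then show ?thesis using L(2) by (rule that)
qed

lemma represents_exists:
  assumes "S \<in> sets borel"
  shows "\<exists>P. represents P S"
  using assms
proof (induction rule: borel_real_induct)
  case (atMost a)
  show ?case using represents_atMost by blast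
next
  case empty
  have "represents 0 {}" by (simp add: represents_def)
  then show ?case by blast
next
  case (compl S)
  then show ?case using represents_Compl by blast
next
  case (union F)
  then obtain P where "\<And>i. represents (P i) (F i)" by metis
  with union(1,2) show ?case by (rule represents_UN) blast
qed

text \<open>The value 0 off the Borel sets matches the convention that makes
  \<open>spectral_measure\<close> unique.\<close>

definition spectral_proj :: "real set \<Rightarrow> ('a \<Rightarrow>\<^sub>L 'a)"
  where "spectral_proj S = (if S \<in> sets borel then SOME P. represents P S else 0)"

lemma represents_spectral_proj: "S \<in> sets borel \<Longrightarrow> represents (spectral_proj S) S"
  using someI_ex[OF represents_exists] by (simp add: spectral_proj_def)

lemma represents_imp_eq: "S \<in> sets borel \<Longrightarrow> represents P S \<Longrightarrow> spectral_proj S = P"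
  by (rule represents_unique[OF represents_spectral_proj])

lemma symmetric_spectral_proj: "S \<in> sets borel \<Longrightarrow> symmetric_op (spectral_proj S)"
  and inner_spectral_proj: "S \<in> sets borel \<Longrightarrow> spectral_proj S v \<bullet> v = measure (form_measure v) S"
  and spectral_proj_commute:
    "S \<in> sets borel \<Longrightarrow> A o\<^sub>L B = B o\<^sub>L A \<Longrightarrow> B o\<^sub>L spectral_proj S = spectral_proj S o\<^sub>L B"
  using represents_symmetric represents_inner represents_commute represents_spectral_proj by blast+

lemma spectral_proj_commute_self: "S \<in> sets borel \<Longrightarrow> A (spectral_proj S v) = spectral_proj S (A v)"
  using spectral_proj_commute[of S A, OF _ refl, THEN arg_cong, of "\<lambda>X. blinfun_apply X v"] by simp

lemma spectral_proj_commute_spectral_proj: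
  assumes "S \<in> sets borel" "S' \<in> sets borel"
  shows "spectral_proj S (spectral_proj S' v) = spectral_proj S' (spectral_proj S v)"
proof -
  have "A o\<^sub>L spectral_proj S = spectral_proj S o\<^sub>L A"
    by (rule spectral_proj_commute) (use assms in auto)
  from spectral_proj_commute[OF assms(2) this, THEN arg_cong, of "\<lambda>X. blinfun_apply X v"] show ?thesis
    by simp
qed

lemma spectral_proj_atMost: "spectral_proj {..s} v = v - upper_proj A s v"
  using represents_imp_eq[OF _ represents_atMost, of s] by (simp add: blinfun.diff_left)

lemma spectral_proj_Compl: "S \<in> sets borel \<Longrightarrow> spectral_proj (- S) v = v - spectral_proj S v"
  using represents_imp_eq[OF _ represents_Compl[OF represents_spectral_proj, of S]]
  by (simp add: blinfun.diff_left)

lemma spectral_proj_greaterThan: "spectral_proj {s<..} = upper_proj A s"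
  using spectral_proj_Compl[of "{..s}"] by (auto intro!: blinfun_eqI simp: spectral_proj_atMost)

lemma spectral_proj_sums:
  assumes F: "disjoint_family F" "range F \<subseteq> sets borel"
  shows "(\<lambda>i::nat. spectral_proj (F i) v) sums spectral_proj (\<Union>i. F i) v"
proof -
  have "represents (spectral_proj (F i)) (F i)" for i
    using F by (intro represents_spectral_proj) auto
  from represents_UN[OF F this] obtain L where
    L: "represents L (\<Union>i. F i)" "\<And>v. (\<lambda>i. spectral_proj (F i) v) sums blinfun_apply L v"
    by blast
  moreover have "spectral_proj (\<Union>i. F i) = L"
    using F L(1) by (intro represents_imp_eq) auto
  ultimately show ?thesis by simp
qed

lemma spectral_proj_UNIV: "spectral_proj UNIV = id_blinfun"
  and spectral_proj_empty: "spectral_proj {} = 0"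
proof -
  show "spectral_proj {} = 0"
    by (rule represents_imp_eq) (simp_all add: represents_def)
  then show "spectral_proj UNIV = id_blinfun"
    using spectral_proj_Compl[of "{}"] by (auto intro!: blinfun_eqI)
qed

lemma spectral_proj_Diff_subset:
  assumes "T \<in> sets borel" "S \<in> sets borel" "S \<subseteq> T"
  shows "spectral_proj (T - S) v = spectral_proj T v - spectral_proj S v"
proof -
  interpret finite_borel_measure "form_measure v" for v
    by (rule finite_borel_form_measure)
  have "spectral_proj (T - S) = spectral_proj T - spectral_proj S"
    using assms
    by (intro symmetric_op_eqI symmetric_op_diff symmetric_spectral_proj)
      (auto simp: inner_spectral_proj blinfun.diff_left inner_diff_left finite_measure_Diff)
  then show ?thesis by (simp add: blinfun.diff_left)
qed

text \<open>Multiplicativity is extended one argument at a time: from half-lines to Borel sets in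
  the first argument, then, after exchanging the commuting projections, in the other.\<close>

lemma spectral_proj_Int_induct:
  assumes T: "T \<in> sets borel"
    and base: "\<And>s v. spectral_proj {..s} (spectral_proj T v) = spectral_proj ({..s} \<inter> T) v"
    and S: "S \<in> sets borel"
  shows "spectral_proj S (spectral_proj T v) = spectral_proj (S \<inter> T) v"
  using S
proof (induction arbitrary: v rule: borel_real_induct)
  case (compl S)
  have "- S \<inter> T = T - (S \<inter> T)" by auto
  with compl T show ?case
    by (simp add: spectral_proj_Compl spectral_proj_Diff_subset)
next
  case (union F)
  have "(\<lambda>i. spectral_proj (F i) (spectral_proj T v)) sums spectral_proj (\<Union>i. F i) (spectral_proj T v)"
    using union by (intro spectral_proj_sums)
  moreover have "(\<lambda>i. spectral_proj (F i \<inter> T) v) sums spectral_proj (\<Union>i. F i \<inter> T) v"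
    using union T by (intro spectral_proj_sums) (auto simp: disjoint_family_on_def)
  ultimately show ?case
    using union.IH by (simp add: sums_unique2)
qed (simp_all add: base spectral_proj_empty)

lemma spectral_proj_Int:
  assumes "S \<in> sets borel" "T \<in> sets borel"
  shows "spectral_proj S (spectral_proj T v) = spectral_proj (S \<inter> T) v"
proof -
  have "spectral_proj {..s} (spectral_proj {..t} v) = spectral_proj ({..s} \<inter> {..t}) v" for s t v
  proof -
    have "{..s} \<inter> {..t} = {..min s t}" by auto
    then show ?thesis
      using upper_proj_max[of s t v] upper_proj_mono[of s t v] upper_proj_mono[of t s v]
      by (auto simp: spectral_proj_atMost blinfun.diff_right max_def min_def)
  qed
  from spectral_proj_Int_induct[OF _ this]
  have "spectral_proj S' (spectral_proj {..t} v) = spectral_proj (S' \<inter> {..t}) v" if "S' \<in> sets borel" for S' t v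
    using that by simp
  from this[OF assms(2)]
  have "spectral_proj {..t} (spectral_proj T v) = spectral_proj ({..t} \<inter> T) v" for t v
    using assms(2) by (simp add: spectral_proj_commute_spectral_proj[of "{..t}"] Int_commute)
  from spectral_proj_Int_induct[OF assms(2) this assms(1)] show ?thesis .
qed

lemma real_pvm_spectral_proj: "real_pvm spectral_proj"
  unfolding real_pvm_def
  by (auto simp: symmetric_spectral_proj spectral_proj_UNIV spectral_proj_Int spectral_proj_sums
      intro!: blinfun_eqI)

lemma spectral_proj_support:
  assumes lower: "\<And>v. c * (v \<bullet> v) \<le> A v \<bullet> v" and a: "a < c" and b: "norm A \<le> b"
  shows "spectral_proj {a<..b} = id_blinfun"
proof (rule blinfun_eqI)
  fix v
  have "spectral_proj {a<..b} v = spectral_proj {a<..} (spectral_proj {..b} v)"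
    by (subst spectral_proj_Int) (auto intro!: arg_cong[of _ _ "\<lambda>S. spectral_proj S v"])
  then show "spectral_proj {a<..b} v = id_blinfun v"
    using upper_proj_eq_id[OF lower a] upper_proj_eq_0[OF b]
    by (simp add: spectral_proj_atMost spectral_proj_greaterThan)
qed

lemma inner_eq_integral_spectral_proj: "A v \<bullet> v = (\<integral>l. l \<partial>pvm_measure spectral_proj v)"
proof (rule inner_eq_integral_pvm[OF real_pvm_spectral_proj])
  show "A (spectral_proj {..s} v) = spectral_proj {..s} (A v)" for s v
    by (simp add: spectral_proj_commute_self)
  have "- norm A * (v \<bullet> v) \<le> A v \<bullet> v" for v
    using abs_inner_op_le[of A v] by (simp add: abs_le_iff)
  from spectral_proj_support[OF this, of "- norm A - 1" "norm A"]
  show "spectral_proj {- norm A - 1<..norm A} v = v" by simp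
  show "- norm A - 1 \<le> norm A"
    using norm_ge_zero[of A] by linarith
  show "a * (v \<bullet> v) \<le> A v \<bullet> v \<and> A v \<bullet> v \<le> b * (v \<bullet> v)" if v: "spectral_proj {a<..b} v = v" for a b v
  proof
    have "spectral_proj {a<..} v = spectral_proj {a<..} (spectral_proj {a<..b} v)" by (simp add: v)
    also have "\<dots> = spectral_proj ({a<..} \<inter> {a<..b}) v" by (rule spectral_proj_Int) auto
    also have "{a<..} \<inter> {a<..b} = {a<..b}" by auto
    finally show "a * (v \<bullet> v) \<le> A v \<bullet> v"
      by (intro upper_proj_ge) (simp add: v spectral_proj_greaterThan)
    have "spectral_proj {b<..} v = spectral_proj {b<..} (spectral_proj {a<..b} v)" by (simp add: v)
    also have "\<dots> = spectral_proj ({b<..} \<inter> {a<..b}) v" by (rule spectral_proj_Int) auto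
    also have "{b<..} \<inter> {a<..b} = {}" by auto
    finally show "A v \<bullet> v \<le> b * (v \<bullet> v)"
      by (intro upper_proj_le) (simp add: spectral_proj_empty spectral_proj_greaterThan)
  qed
qed

text \<open>A spectral measure \<open>E\<close> of \<open>A\<close> commutes with \<open>A\<close>: the quadratic form of \<open>A\<close> splits along \<open>E S\<close>, so
  the off-diagonal part of \<open>A\<close> vanishes.  The projections \<open>E {s<..}\<close> and \<open>upper_proj A s\<close> then
  commute, and on either difference the form of \<open>A - s\<close> has contradictory signs.\<close>

lemma spectral_measure_commute:
  assumes E: "real_pvm E" and supp: "E {-R..R} = id_blinfun"
    and form: "\<And>v. A v \<bullet> v = (\<integral>l. l \<partial>pvm_measure E v)" and S: "S \<in> sets borel"
  shows "A (E S v) = E S (A v)"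
proof -
  let ?P = "E S"
  let ?Q = "id_blinfun - ?P"
  let ?X = "(?P o\<^sub>L A o\<^sub>L ?Q) + (?Q o\<^sub>L A o\<^sub>L ?P)"
  have symP: "?P x \<bullet> y = x \<bullet> ?P y" for x y
    using symmetric_pvm[OF E S] by (rule symmetric_opD)
  have PP: "?P (?P x) = ?P x" for x
    using pvm_Int[OF E S S] by simp
  have int: "integrable (pvm_measure E v) (\<lambda>l. l)" for v
    by (rule integrable_pvm[OF E, of "{-R..R}" _ _ R]) (auto simp: supp)
  have "?X v \<bullet> v = 0" for v
  proof -
    have "A v \<bullet> v = A (?P v) \<bullet> ?P v + A (v - ?P v) \<bullet> (v - ?P v)"
      using integral_pvm_split[OF E S int, of v] by (simp add: form)
    moreover have "?X v \<bullet> v = A v \<bullet> v - A (?P v) \<bullet> ?P v - A (v - ?P v) \<bullet> (v - ?P v)"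
      by (simp add: blinfun.bilinear_simps inner_simps symP)
    ultimately show ?thesis by linarith
  qed
  moreover have "symmetric_op ?X"
    using sym unfolding symmetric_op_def
    by (simp add: blinfun.bilinear_simps inner_simps symP)
  ultimately have "?X = 0"
    by (intro symmetric_op_eqI) auto
  then have X: "?X w = 0" for w by simp
  have off: "?P (A (w - ?P w)) + (A (?P w) - ?P (A (?P w))) = 0" for w
    using X[of w] by (simp add: blinfun.bilinear_simps)
  \<comment> \<open>\<open>off\<close> at \<open>P v\<close> gives \<open>(1 - P) A P v = 0\<close>,
    and at \<open>v - P v\<close> it gives \<open>P A (1 - P) v = 0\<close>; hence
    \<open>A P = P A P = P A\<close>.\<close>
  have "A (?P v) - ?P (A (?P v)) =
      ?P (A (?P v - ?P (?P v))) + (A (?P (?P v)) - ?P (A (?P (?P v))))"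
    by (simp only: PP diff_self blinfun.zero_right add_0)
  moreover have "?P (A v) - ?P (A (?P v)) =
      ?P (A ((v - ?P v) - ?P (v - ?P v))) + (A (?P (v - ?P v)) - ?P (A (?P (v - ?P v))))"
    by (simp only: blinfun.diff_right PP diff_self blinfun.zero_right diff_0_right add_0_right)
  ultimately show ?thesis
    unfolding off by (metis eq_iff_diff_eq_0)
qed

lemma spectral_measure_unique_half_line:
  assumes E: "real_pvm E" and supp: "E {-R..R} = id_blinfun"
    and form: "\<And>v. A v \<bullet> v = (\<integral>l. l \<partial>pvm_measure E v)"
  shows "E {s<..} v = upper_proj A s v"
proof -
  let ?P = "E {s<..}" and ?Q = "upper_proj A s"
  have meas: "{s<..} \<in> sets borel" by simp
  have PP: "?P (?P x) = ?P x" for x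
    using pvm_Int[OF E meas meas] by simp
  have comm: "?P (?Q x) = ?Q (?P x)" for x
  proof -
    have "A o\<^sub>L ?P = ?P o\<^sub>L A"
      by (rule blinfun_eqI) (simp add: spectral_measure_commute[OF E supp form])
    from upper_proj_commute[OF this, of s, THEN arg_cong, of "\<lambda>X. blinfun_apply X x"] show ?thesis
      by simp
  qed
  have int: "integrable (pvm_measure E w) (\<lambda>l. l)" for w
    by (rule integrable_pvm[OF E, of "{-R..R}" _ _ R]) (auto simp: supp)
  have shift: "(\<integral>l. l - s \<partial>pvm_measure E w) = A w \<bullet> w - s * (w \<bullet> w)" for w
  proof -
    interpret finite_borel_measure "pvm_measure E w"
      by (rule finite_borel_pvm_measure[OF E])
    show ?thesis
      using int by (simp add: form measure_pvm_measure[OF E] pvm_UNIV[OF E])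
  qed
  have "?P v - ?Q (?P v) = 0"
  proof -
    let ?w = "?P v - ?Q (?P v)"
    have Pw: "?P ?w = ?w" by (simp add: blinfun.diff_right comm PP)
    have "?Q ?w = 0" by (simp add: blinfun.diff_right upper_proj_idem)
    then have "(\<integral>l. l - s \<partial>pvm_measure E ?w) \<le> 0"
      using upper_proj_le[of s ?w] by (simp add: shift)
    moreover have AE: "AE l in pvm_measure E ?w. l \<in> {s<..}"
      by (rule AE_pvm_support[OF E meas Pw])
    then have nonneg: "AE l in pvm_measure E ?w. 0 \<le> l - s" by auto
    then have "0 \<le> (\<integral>l. l - s \<partial>pvm_measure E ?w)"
      by (rule integral_nonneg_AE)
    ultimately have "(\<integral>l. l - s \<partial>pvm_measure E ?w) = 0" by simp
    moreover interpret finite_borel_measure "pvm_measure E ?w"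
      by (rule finite_borel_pvm_measure[OF E])
    have "integrable (pvm_measure E ?w) (\<lambda>l. l - s)"
      using int by simp
    ultimately have "AE l in pvm_measure E ?w. l - s = 0"
      using integral_nonneg_eq_0_iff_AE[OF _ nonneg] by simp
    \<comment> \<open>Almost everywhere both \<open>l = s\<close> and \<open>s < l\<close>, so the
      measure is null; its total mass is the squared norm of the vector.\<close>
    with AE have "AE l in pvm_measure E ?w. False" by eventually_elim auto
    then have "emeasure (pvm_measure E ?w) UNIV = 0"
      by (simp add: AE_iff_measurable[of UNIV] )
    then show ?thesis
      by (simp add: emeasure_pvm_measure[OF E] pvm_UNIV[OF E])
  qed
  moreover have "?Q v - ?P (?Q v) = 0"
  proof (rule upper_proj_strict)
    let ?w = "?Q v - ?P (?Q v)"
    show "?Q ?w = ?w" by (simp add: blinfun.diff_right comm upper_proj_idem)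
    have "?P ?w = 0"
      by (simp add: blinfun.diff_right PP)
    then have "E (- {s<..}) ?w = ?w"
      unfolding pvm_Compl[OF E meas] by simp
    then have "AE l in pvm_measure E ?w. l \<in> - {s<..}"
      by (intro AE_pvm_support[OF E]) auto
    then have "0 \<le> (\<integral>l. - (l - s) \<partial>pvm_measure E ?w)"
      by (intro integral_nonneg_AE) auto
    then have "(\<integral>l. l - s \<partial>pvm_measure E ?w) \<le> 0"
      unfolding Bochner_Integration.integral_minus by simp
    then show "A ?w \<bullet> ?w \<le> s * (?w \<bullet> ?w)" by (simp add: shift)
  qed
  ultimately show ?thesis using comm[of v] by (metis eq_iff_diff_eq_0)
qed

lemma spectral_measure_unique:
  assumes E: "real_pvm E" and supp: "E {-R..R} = id_blinfun"
    and form: "\<And>v. A v \<bullet> v = (\<integral>l. l \<partial>pvm_measure E v)" and S: "S \<in> sets borel"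
  shows "E S = spectral_proj S"
proof (rule blinfun_eqI)
  fix v show "E S v = spectral_proj S v"
    using S
  proof (induction rule: borel_real_induct)
    case (atMost a)
    have "E (- {a<..}) v = v - upper_proj A a v"
      using spectral_measure_unique_half_line[OF assms(1-3), of a v] pvm_Compl[OF E, of "{a<..}" v]
      by simp
    then show ?case by (simp add: spectral_proj_atMost Compl_greaterThan)
  next
    case (union F)
    then show ?case
      using pvm_sums[OF E, of F v] spectral_proj_sums[of F v] by (simp add: sums_unique2)
  qed (simp_all add: pvm_empty[OF E] pvm_Compl[OF E] spectral_proj_empty spectral_proj_Compl)
qed

end

section \<open>Bounded Borel functional calculus\<close>

context symmetric_operator
begin

lemma spectral_proj_not_borel: "S \<notin> sets borel \<Longrightarrow> spectral_proj S = 0"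
  by (simp add: spectral_proj_def)

text \<open>\<open>upper_proj_eq_id\<close> reaches only thresholds strictly below \<open>c\<close>,
  since \<open>c\<close> may be an eigenvalue. The thresholds \<open>c - 1 / (n + 1)\<close> exhaust
  \<open>{..<c}\<close> by null sets.\<close>

lemma spectral_proj_atLeast:
  assumes lower: "\<And>v. c * (v \<bullet> v) \<le> A v \<bullet> v"
  shows "spectral_proj {c..} v = v"
proof -
  have "emeasure (pvm_measure spectral_proj v) (\<Union>n. {..c - 1 / real (Suc n)}) = 0"
  proof (intro emeasure_UN_eq_0)
    fix n :: nat
    have "spectral_proj {..c - 1 / real (Suc n)} v = 0"
      using upper_proj_eq_id[OF lower, of "c - 1 / real (Suc n)" v] by (simp add: spectral_proj_atMost)
    then show "emeasure (pvm_measure spectral_proj v) {..c - 1 / real (Suc n)} = 0"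
      by (simp add: emeasure_pvm_measure[OF real_pvm_spectral_proj])
  qed auto
  moreover have "(\<Union>n. {..c - 1 / real (Suc n)}) = {..<c}"
  proof (intro equalityI subsetI)
    fix x assume "x \<in> {..<c}"
    then obtain n where "inverse (real (Suc n)) < c - x"
      using reals_Archimedean[of "c - x"] by auto
    then show "x \<in> (\<Union>n. {..c - 1 / real (Suc n)})"
      by (auto simp: inverse_eq_divide intro!: exI[of _ n])
  next
    fix x assume "x \<in> (\<Union>n. {..c - 1 / real (Suc n)})"
    then obtain n where "x \<le> c - 1 / real (Suc n)" by auto
    moreover have "0 < 1 / real (Suc n)" by simp
    ultimately show "x \<in> {..<c}" unfolding lessThan_iff by linarith
  qed
  ultimately have "spectral_proj {..<c} v \<bullet> v \<le> 0"
    by (simp add: emeasure_pvm_measure[OF real_pvm_spectral_proj] ennreal_eq_0_iff)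
  then have "spectral_proj {..<c} v = 0"
    by (simp add: inner_pvm[OF real_pvm_spectral_proj])
  moreover have "- {..<c} = {c..}" by auto
  ultimately show ?thesis
    using spectral_proj_Compl[of "{..<c}" v] by simp
qed

lemma spectral_proj_support_Icc:
  assumes lower: "\<And>v. c * (v \<bullet> v) \<le> A v \<bullet> v" and b: "norm A \<le> b"
  shows "spectral_proj {c..b} v = v"
proof -
  have "spectral_proj {c..b} v = spectral_proj {c..} (spectral_proj {..b} v)"
    by (subst spectral_proj_Int) (auto simp: atLeastAtMost_def)
  also have "\<dots> = v"
    using upper_proj_eq_0[OF b] by (simp add: spectral_proj_atMost spectral_proj_atLeast[OF lower])
  finally show ?thesis .
qed

text \<open>\<open>B\<close> is the integral of \<open>f\<close> against the spectral measure, given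
  by its form. The commutation clause later yields complex linearity and membership in the
  algebra.\<close>

definition op_integral :: "(real \<Rightarrow> real) \<Rightarrow> ('a \<Rightarrow>\<^sub>L 'a) \<Rightarrow> bool"
  where "op_integral f B \<longleftrightarrow> symmetric_op B \<and>
    (\<forall>v. B v \<bullet> v = (\<integral>l. f l \<partial>pvm_measure spectral_proj v)) \<and>
    (\<forall>C. A o\<^sub>L C = C o\<^sub>L A \<longrightarrow> C o\<^sub>L B = B o\<^sub>L C)"

lemma op_integralI:
  assumes "symmetric_op B" "\<And>v. B v \<bullet> v = (\<integral>l. f l \<partial>pvm_measure spectral_proj v)"
    "\<And>C. A o\<^sub>L C = C o\<^sub>L A \<Longrightarrow> C o\<^sub>L B = B o\<^sub>L C"
  shows "op_integral f B"
  using assms unfolding op_integral_def by blast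

lemma op_integral_symmetric: "op_integral f B \<Longrightarrow> symmetric_op B"
  and op_integral_inner: "op_integral f B \<Longrightarrow> B v \<bullet> v = (\<integral>l. f l \<partial>pvm_measure spectral_proj v)"
  and op_integral_commute: "op_integral f B \<Longrightarrow> A o\<^sub>L C = C o\<^sub>L A \<Longrightarrow> C o\<^sub>L B = B o\<^sub>L C"
  unfolding op_integral_def by blast+

lemma integrable_bounded_borel:
  fixes g :: "real \<Rightarrow> real"
  assumes "g \<in> borel_measurable borel" "\<And>l. 0 \<le> g l" "\<And>l. g l \<le> K"
  shows "integrable (pvm_measure spectral_proj v) g"
  by (rule integrable_pvm[OF real_pvm_spectral_proj, of UNIV _ _ K])
    (use assms in \<open>auto simp: spectral_proj_UNIV\<close>)

lemma op_integral_mult: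
  assumes "op_integral u B"
  shows "op_integral (\<lambda>l. c * u l) (c *\<^sub>R B)"
proof (rule op_integralI)
  show "C o\<^sub>L (c *\<^sub>R B) = (c *\<^sub>R B) o\<^sub>L C" if "A o\<^sub>L C = C o\<^sub>L A" for C
    using op_integral_commute[OF assms that]
    by (simp add: bounded_bilinear.scaleR_left[OF bounded_bilinear_blinfun_compose]
        bounded_bilinear.scaleR_right[OF bounded_bilinear_blinfun_compose])
qed (simp_all add: op_integral_symmetric[OF assms] op_integral_inner[OF assms]
    symmetric_op_scaleR blinfun.scaleR_left)

lemma op_integral_add:
  assumes B: "op_integral u B" "op_integral w B'"
    and int: "\<And>v. integrable (pvm_measure spectral_proj v) u" "\<And>v. integrable (pvm_measure spectral_proj v) w"
  shows "op_integral (\<lambda>l. u l + w l) (B + B')"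
proof (rule op_integralI)
  show "C o\<^sub>L (B + B') = (B + B') o\<^sub>L C" if "A o\<^sub>L C = C o\<^sub>L A" for C
    using op_integral_commute[OF B(1) that] op_integral_commute[OF B(2) that]
    by (simp add: bounded_bilinear.add_left[OF bounded_bilinear_blinfun_compose]
        bounded_bilinear.add_right[OF bounded_bilinear_blinfun_compose])
qed (use B int in \<open>simp_all add: op_integral_symmetric op_integral_inner
    symmetric_op_add blinfun.add_left inner_add_left\<close>)

text \<open>Monotone bounded forms give a strong limit of the operators; the constant
  \<open>K\<close> is integrable for each finite scalar measure and serves as the dominating
  function that identifies the limit form.\<close>

lemma op_integral_seq:
  assumes B: "\<And>n. op_integral (U n) (B n)" and U: "\<And>n. U n \<in> borel_measurable borel"
    and nonneg: "\<And>n l. 0 \<le> U n l" and le: "\<And>n l. U n l \<le> K" and mono: "\<And>m n l. m \<le> n \<Longrightarrow> U m l \<le> U n l"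
    and lim: "\<And>l. (\<lambda>n. U n l) \<longlonglongrightarrow> f l" and f: "f \<in> borel_measurable borel"
  shows "\<exists>L. op_integral f L"
proof -
  note pvm = real_pvm_spectral_proj
  interpret finite_borel_measure "pvm_measure spectral_proj v" for v
    by (rule finite_borel_pvm_measure[OF pvm])
  have int: "integrable (pvm_measure spectral_proj v) (U n)" for n v
    using U nonneg le by (rule integrable_bounded_borel)
  note form = op_integral_inner[OF B]
  have monoB: "B m v \<bullet> v \<le> B n v \<bullet> v" if "m \<le> n" for m n v
    unfolding form using mono[OF that] by (intro integral_mono int)
  have lowerB: "0 \<le> B n v \<bullet> v" for n v
    unfolding form using nonneg by (intro integral_nonneg_AE) auto
  have upperB: "B n v \<bullet> v \<le> K * (v \<bullet> v)" for n v
    unfolding form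
    by (rule integral_pvm_bounds(2)[OF pvm, of UNIV _ _ 0]) (use U nonneg le in \<open>auto simp: spectral_proj_UNIV\<close>)
  obtain L :: "'a \<Rightarrow>\<^sub>L 'a" where L: "symmetric_op L" "\<And>v. (\<lambda>n. B n v) \<longlonglongrightarrow> L v"
    by (rule incseq_op_strong_limit[of B K, OF op_integral_symmetric[OF B] monoB lowerB upperB])
      (assumption | rule that)+
  have "op_integral f L"
  proof (rule op_integralI[OF L(1)])
    fix v
    have "(\<lambda>n. B n v \<bullet> v) \<longlonglongrightarrow> (\<integral>l. f l \<partial>pvm_measure spectral_proj v)"
      unfolding form
      by (rule integral_dominated_convergence[where w="\<lambda>_. K"])
        (use U f nonneg le lim in \<open>auto simp: abs_of_nonneg\<close>)
    moreover have "(\<lambda>n. B n v \<bullet> v) \<longlonglongrightarrow> L v \<bullet> v"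
      by (intro tendsto_intros L)
    ultimately show "L v \<bullet> v = (\<integral>l. f l \<partial>pvm_measure spectral_proj v)"
      using LIMSEQ_unique by blast
  next
    show "C o\<^sub>L L = L o\<^sub>L C" if "A o\<^sub>L C = C o\<^sub>L A" for C
      by (rule commute_limit[OF op_integral_commute[OF B that] L(2)])
  qed
  then show ?thesis by blast
qed

text \<open>Induction over nonnegative Borel functions. The bound is generalised because each
  constituent needs its own: \<open>K / c\<close> below a multiple, \<open>K\<close> for each
  summand and for each member of an increasing sequence.\<close>

lemma bounded_borel_op_exists:
  fixes f :: "real \<Rightarrow> real"
  assumes "f \<in> borel_measurable borel" "\<And>l. 0 \<le> f l" "\<And>l. f l \<le> K"
  shows "\<exists>B. op_integral f B"
  using assms
proof (induction f arbitrary: K rule: borel_measurable_induct_real)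
  case (set S)
  then have "op_integral (indicator S) (spectral_proj S)"
    by (intro op_integralI symmetric_spectral_proj spectral_proj_commute)
      (simp_all add: measure_pvm_measure[OF real_pvm_spectral_proj])
  then show ?case by blast
next
  case (mult u c)
  show ?case
  \<comment> \<open>For \<open>c = 0\<close> the bound on the product says nothing about
    \<open>u\<close>, which may be unbounded.\<close>
  proof (cases "c = 0")
    case True
    then have "op_integral (\<lambda>l. c * u l) 0"
      by (intro op_integralI) simp_all
    then show ?thesis by blast
  next
    case False
    with mult(1) have "c > 0" by simp
    then have "u l \<le> K / c" for l
      using mult.prems[of l] by (simp add: field_simps)
    then obtain B where "op_integral u B" using mult.IH[of "K / c"] by blast
    then have "op_integral (\<lambda>l. c * u l) (c *\<^sub>R B)" by (rule op_integral_mult)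
    then show ?thesis by blast
  qed
next
  case (add u w)
  have le: "u l \<le> K" "w l \<le> K" for l
    using add.hyps(2)[of l] add.hyps(4)[of l] add.prems[of l] by linarith+
  obtain B where "op_integral u B" using add.IH(1)[OF le(1)] by blast
  moreover obtain B' where "op_integral w B'" using add.IH(2)[OF le(2)] by blast
  moreover have "integrable (pvm_measure spectral_proj v) u" "integrable (pvm_measure spectral_proj v) w" for v
    by (rule integrable_bounded_borel[OF add.hyps(1,2) le(1)],
        rule integrable_bounded_borel[OF add.hyps(3,4) le(2)])
  ultimately have "op_integral (\<lambda>l. w l + u l) (B' + B)"
    by (intro op_integral_add)
  then show ?case by blast
next
  case (seq U)
  have mono: "U m l \<le> U n l" if "m \<le> n" for m n l
    using \<open>incseq U\<close> that by (simp add: incseq_def le_fun_def)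
  have lim: "(\<lambda>n. U n l) \<longlonglongrightarrow> f l" for l
    using seq.hyps(4)[of l] by simp
  have le: "U n l \<le> K" for n l
  proof -
    have "U n l \<le> f l"
      using lim by (rule LIMSEQ_le_const) (intro exI[of _ n] allI impI mono)
    then show ?thesis using seq.prems[of l] by linarith
  qed
  have "\<exists>B. op_integral (U n) B" for n
    by (rule seq.IH[OF le])
  then have "\<forall>n. \<exists>B. op_integral (U n) B" by (rule allI)
  from choice[OF this] obtain B where B: "\<And>n. op_integral (U n) (B n)" by blast
  show ?case
    by (rule op_integral_seq[of U B K f, OF B seq.hyps(1,2) le mono lim assms(1)])
qed

end

section \<open>Adjoints\<close>

text \<open>The representing vector minimises \<open>norm x ^ 2 - 2 * \<phi> x\<close>. The
  parallelogram law makes minimising sequences Cauchy, and the first variation at the minimiser is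
  the representation.\<close>

lemma riesz_representation:
  fixes \<phi> :: "'a::{real_inner,complete_space} \<Rightarrow> real"
  assumes "bounded_linear \<phi>"
  obtains u where "\<And>x. \<phi> x = x \<bullet> u"
proof -
  interpret bounded_linear \<phi> by fact
  obtain K where K: "\<And>x. norm (\<phi> x) \<le> norm x * K"
    using bounded by blast
  define g where "g x = (norm x)\<^sup>2 - 2 * \<phi> x" for x
  define m where "m = (INF x. g x)"
  have lower: "- K\<^sup>2 \<le> g x" for x
  proof -
    have "0 \<le> (norm x - K)\<^sup>2" by simp
    moreover have "\<phi> x \<le> norm x * K" using K[of x] by simp
    ultimately show ?thesis by (simp add: g_def power2_eq_square algebra_simps)
  qed
  then have bdd: "bdd_below (range g)" by (intro bdd_belowI[of _ "- K\<^sup>2"]) auto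
  then have m: "m \<le> g x" for x
    unfolding m_def by (intro cINF_lower) auto
  have "\<exists>x. g x < m + (1/2) ^ n" for n
    using cINF_less_iff[OF _ bdd, of "m + (1/2) ^ n"] by (auto simp: m_def)
  then obtain X where X: "\<And>n. g (X n) < m + (1/2) ^ n" by metis
  have par: "(norm (x - y))\<^sup>2 = 2 * g x + 2 * g y - 4 * g ((1/2) *\<^sub>R (x + y))" for x y
    unfolding g_def power2_norm_eq_inner
    by (simp add: inner_simps add scaleR inner_commute) (simp add: field_simps)
  have "Cauchy X"
  proof (rule Cauchy_of_dist_sq_le)
    \<comment> \<open>\<open>par\<close> and the choice of \<open>X\<close> bound the left side by
      \<open>2 (1/2)^k + 2 (1/2)^n\<close>. For \<open>n > k\<close> this is at most
      \<open>3 (1/2)^k\<close>, while the right side is at least \<open>4 (1/2)^k\<close>.\<close>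
    show "(dist (X k) (X n))\<^sup>2 \<le> - 8 * (1/2) ^ n - (- 8 * (1/2) ^ k)" if "k \<le> n" for k n
    proof (cases "k = n")
      case False
      then have "(1/2 :: real) ^ n \<le> (1/2) ^ Suc k"
        using that by (intro power_decreasing) auto
      then have "2 * (1/2 :: real) ^ n \<le> (1/2) ^ k" by simp
      moreover have "0 \<le> (1/2 :: real) ^ k" by simp
      ultimately show ?thesis
        unfolding dist_norm par
        using X[of k] X[of n] m[of "(1/2) *\<^sub>R (X k + X n)"] by linarith
    qed simp
    show "- 8 * (1/2) ^ n \<le> (0::real)" for n by simp
  qed
  then obtain u where u: "X \<longlonglongrightarrow> u"
    by (auto simp: Cauchy_convergent_iff convergent_def)
  have "(\<lambda>n. g (X n)) \<longlonglongrightarrow> g u"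
    unfolding g_def by (intro tendsto_intros u tendsto)
  moreover have "(\<lambda>n. m + (1/2) ^ n) \<longlonglongrightarrow> m + 0"
    by (intro tendsto_intros LIMSEQ_power_zero) simp
  ultimately have gu: "g u \<le> m"
    using X by (intro LIMSEQ_le[of "\<lambda>n. g (X n)" _ "\<lambda>n. m + (1/2) ^ n"]) (auto intro: less_imp_le)
  have "\<phi> x = x \<bullet> u" for x
  proof (cases "x = 0")
    case False
    define d where "d = x \<bullet> u - \<phi> x"
    \<comment> \<open>This \<open>t\<close> minimises \<open>2 t d + t^2 (x \<bullet> x)\<close>;
      the minimum \<open>- d^2 / (x \<bullet> x)\<close> is nonnegative only for
      \<open>d = 0\<close>.\<close>
    define t where "t = - d / (x \<bullet> x)"
    have pos: "x \<bullet> x > 0" using False by simp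
    have "0 \<le> g (u + t *\<^sub>R x) - g u"
      using gu m[of "u + t *\<^sub>R x"] by linarith
    also have "\<dots> = 2 * t * d + t * t * (x \<bullet> x)"
      by (simp add: g_def d_def power2_norm_eq_inner inner_simps add scaleR inner_commute algebra_simps)
    also have "\<dots> = - d\<^sup>2 / (x \<bullet> x)"
      using pos by (simp add: t_def field_simps power2_eq_square)
    finally have "d\<^sup>2 \<le> 0"
      using pos by (simp add: field_simps)
    then show ?thesis by (simp add: d_def)
  qed (simp add: zero)
  then show ?thesis using that by blast
qed

lemma real_adjoint_exists:
  fixes A :: "'a::{real_inner,complete_space} \<Rightarrow>\<^sub>L 'a"
  obtains B :: "'a \<Rightarrow>\<^sub>L 'a" where "\<And>x y. A x \<bullet> y = x \<bullet> B y"
proof -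
  have "\<exists>u. \<forall>x. A x \<bullet> y = x \<bullet> u" for y
  proof -
    have "bounded_linear (\<lambda>x. A x \<bullet> y)"
      by (intro bounded_linear_intros)
    then show ?thesis using riesz_representation[of "\<lambda>x. A x \<bullet> y"] by metis
  qed
  then obtain b where b: "\<And>x y. A x \<bullet> y = x \<bullet> b y" by metis
  have eqI: "u = w" if "\<And>x. x \<bullet> u = x \<bullet> w" for u w :: 'a
    using that vector_eq_ldot by blast
  have "bounded_linear b"
  proof (rule bounded_linear_intro[where K="norm A"])
    show "b (x + y) = b x + b y" for x y
      by (rule eqI) (simp add: inner_add_right flip: b)
    show "b (r *\<^sub>R x) = r *\<^sub>R b x" for r x
      by (rule eqI) (simp flip: b)
    show "norm (b y) \<le> norm y * norm A" for y
    proof (cases "b y = 0")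
      case False
      have "norm (b y) * norm (b y) = A (b y) \<bullet> y"
        using b[of "b y" y] by (simp add: power2_norm_eq_inner[unfolded power2_eq_square])
      also have "\<dots> \<le> norm (A (b y)) * norm y" by (rule norm_cauchy_schwarz)
      also have "\<dots> \<le> (norm A * norm (b y)) * norm y"
        by (intro mult_right_mono norm_blinfun norm_ge_zero)
      finally have "norm (b y) * norm (b y) \<le> (norm y * norm A) * norm (b y)"
        by (simp add: algebra_simps)
      then show ?thesis using False by simp
    qed simp
  qed
  then show ?thesis
    using that[of "Blinfun b"] by (simp add: bounded_linear_Blinfun_apply b)
qed

section \<open>Complex Hilbert spaces\<close>

lemma cinner_scaleC_right: "cinner x (c *\<^sub>C y) = cnj c * cinner x y" for x y :: "'a::complex_inner"
  by (metis cinner_commute cinner_scaleC_left complex_cnj_mult)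

lemma cinner_add_right: "cinner x (y + z) = cinner x y + cinner x z" for x y z :: "'a::complex_inner"
  by (metis cinner_add_left cinner_commute complex_cnj_add)

text \<open>Multiplying an argument by the imaginary unit exposes the imaginary part, so the real
  inner product recovers the complex one and the real theory can be applied.\<close>

lemma cinner_eq_Complex: "cinner x y = Complex (x \<bullet> y) (- ((\<i> *\<^sub>C x) \<bullet> y))" for x y :: "'a::complex_inner"
  by (simp add: complex_eq_iff inner_eq_Re_cinner cinner_scaleC_left)

lemma inner_imaginary: "(\<i> *\<^sub>C x) \<bullet> (\<i> *\<^sub>C y) = x \<bullet> y" for x y :: "'a::complex_inner"
  by (simp add: inner_eq_Re_cinner cinner_scaleC_left cinner_scaleC_right)

lemma inner_imaginary_left: "(\<i> *\<^sub>C x) \<bullet> y = - (x \<bullet> \<i> *\<^sub>C y)" for x y :: "'a::complex_inner"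
  by (simp add: inner_eq_Re_cinner cinner_scaleC_left cinner_scaleC_right)

lemma scaleC_eq: "c *\<^sub>C x = Re c *\<^sub>R x + Im c *\<^sub>R \<i> *\<^sub>C x" for x :: "'a::complex_inner"
proof -
  have "c *\<^sub>C x = (complex_of_real (Re c) + complex_of_real (Im c) * \<i>) *\<^sub>C x"
    by (rule arg_cong[of c]) (simp add: complex_eq_iff)
  then show ?thesis
    by (simp add: scaleC_add_left scaleC_of_real flip: scaleC_scaleC)
qed

definition imaginary_op :: "'h::chilbert_space \<Rightarrow>\<^sub>L 'h"
  where "imaginary_op = Blinfun (\<lambda>x. \<i> *\<^sub>C x)"

lemma imaginary_op_apply [simp]: "imaginary_op x = \<i> *\<^sub>C x" for x :: "'h::chilbert_space"
proof -
  have "bounded_linear (\<lambda>x::'h. \<i> *\<^sub>C x)"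
  proof (rule bounded_linear_intro[where K=1])
    show "\<i> *\<^sub>C r *\<^sub>R x = r *\<^sub>R \<i> *\<^sub>C x" for r and x :: 'h
      by (simp add: scaleC_scaleC mult.commute flip: scaleC_of_real)
    show "norm (\<i> *\<^sub>C x) \<le> norm x * 1" for x :: 'h
      by (simp add: norm_eq_sqrt_inner inner_imaginary)
  qed (rule scaleC_add_right)
  then show ?thesis by (simp add: imaginary_op_def bounded_linear_Blinfun_apply)
qed

lemma bounded_ops_iff: "A \<in> bounded_ops \<longleftrightarrow> A o\<^sub>L imaginary_op = imaginary_op o\<^sub>L A"
proof
  assume "A \<in> bounded_ops"
  then show "A o\<^sub>L imaginary_op = imaginary_op o\<^sub>L A"
    by (auto simp: bounded_ops_def intro!: blinfun_eqI)
next
  assume eq: "A o\<^sub>L imaginary_op = imaginary_op o\<^sub>L A"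
  have "A (\<i> *\<^sub>C x) = \<i> *\<^sub>C A x" for x
    using eq[THEN arg_cong, of "\<lambda>X. blinfun_apply X x"] by simp
  then have "A (Re c *\<^sub>R x + Im c *\<^sub>R \<i> *\<^sub>C x) = Re c *\<^sub>R A x + Im c *\<^sub>R \<i> *\<^sub>C A x" for c x
    by (simp add: blinfun.add_right blinfun.scaleR_right)
  then show "A \<in> bounded_ops"
    unfolding bounded_ops_def by (simp flip: scaleC_eq)
qed

lemma bounded_ops_imaginary: "A \<in> bounded_ops \<Longrightarrow> A (\<i> *\<^sub>C x) = \<i> *\<^sub>C A x"
  by (simp add: bounded_ops_def)

lemma cinner_op_eqI:
  fixes A B :: "'h::chilbert_space \<Rightarrow>\<^sub>L 'h"
  assumes "\<And>x y. A x \<bullet> y = x \<bullet> B y" "A \<in> bounded_ops"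
  shows "cinner (A x) y = cinner x (B y)"
  using assms(1)[of x y] assms(1)[of "\<i> *\<^sub>C x" y]
  by (simp add: cinner_eq_Complex bounded_ops_imaginary[OF assms(2)])

lemma cinner_op_adjoint:
  assumes "A \<in> bounded_ops"
  shows "cinner (A x) y = cinner x (op_adjoint A y)"
proof -
  obtain B where "\<And>x y. A x \<bullet> y = x \<bullet> blinfun_apply B y"
    using real_adjoint_exists by blast
  then have B: "\<forall>x y. cinner (A x) y = cinner x (blinfun_apply B y)"
    using cinner_op_eqI assms by blast
  have "C = B" if "\<forall>x y. cinner (A x) y = cinner x (blinfun_apply C y)" for C
  proof (rule blinfun_eqI)
    fix y
    have "cinner x (C y) = cinner x (B y)" for x
      using that B by metis
    then have "x \<bullet> C y = x \<bullet> B y" for x by (simp add: inner_eq_Re_cinner)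
    then show "C y = B y" using vector_eq_ldot by blast
  qed
  then have "op_adjoint A = B"
    unfolding op_adjoint_def using B by (intro the_equality) auto
  with B show ?thesis by simp
qed

lemma op_adjoint_eq_self_iff:
  assumes "A \<in> bounded_ops"
  shows "op_adjoint A = A \<longleftrightarrow> symmetric_op A"
proof
  assume "op_adjoint A = A"
  with cinner_op_adjoint[OF assms] show "symmetric_op A"
    by (simp add: symmetric_op_def inner_eq_Re_cinner)
next
  assume "symmetric_op A"
  then have "cinner (A x) y = cinner x (A y)" for x y
    using assms by (intro cinner_op_eqI) (simp_all add: symmetric_op_def)
  then have eq: "cinner x (op_adjoint A y) = cinner x (A y)" for x y
    using cinner_op_adjoint[OF assms] by metis
  show "op_adjoint A = A"
  proof (rule blinfun_eqI)
    fix y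
    have "x \<bullet> op_adjoint A y = x \<bullet> A y" for x
      using eq by (simp add: inner_eq_Re_cinner)
    then show "op_adjoint A y = A y" using vector_eq_ldot by blast
  qed
qed

lemma cinner_symmetric_op:
  assumes "A \<in> bounded_ops" "symmetric_op A"
  shows "cinner (A x) x = complex_of_real (A x \<bullet> x)"
proof -
  have "(\<i> *\<^sub>C A x) \<bullet> x = A x \<bullet> \<i> *\<^sub>C x"
    using symmetric_opD[OF assms(2), of "\<i> *\<^sub>C x" x] bounded_ops_imaginary[OF assms(1), of x]
      symmetric_opD[OF assms(2), of x "\<i> *\<^sub>C x"]
    by (simp add: inner_commute)
  then have "(\<i> *\<^sub>C A x) \<bullet> x = 0"
    using inner_imaginary_left[of "A x" x] by simp
  then show ?thesis by (simp add: cinner_eq_Complex complex_eq_iff)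
qed

text \<open>Polarization at \<open>x + \<i> y\<close>: once the diagonal terms are known to be real,
  the imaginary part consists of the mixed terms alone. Positivity over complex scalars therefore
  includes symmetry.\<close>

lemma symmetric_opI_real:
  assumes A: "A \<in> bounded_ops" and real: "\<And>x. Im (cinner (A x) x) = 0"
  shows "symmetric_op A"
  unfolding symmetric_op_def
proof (intro allI)
  fix x y
  have "Im (cinner (A (x + \<i> *\<^sub>C y)) (x + \<i> *\<^sub>C y)) = 0" by (rule real)
  then have "Re (cinner (A x) y) = Re (cinner (A y) x)"
    using real[of x] real[of y]
    by (simp add: blinfun.add_right bounded_ops_imaginary[OF A] cinner_add_left cinner_add_right
        cinner_scaleC_left cinner_scaleC_right)
  then show "A x \<bullet> y = x \<bullet> A y"
    by (simp add: inner_commute[of x] flip: inner_eq_Re_cinner)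
qed

lemma positive_op_iff: "positive_op A \<longleftrightarrow> A \<in> bounded_ops \<and> nonneg_op A"
proof
  assume "positive_op A"
  then have A: "A \<in> bounded_ops" and nn: "\<And>x. cinner (A x) x \<in> \<real>\<^sub>\<ge>\<^sub>0"
    by (auto simp: positive_op_def)
  have "symmetric_op A"
    using A by (rule symmetric_opI_real) (use nn in \<open>simp add: complex_nonneg_Reals_iff\<close>)
  moreover have "0 \<le> A x \<bullet> x" for x
    using nn[of x] by (simp add: complex_nonneg_Reals_iff inner_eq_Re_cinner)
  ultimately show "A \<in> bounded_ops \<and> nonneg_op A" using A by (simp add: nonneg_op_def)
next
  assume "A \<in> bounded_ops \<and> nonneg_op A"
  then show "positive_op A"
    by (simp add: positive_op_def nonneg_op_def cinner_symmetric_op)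
qed

lemma op_abs_positive:
  assumes "positive_op A"
  shows "op_abs A = A"
proof -
  have A: "A \<in> bounded_ops" "nonneg_op A" using assms by (auto simp: positive_op_iff)
  then have "op_adjoint A = A"
    by (simp add: op_adjoint_eq_self_iff nonneg_opD)
  then show ?thesis
    unfolding op_abs_def using assms A
    by (intro the_equality) (auto simp: positive_op_iff intro: nonneg_op_square_eq)
qed

lemma scalar_measure_eq: "scalar_measure E x = pvm_measure E x"
  by (simp add: scalar_measure_def pvm_measure_def inner_eq_Re_cinner)

lemma projection_valued_measure_iff:
  "projection_valued_measure E \<longleftrightarrow>
    (\<forall>S. S \<notin> sets borel \<longrightarrow> E S = 0) \<and> (\<forall>S\<in>sets borel. E S \<in> bounded_ops) \<and> real_pvm E"
proof
  assume "projection_valued_measure E"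
  then show "(\<forall>S. S \<notin> sets borel \<longrightarrow> E S = 0) \<and> (\<forall>S\<in>sets borel. E S \<in> bounded_ops) \<and> real_pvm E"
    by (auto simp: projection_valued_measure_def real_pvm_def is_projection_def op_adjoint_eq_self_iff)
next
  assume E: "(\<forall>S. S \<notin> sets borel \<longrightarrow> E S = 0) \<and> (\<forall>S\<in>sets borel. E S \<in> bounded_ops) \<and> real_pvm E"
  then have "E S o\<^sub>L E S = E S" if "S \<in> sets borel" for S
    using that unfolding real_pvm_def by (metis Int_absorb)
  with E show "projection_valued_measure E"
    by (auto simp: projection_valued_measure_def real_pvm_def is_projection_def op_adjoint_eq_self_iff)
qed

section \<open>Spectral measure and powers of a positive operator\<close>

locale positive_operator =
  fixes T :: "'h::chilbert_space \<Rightarrow>\<^sub>L 'h"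
  assumes positive: "positive_op T"
begin

lemma T_bounded_ops: "T \<in> bounded_ops" and nonneg_op_T: "nonneg_op T"
  using positive by (auto simp: positive_op_iff)

sublocale symmetric_operator T
  by unfold_locales (rule nonneg_opD[OF nonneg_op_T])

lemma in_bounded_opsI: "(\<And>C. T o\<^sub>L C = C o\<^sub>L T \<Longrightarrow> C o\<^sub>L B = B o\<^sub>L C) \<Longrightarrow> B \<in> bounded_ops"
  using T_bounded_ops by (simp add: bounded_ops_iff)

lemma spectral_proj_bounded_ops: "S \<in> sets borel \<Longrightarrow> spectral_proj S \<in> bounded_ops"
  by (rule in_bounded_opsI) (rule spectral_proj_commute)

lemma spectral_measure_eq: "spectral_measure T = spectral_proj"
  unfolding spectral_measure_def
proof (rule the_equality)
  have "spectral_proj {- norm T..norm T} = id_blinfun"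
  proof (rule blinfun_eqI)
    fix v
    have "- norm T * (v \<bullet> v) \<le> T v \<bullet> v" for v
      using abs_inner_op_le[of T v] by (simp add: abs_le_iff)
    from spectral_proj_support_Icc[OF this order_refl, of v]
    show "spectral_proj {- norm T..norm T} v = id_blinfun v" by simp
  qed
  then show "is_spectral_measure T spectral_proj"
    using inner_eq_integral_spectral_proj cinner_symmetric_op[OF T_bounded_ops sym]
    by (auto simp: is_spectral_measure_def projection_valued_measure_iff real_pvm_spectral_proj
        spectral_proj_bounded_ops spectral_proj_not_borel scalar_measure_eq)
next
  fix E assume "is_spectral_measure T E"
  then obtain R where E: "real_pvm E" "E {-R..R} = id_blinfun"
    "\<And>x. T x \<bullet> x = (\<integral>l. l \<partial>pvm_measure E x)" "\<And>S. S \<notin> sets borel \<Longrightarrow> E S = 0"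
    by (auto simp: is_spectral_measure_def projection_valued_measure_iff scalar_measure_eq
        inner_eq_Re_cinner)
  show "E = spectral_proj"
  proof
    fix S show "E S = spectral_proj S"
      using spectral_measure_unique[OF E(1-3), of S] E(4)
      by (cases "S \<in> sets borel") (auto simp: spectral_proj_not_borel)
  qed
qed

lemma spectral_proj_nonneg_support: "spectral_proj {0..norm T} v = v"
  by (rule spectral_proj_support_Icc) (use nonneg_opD(2)[OF nonneg_op_T] in auto)

lemma op_powr:
  assumes "s > 0"
  shows op_powr_positive: "positive_op (op_powr T s)"
    and inner_op_powr: "op_powr T s v \<bullet> v = (\<integral>l. l powr s \<partial>pvm_measure spectral_proj v)"
    and op_powr_commute: "T o\<^sub>L C = C o\<^sub>L T \<Longrightarrow> C o\<^sub>L op_powr T s = op_powr T s o\<^sub>L C"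
    and integrable_powr: "integrable (pvm_measure spectral_proj v) (\<lambda>l. l powr s)"
proof -
  note pvm = real_pvm_spectral_proj
  \<comment> \<open>The cut-off to the support makes the integrand nonnegative and bounded, as
    \<open>bounded_borel_op_exists\<close> requires; it changes the power only on null sets of the
    scalar measures.\<close>
  define f where "f l = indicator {0..norm T} l * l powr s" for l :: real
  have f: "f \<in> borel_measurable borel" "0 \<le> f l" "f l \<le> norm T powr s" for l
    using assms by (auto simp: f_def[abs_def] indicator_def intro!: powr_mono2)
  have AE: "AE l in pvm_measure spectral_proj v. f l = l powr s" for v
    using AE_pvm_support[OF pvm _ spectral_proj_nonneg_support, of v]
    by (auto simp: f_def)
  have int: "integrable (pvm_measure spectral_proj v) (\<lambda>l. l powr s)" for v
    by (rule integrable_pvm[OF pvm _ spectral_proj_nonneg_support, of _ "norm T powr s"])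
      (use assms in \<open>auto intro!: powr_mono2\<close>)
  have eq: "(\<integral>l. f l \<partial>pvm_measure spectral_proj v) = (\<integral>l. l powr s \<partial>pvm_measure spectral_proj v)" for v
    using f(1) by (intro integral_cong_AE AE) auto
  from bounded_borel_op_exists[OF f] obtain B where op: "op_integral f B" by blast
  note B = op_integral_symmetric[OF op] op_integral_inner[OF op, unfolded eq] op_integral_commute[OF op]
  have Bb: "B \<in> bounded_ops" by (rule in_bounded_opsI) (rule B(3))
  have opB: "op_powr T s = B"
    unfolding op_powr_def op_fun_def spectral_measure_eq scalar_measure_eq
  proof (rule the_equality)
    show "B \<in> bounded_ops \<and> (\<forall>x. integrable (pvm_measure spectral_proj x) (\<lambda>l. l powr s) \<and>
      cinner (B x) x = complex_of_real (\<integral>l. l powr s \<partial>pvm_measure spectral_proj x))"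
      using Bb int cinner_symmetric_op[OF Bb B(1)] B(2) by simp
    fix C assume C: "C \<in> bounded_ops \<and> (\<forall>x. integrable (pvm_measure spectral_proj x) (\<lambda>l. l powr s) \<and>
      cinner (blinfun_apply C x) x = complex_of_real (\<integral>l. l powr s \<partial>pvm_measure spectral_proj x))"
    then have "symmetric_op C" by (intro symmetric_opI_real) auto
    then show "C = B"
    proof (rule symmetric_op_eqI[OF _ B(1)])
      show "C v \<bullet> v = B v \<bullet> v" for v
        unfolding B(2) using C by (simp add: inner_eq_Re_cinner)
    qed
  qed
  show "positive_op (op_powr T s)"
    using Bb B(1) by (simp add: opB positive_op_iff nonneg_op_def B(2) integral_nonneg_AE)
  show "op_powr T s v \<bullet> v = (\<integral>l. l powr s \<partial>pvm_measure spectral_proj v)" by (simp add: opB B(2))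
  show "C o\<^sub>L op_powr T s = op_powr T s o\<^sub>L C" if "T o\<^sub>L C = C o\<^sub>L T"
    unfolding opB by (rule B(3)[OF that])
  show "integrable (pvm_measure spectral_proj v) (\<lambda>l. l powr s)" by (rule int)
qed

end

section \<open>Traces of spectral projections\<close>

lemma blinfun_eq_iff: "A = B \<longleftrightarrow> (\<forall>x. blinfun_apply A x = blinfun_apply B x)"
  by (auto intro: blinfun_eqI)

text \<open>Every element of \<open>commutant N\<close> commutes with \<open>T\<close>, hence with
  \<open>B\<close>; so \<open>B\<close> lies in the bicommutant.\<close>

lemma von_neumann_algebra_memI:
  assumes N: "von_neumann_algebra N" and T: "T \<in> N" and B: "B \<in> bounded_ops"
    and comm: "\<And>C. T o\<^sub>L C = C o\<^sub>L T \<Longrightarrow> C o\<^sub>L B = B o\<^sub>L C"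
  shows "B \<in> N"
proof -
  have "B \<in> commutant (commutant N)"
    using B T comm by (auto simp: commutant_def)
  then show ?thesis using N by (simp add: von_neumann_algebra_def)
qed

context
  fixes N :: "('h::chilbert_space \<Rightarrow>\<^sub>L 'h) set" and \<tau> :: "('h \<Rightarrow>\<^sub>L 'h) \<Rightarrow> ennreal"
  assumes N: "von_neumann_algebra N" and \<tau>: "is_trace N \<tau>"
begin

lemma N_bounded_ops: "A \<in> N \<Longrightarrow> A \<in> bounded_ops"
  using N by (auto simp: von_neumann_algebra_def)

lemma N_iff: "A \<in> N \<longleftrightarrow> A \<in> bounded_ops \<and> (\<forall>C\<in>commutant N. \<forall>x. C (A x) = A (C x))"
proof -
  have "A \<in> N \<longleftrightarrow> A \<in> commutant (commutant N)" using N by (simp add: von_neumann_algebra_def)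
  also have "\<dots> \<longleftrightarrow> A \<in> bounded_ops \<and> (\<forall>C\<in>commutant N. \<forall>x. C (A x) = A (C x))"
    unfolding commutant_def[of "commutant N"] by (auto simp: blinfun_eq_iff)
  finally show ?thesis .
qed

lemma N_add: "A \<in> N \<Longrightarrow> B \<in> N \<Longrightarrow> A + B \<in> N"
  and N_diff: "A \<in> N \<Longrightarrow> B \<in> N \<Longrightarrow> A - B \<in> N"
  and N_scaleR: "A \<in> N \<Longrightarrow> c *\<^sub>R A \<in> N"
  and N_0: "0 \<in> N"
  by (auto simp: N_iff bounded_ops_iff blinfun_eq_iff blinfun.bilinear_simps scaleC_add_right
      simp flip: imaginary_op_apply)

lemma positive_part_iff: "A \<in> positive_part N \<longleftrightarrow> A \<in> N \<and> nonneg_op A"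
  using N_bounded_ops by (auto simp: positive_part_def positive_op_iff)

lemma trace_mono:
  assumes A: "A \<in> positive_part N" and B: "B \<in> N" and le: "\<And>x. A x \<bullet> x \<le> B x \<bullet> x"
    and sym: "symmetric_op B"
  shows "\<tau> A \<le> \<tau> B"
proof -
  have "nonneg_op (B - A)"
    using A sym le by (simp add: positive_part_iff nonneg_op_def symmetric_op_diff
        blinfun.diff_left inner_diff_left)
  then have "B - A \<in> positive_part N"
    using A B by (simp add: positive_part_iff N_diff)
  with A have "\<tau> (A + (B - A)) = \<tau> A + \<tau> (B - A)"
    using \<tau> unfolding is_trace_def by blast
  then show ?thesis by simp
qed

lemma trace_scaleR: "A \<in> positive_part N \<Longrightarrow> 0 \<le> c \<Longrightarrow> \<tau> (c *\<^sub>R A) = ennreal c * \<tau> A"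
  using \<tau> unfolding is_trace_def by blast

lemma trace_sum:
  fixes A :: "'i \<Rightarrow> 'h \<Rightarrow>\<^sub>L 'h"
  assumes "finite I" "\<And>i. i \<in> I \<Longrightarrow> A i \<in> positive_part N" "\<And>i. i \<in> I \<Longrightarrow> 0 \<le> c i"
  shows "(\<Sum>i\<in>I. c i *\<^sub>R A i) \<in> positive_part N \<and>
    \<tau> (\<Sum>i\<in>I. c i *\<^sub>R A i) = (\<Sum>i\<in>I. ennreal (c i) * \<tau> (A i))"
  using assms
proof (induction I rule: finite_induct)
  case empty
  have "0 \<in> positive_part N" by (simp add: positive_part_iff N_0 nonneg_op_def)
  then show ?case using trace_scaleR[of 0 0] by simp
next
  case (insert i I)
  have "c i *\<^sub>R A i \<in> positive_part N"
    using insert.prems[of i]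
    by (auto simp: positive_part_iff N_scaleR nonneg_op_def symmetric_op_scaleR blinfun.scaleR_left)
  moreover have IH: "(\<Sum>i\<in>I. c i *\<^sub>R A i) \<in> positive_part N"
    "\<tau> (\<Sum>i\<in>I. c i *\<^sub>R A i) = (\<Sum>i\<in>I. ennreal (c i) * \<tau> (A i))"
    using insert by auto
  ultimately have "c i *\<^sub>R A i + (\<Sum>i\<in>I. c i *\<^sub>R A i) \<in> positive_part N"
    "\<tau> (c i *\<^sub>R A i + (\<Sum>i\<in>I. c i *\<^sub>R A i)) = \<tau> (c i *\<^sub>R A i) + \<tau> (\<Sum>i\<in>I. c i *\<^sub>R A i)"
    using \<tau> unfolding is_trace_def
    by (auto simp: positive_part_iff N_add nonneg_op_def symmetric_op_add blinfun.add_left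
        inner_add_left)
  with insert IH trace_scaleR[of "A i" "c i"] show ?case by auto
qed

end

section \<open>Dyadic staircase sums: the upper bound serves the spectral variable, the lower one
  the singular values\<close>

lemma dyadic_sum_eq_0:
  fixes x M :: real
  assumes "M \<ge> 0" "x \<le> M / 2 ^ K"
  shows "(\<Sum>k=1..K. M / 2 ^ k * indicator {M / 2 ^ k<..} x) = 0"
proof (intro sum.neutral ballI)
  fix k assume "k \<in> {1..K}"
  then have "M / 2 ^ K \<le> M / 2 ^ k"
    using assms(1) by (intro divide_left_mono power_increasing) auto
  then show "M / 2 ^ k * indicator {M / 2 ^ k<..} x = 0"
    using assms(2) by (simp add: indicator_def)
qed

text \<open>The thresholds below \<open>x\<close> form a geometric progression ending at
  \<open>M / 2 ^ K\<close>; their sum is twice the largest one minus the last. The subtracted term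
  pays for the next threshold in the induction.\<close>

lemma dyadic_sum_upper:
  fixes x M :: real
  assumes "M \<ge> 0" "M / 2 ^ K < x"
  shows "(\<Sum>k=1..K. M / 2 ^ k * indicator {M / 2 ^ k<..} x) \<le> 2 * x - M / 2 ^ K"
  using assms(2)
proof (induction K)
  case (Suc K)
  define S where "S = (\<Sum>k=1..K. M / 2 ^ k * indicator {M / 2 ^ k<..} x)"
  have step: "(\<Sum>k=1..Suc K. M / 2 ^ k * indicator {M / 2 ^ k<..} x) = S + M / 2 ^ Suc K"
    using Suc.prems by (simp add: S_def)
  have half: "M / 2 ^ K = 2 * (M / 2 ^ Suc K)" by simp
  show ?case
  proof (cases "M / 2 ^ K < x")
    case True
    then show ?thesis
      using Suc.IH[folded S_def] Suc.prems unfolding step half by linarith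
  next
    case False
    then have "S = 0" using dyadic_sum_eq_0[OF assms(1), of x K] by (simp add: S_def)
    then show ?thesis using Suc.prems unfolding step by linarith
  qed
qed (use assms(1) in simp)

text \<open>Adding the last step \<open>M / 2 ^ K\<close> to the sum doubles the largest threshold
  below \<open>x\<close>, and the doubled value is either the next threshold up or \<open>M\<close>,
  so it is at least \<open>x\<close>.\<close>

lemma dyadic_sum_lower:
  fixes x M :: real
  assumes "M \<ge> 0" "x \<le> M"
  shows "x \<le> M / 2 ^ K + (\<Sum>k=1..K. M / 2 ^ k * indicator {M / 2 ^ k<..} x)"
proof (induction K)
  case (Suc K)
  define S where "S = (\<Sum>k=1..K. M / 2 ^ k * indicator {M / 2 ^ k<..} x)"
  have half: "M / 2 ^ K = 2 * (M / 2 ^ Suc K)" by simp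
  show ?case
  proof (cases "M / 2 ^ Suc K < x")
    case True
    then have "(\<Sum>k=1..Suc K. M / 2 ^ k * indicator {M / 2 ^ k<..} x) = S + M / 2 ^ Suc K"
      by (simp add: S_def)
    then show ?thesis using Suc[folded S_def] unfolding half by linarith
  next
    case False
    then show ?thesis using dyadic_sum_eq_0[OF assms(1), of x "Suc K"] by linarith
  qed
qed (use assms in simp)

lemma dyadic_sum_powr:
  fixes x M q :: real
  assumes M: "M > 0" and q: "q > 0" and x: "0 \<le> x"
  shows "(\<Sum>k=1..K. M / 2 ^ k * indicator {M / 2 ^ k<..} x) \<le> 2 * (M / 2 ^ K) powr (- q) * x powr (1 + q)"
proof (cases "M / 2 ^ K < x")
  case True
  define a where "a = M / 2 ^ K"
  have a: "a > 0" using M by (simp add: a_def)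
  note True = True[folded a_def]
  have xpos: "x > 0" using a True by linarith
  have "(\<Sum>k=1..K. M / 2 ^ k * indicator {M / 2 ^ k<..} x) \<le> 2 * x"
    using dyadic_sum_upper[of M K x, folded a_def] M True a by linarith
  also have "\<dots> \<le> 2 * x * (x / a) powr q"
  proof -
    have "1 \<le> (x / a) powr q"
      using True a q by (intro ge_one_powr_ge_zero) (auto simp: pos_le_divide_eq)
    then show ?thesis using xpos by simp
  qed
  also have "\<dots> = 2 * a powr (- q) * x powr (1 + q)"
    using a xpos by (simp add: powr_divide powr_minus powr_add field_simps)
  finally show ?thesis by (simp only: a_def)
next
  case False
  then show ?thesis
    using dyadic_sum_eq_0[of M x K] M by simp
qed

lemma emeasure_lborel_below_le: "emeasure lborel {s. 0 \<le> s \<and> ennreal s < c} \<le> c"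
proof (cases c)
  case (real r)
  then have "{s. 0 \<le> s \<and> ennreal s < c} = {0..<r}"
    by (auto simp: ennreal_less_iff)
  then show ?thesis using real by simp
qed simp

lemma below_borel [measurable]: "{s. 0 \<le> s \<and> ennreal s < c} \<in> sets borel"
proof -
  have "{s \<in> space borel. 0 \<le> s \<and> ennreal s < c} \<in> sets borel" by measurable
  then show ?thesis by simp
qed

section \<open>Trace estimates for spectral projections and singular values\<close>

context positive_operator
begin

context
  fixes N :: "('h \<Rightarrow>\<^sub>L 'h) set" and \<tau> :: "('h \<Rightarrow>\<^sub>L 'h) \<Rightarrow> ennreal"
  assumes N: "von_neumann_algebra N" and \<tau>: "is_trace N \<tau>" and T: "T \<in> N"
begin

lemma spectral_proj_positive_part:
  assumes "S \<in> sets borel"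
  shows "spectral_proj S \<in> positive_part N"
proof -
  have "spectral_proj S \<in> N"
    using spectral_proj_bounded_ops[OF assms] spectral_proj_commute[OF assms]
    by (rule von_neumann_algebra_memI[OF N T])
  then show ?thesis
    using assms by (simp add: positive_part_iff[OF N \<tau>] nonneg_op_def symmetric_spectral_proj
        inner_spectral_proj)
qed

lemma op_powr_positive_part:
  assumes "s > 0"
  shows "op_powr T s \<in> positive_part N"
proof -
  have "op_powr T s \<in> N"
    using op_powr_positive[OF assms] op_powr_commute[OF assms]
    by (intro von_neumann_algebra_memI[OF N T]) (auto simp: positive_op_iff)
  then show ?thesis
    using op_powr_positive[OF assms] by (simp add: positive_part_iff[OF N \<tau>] positive_op_iff)
qed

text \<open>\<open>dyadic_sum_powr\<close> holds on the spectrum; integrated against each scalar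
  measure it compares the forms of the dyadic operator sum and of the power, and the trace respects
  this order.\<close>

lemma dyadic_trace_le:
  assumes M: "M > 0" and q: "q > 0"
  shows "(\<Sum>k=1..K. ennreal (M / 2 ^ k) * \<tau> (spectral_proj {M / 2 ^ k<..}))
    \<le> ennreal (2 * (M / 2 ^ K) powr (- q)) * \<tau> (op_powr T (1 + q))"
proof -
  note pvm = real_pvm_spectral_proj
  let ?c = "2 * (M / 2 ^ K) powr (- q)"
  let ?S = "\<Sum>k=1..K. (M / 2 ^ k) *\<^sub>R spectral_proj {M / 2 ^ k<..}"
  have S: "?S \<in> positive_part N \<and>
      \<tau> ?S = (\<Sum>k=1..K. ennreal (M / 2 ^ k) * \<tau> (spectral_proj {M / 2 ^ k<..}))"
    using M by (intro trace_sum[OF N \<tau>] spectral_proj_positive_part) auto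
  have P: "op_powr T (1 + q) \<in> positive_part N"
    using q by (intro op_powr_positive_part) simp
  have "\<tau> ?S \<le> \<tau> (?c *\<^sub>R op_powr T (1 + q))"
  proof (rule trace_mono[OF N \<tau>])
    show "?c *\<^sub>R op_powr T (1 + q) \<in> N" "symmetric_op (?c *\<^sub>R op_powr T (1 + q))"
      using P by (auto simp: positive_part_iff[OF N \<tau>] N_scaleR[OF N \<tau>] symmetric_op_scaleR nonneg_op_def)
    fix v
    interpret finite_borel_measure "pvm_measure spectral_proj v"
      by (rule finite_borel_pvm_measure[OF pvm])
    have int: "integrable (pvm_measure spectral_proj v) (\<lambda>l. M / 2 ^ k * indicator {M / 2 ^ k<..} l)" for k
      by (intro integrable_mult_right integrable_real_indicator) (simp_all add: emeasure_eq_measure)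
    have intp: "integrable (pvm_measure spectral_proj v) (\<lambda>l. ?c * l powr (1 + q))"
      using q by (intro integrable_mult_right integrable_powr) simp
    have "?S v \<bullet> v = (\<integral>l. (\<Sum>k=1..K. M / 2 ^ k * indicator {M / 2 ^ k<..} l) \<partial>pvm_measure spectral_proj v)"
      using int by (simp add: blinfun.sum_left inner_sum_left blinfun.scaleR_left measure_pvm_measure[OF pvm])
    also have "\<dots> \<le> (\<integral>l. ?c * l powr (1 + q) \<partial>pvm_measure spectral_proj v)"
    proof (intro integral_mono_AE intp Bochner_Integration.integrable_sum int)
      have "AE l in pvm_measure spectral_proj v. l \<in> {0..norm T}"
        by (rule AE_pvm_support[OF pvm _ spectral_proj_nonneg_support]) simp
      then show "AE l in pvm_measure spectral_proj v.
          (\<Sum>k=1..K. M / 2 ^ k * indicator {M / 2 ^ k<..} l) \<le> ?c * l powr (1 + q)"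
        by eventually_elim (use dyadic_sum_powr[OF M q] in auto)
    qed
    also have "\<dots> = (?c *\<^sub>R op_powr T (1 + q)) v \<bullet> v"
      using q by (simp add: blinfun.scaleR_left inner_op_powr)
    finally show "?S v \<bullet> v \<le> (?c *\<^sub>R op_powr T (1 + q)) v \<bullet> v" .
  qed (use S in blast)
  also have "\<dots> = ennreal ?c * \<tau> (op_powr T (1 + q))"
    by (rule trace_scaleR[OF N \<tau> P]) simp
  finally show ?thesis using S by simp
qed

lemma singular_value_eq:
  "singular_value \<tau> s T = Inf {l. 0 \<le> l \<and> \<tau> (spectral_proj {l<..}) \<le> ennreal s}"
  by (simp add: singular_value_def op_abs_positive[OF positive] spectral_measure_eq)

lemma singular_value_le:
  assumes "0 \<le> l" "\<tau> (spectral_proj {l<..}) \<le> ennreal s"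
  shows "singular_value \<tau> s T \<le> l"
  unfolding singular_value_eq using assms by (intro cInf_lower bdd_belowI[of _ 0]) auto

lemma singular_value_le_norm: "singular_value \<tau> s T \<le> norm T"
proof (rule singular_value_le)
  have "0 \<in> positive_part N" by (simp add: positive_part_iff[OF N \<tau>] N_0[OF N \<tau>] nonneg_op_def)
  then have "\<tau> 0 = 0" using trace_scaleR[OF N \<tau>, of 0 0] by simp
  moreover have "spectral_proj {norm T<..} = 0"
    using upper_proj_eq_0[of "norm T"] by (auto intro!: blinfun_eqI simp: spectral_proj_greaterThan)
  ultimately show "\<tau> (spectral_proj {norm T<..}) \<le> ennreal s" by simp
qed simp

text \<open>Layer-cake estimate: \<open>singular_value \<tau> s T > l\<close> forces \<open>s < \<tau> (E {l<..})\<close>.\<close>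

lemma nn_integral_singular_value_le:
  assumes M: "M > 0" "norm T \<le> M" and t: "0 \<le> t"
  shows "(\<integral>\<^sup>+s\<in>{0..t}. ennreal (singular_value \<tau> s T) \<partial>lborel)
    \<le> ennreal (M / 2 ^ K * t) + (\<Sum>k=1..K. ennreal (M / 2 ^ k) * \<tau> (spectral_proj {M / 2 ^ k<..}))"
proof -
  \<comment> \<open>The comparison in \<open>ennreal\<close> covers an infinite trace, for which
    \<open>W k\<close> is the whole half-line \<open>{0..}\<close>.\<close>
  define W where "W k = {s. 0 \<le> s \<and> ennreal s < \<tau> (spectral_proj {M / 2 ^ k<..})}" for k :: nat
  have [measurable]: "W k \<in> sets borel" for k
    by (simp add: W_def below_borel)
  have "ennreal (singular_value \<tau> s T) * indicator {0..t} s
      \<le> ennreal (M / 2 ^ K) * indicator {0..t} s + (\<Sum>k=1..K. ennreal (M / 2 ^ k) * indicator (W k) s)" for s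
  proof (cases "s \<in> {0..t}")
    case True
    let ?m = "singular_value \<tau> s T"
    have ind: "indicator {M / 2 ^ k<..} ?m \<le> (indicator (W k) s :: real)" for k
    proof (cases "M / 2 ^ k < ?m")
      case less: True
      then have "\<not> \<tau> (spectral_proj {M / 2 ^ k<..}) \<le> ennreal s"
        using singular_value_le[of "M / 2 ^ k" s] M(1) by fastforce
      with True show ?thesis by (simp add: W_def not_le)
    qed simp
    have "?m \<le> M / 2 ^ K + (\<Sum>k=1..K. M / 2 ^ k * indicator {M / 2 ^ k<..} ?m)"
      using M order_trans[OF singular_value_le_norm M(2)] by (intro dyadic_sum_lower) auto
    also have "\<dots> \<le> M / 2 ^ K + (\<Sum>k=1..K. M / 2 ^ k * indicator (W k) s)"
      using M ind by (intro add_left_mono sum_mono mult_left_mono) auto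
    finally have "ennreal ?m \<le> ennreal (M / 2 ^ K + (\<Sum>k=1..K. M / 2 ^ k * indicator (W k) s))"
      by (rule ennreal_leI)
    also have "\<dots> = ennreal (M / 2 ^ K) + (\<Sum>k=1..K. ennreal (M / 2 ^ k * indicator (W k) s))"
      using M by (subst ennreal_plus) (auto intro!: sum_nonneg simp: sum_ennreal)
    also have "(\<Sum>k=1..K. ennreal (M / 2 ^ k * indicator (W k) s)) = (\<Sum>k=1..K. ennreal (M / 2 ^ k) * indicator (W k) s)"
      using M by (intro sum.cong) (auto simp: indicator_def)
    finally show ?thesis using True by simp
  qed simp
  then have "(\<integral>\<^sup>+s\<in>{0..t}. ennreal (singular_value \<tau> s T) \<partial>lborel)
      \<le> (\<integral>\<^sup>+s. ennreal (M / 2 ^ K) * indicator {0..t} s + (\<Sum>k=1..K. ennreal (M / 2 ^ k) * indicator (W k) s) \<partial>lborel)"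
    by (intro nn_integral_mono)
  also have "\<dots> = ennreal (M / 2 ^ K) * emeasure lborel {0..t} + (\<Sum>k=1..K. ennreal (M / 2 ^ k) * emeasure lborel (W k))"
  proof -
    have "(\<integral>\<^sup>+s. ennreal (M / 2 ^ K) * indicator {0..t} s + (\<Sum>k=1..K. ennreal (M / 2 ^ k) * indicator (W k) s) \<partial>lborel)
      = (\<integral>\<^sup>+s. ennreal (M / 2 ^ K) * indicator {0..t} s \<partial>lborel)
      + (\<integral>\<^sup>+s. (\<Sum>k=1..K. ennreal (M / 2 ^ k) * indicator (W k) s) \<partial>lborel)"
      by (rule nn_integral_add) measurable
    moreover have "(\<integral>\<^sup>+s. ennreal (M / 2 ^ K) * indicator {0..t} s \<partial>lborel) = ennreal (M / 2 ^ K) * emeasure lborel {0..t}"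
      by (rule nn_integral_cmult_indicator) simp
    moreover have "(\<integral>\<^sup>+s. (\<Sum>k=1..K. ennreal (M / 2 ^ k) * indicator (W k) s) \<partial>lborel)
      = (\<Sum>k=1..K. \<integral>\<^sup>+s. ennreal (M / 2 ^ k) * indicator (W k) s \<partial>lborel)"
      by (rule nn_integral_sum) measurable
    moreover have "\<dots> = (\<Sum>k=1..K. ennreal (M / 2 ^ k) * emeasure lborel (W k))"
      by (intro sum.cong refl nn_integral_cmult_indicator) simp
    ultimately show ?thesis by (simp only:)
  qed
  also have "\<dots> \<le> ennreal (M / 2 ^ K) * ennreal t + (\<Sum>k=1..K. ennreal (M / 2 ^ k) * \<tau> (spectral_proj {M / 2 ^ k<..}))"
    using t by (intro add_mono sum_mono mult_left_mono) (auto simp: W_def emeasure_lborel_below_le)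
  also have "ennreal (M / 2 ^ K) * ennreal t = ennreal (M / 2 ^ K * t)"
    using M t by (intro ennreal_mult[symmetric]) auto
  finally show ?thesis .
qed

end

end

section \<open>The logarithmic bound\<close>

lemma power_two_bracket:
  fixes t :: real
  assumes "1 \<le> t"
  obtains K :: nat where "t \<le> 2 ^ K" "2 ^ K \<le> 2 * t"
proof -
  define K where "K = (LEAST n. t \<le> 2 ^ n)"
  obtain n where "t < 2 ^ n" using real_arch_pow[of 2 t] by auto
  then have "t \<le> 2 ^ n" by simp
  then have K: "t \<le> 2 ^ K" unfolding K_def by (rule LeastI)
  have "2 ^ K \<le> 2 * t"
  proof (cases K)
    case (Suc m)
    have "\<not> t \<le> 2 ^ m"
      by (rule not_less_Least, fold K_def, simp add: Suc)
    then show ?thesis using Suc by simp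
  qed (use assms in simp)
  with K show ?thesis by (rule that)
qed

theorem corollary4p6:
  fixes N :: "('h::{chilbert_space, second_countable_topology} \<Rightarrow>\<^sub>L 'h) set"
    and \<tau> :: "('h \<Rightarrow>\<^sub>L 'h) \<Rightarrow> ennreal"
    and T :: "'h \<Rightarrow>\<^sub>L 'h"
  assumes "von_neumann_algebra N"
    and "is_trace N \<tau>" and "faithful N \<tau>" and "normal N \<tau>" and "semifinite N \<tau>"
    and "T \<in> N" and "positive_op T"
    and "\<forall>s>1. \<tau> (op_powr T s) < \<infinity>"
    and "\<exists>L::real. ((\<lambda>r::real. (1 / r) * enn2real (\<tau> (op_powr T (1 + 1 / r)))) \<longlongrightarrow> L) at_top"
  shows "T \<in> L_one_infinity N \<tau>"
proof -
  interpret positive_operator T by unfold_locales fact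
  \<comment> \<open>The \<open>+ 1\<close> gives \<open>M \<ge> 1\<close> even for
    \<open>T = 0\<close>; dividing by \<open>M\<close> can then be dropped from an upper
    bound.\<close>
  define M where "M = norm T + 1"
  have M: "M > 0" "norm T \<le> M" "1 \<le> M"
    unfolding M_def using norm_ge_zero[of T] by linarith+
  define I where "I t = (\<integral>\<^sup>+s\<in>{0..t}. ennreal (singular_value \<tau> s T) \<partial>lborel)" for t
  note I_le = nn_integral_singular_value_le[OF assms(1,2,6) M(1,2), folded I_def]
  obtain L where L: "((\<lambda>r::real. (1 / r) * enn2real (\<tau> (op_powr T (1 + 1 / r)))) \<longlongrightarrow> L) at_top"
    using assms(9) by blast
  define C where "C = \<bar>L\<bar> + 1"
  have C: "C > 0" "L < C" by (auto simp: C_def)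
  from order_tendstoD(2)[OF L C(2)] obtain R where
    R: "\<And>r. R \<le> r \<Longrightarrow> (1 / r) * enn2real (\<tau> (op_powr T (1 + 1 / r))) < C"
    by (auto simp: eventually_at_top_linorder)
  \<comment> \<open>The maximum with 1 keeps \<open>r\<close> positive and makes
    \<open>t \<ge> exp 1\<close> in the range of large \<open>t\<close>.\<close>
  define r0 where "r0 = max 1 R"
  have zeta: "\<tau> (op_powr T (1 + 1 / r)) \<le> ennreal (C * r)" if "r0 \<le> r" for r
  proof -
    have r: "r > 0" "R \<le> r" using that by (auto simp: r0_def)
    have "1 + 1 / r > 1" using r by simp
    with assms(8) have "\<tau> (op_powr T (1 + 1 / r)) < \<infinity>" by blast
    then have "\<tau> (op_powr T (1 + 1 / r)) = ennreal (enn2real (\<tau> (op_powr T (1 + 1 / r))))"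
      by simp
    also have "\<dots> \<le> ennreal (C * r)"
      using R[OF r(2)] r(1) by (intro ennreal_leI) (simp add: field_simps)
    finally show ?thesis .
  qed
  have large: "I t \<le> ennreal ((M + 4 * exp 1 * C) * ln (1 + t))" if t: "exp r0 \<le> t" for t
  proof -
    define r where "r = ln t"
    have "exp 1 \<le> exp r0" by (simp add: r0_def)
    with t have t1: "exp 1 \<le> t" by linarith
    then have t_pos: "1 \<le> t" using exp_ge_add_one_self[of "1::real"] by linarith
    have r: "r0 \<le> r" "1 \<le> r" "t = exp r"
      using t t1 t_pos by (auto simp: r_def ln_ge_iff)
    have r_pos: "r > 0" using r(2) by linarith
    \<comment> \<open>The cut-off level is \<open>M / 2 ^ K\<close>. The lower bound on
      \<open>2 ^ K\<close> makes its contribution at most \<open>M\<close>; the upper bound keeps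
      the negative power of the level under control.\<close>
    obtain K where K: "t \<le> 2 ^ K" "2 ^ K \<le> 2 * t"
      using power_two_bracket[OF t_pos] .
    have "(M / 2 ^ K) powr (- (1 / r)) = (2 ^ K / M) powr (1 / r)"
      using M by (simp add: powr_minus powr_divide)
    also have "\<dots> \<le> (2 * t) powr (1 / r)"
    proof (rule powr_mono2)
      have "2 ^ K / M \<le> 2 ^ K / 1" using M by (intro divide_left_mono) auto
      with K show "2 ^ K / M \<le> 2 * t" by simp
    qed (use M r_pos in auto)
    \<comment> \<open>Since \<open>r = ln t\<close> and \<open>r \<ge> 1\<close>, the second factor
      equals \<open>exp 1\<close> and the first is at most 2.\<close>
    also have "\<dots> = 2 powr (1 / r) * t powr (1 / r)"
      using t_pos by (simp add: powr_mult)
    also have "\<dots> \<le> 2 powr 1 * exp 1"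
    proof (rule mult_mono)
      show "2 powr (1 / r) \<le> 2 powr (1 :: real)"
        using r(2) by (intro powr_mono) auto
      show "t powr (1 / r) \<le> exp 1"
        using r_pos by (simp add: r(3) powr_def)
    qed auto
    finally have pw: "(M / 2 ^ K) powr (- (1 / r)) \<le> 2 * exp 1" by simp
    have "I t \<le> ennreal (M / 2 ^ K * t) +
        (\<Sum>k=1..K. ennreal (M / 2 ^ k) * \<tau> (spectral_proj {M / 2 ^ k<..}))"
      using t_pos by (intro I_le) simp
    also have "\<dots> \<le> ennreal M + ennreal (2 * (M / 2 ^ K) powr (- (1 / r))) * \<tau> (op_powr T (1 + 1 / r))"
    proof (intro add_mono ennreal_leI dyadic_trace_le[OF assms(1,2,6) M(1)])
      show "M / 2 ^ K * t \<le> M" using K(1) M(1) by (simp add: field_simps)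
    qed (use r_pos in simp)
    also have "\<dots> \<le> ennreal M + ennreal (2 * (2 * exp 1)) * ennreal (C * r)"
      using pw zeta[OF r(1)] by (intro add_mono mult_mono ennreal_leI) auto
    also have "ennreal (2 * (2 * exp 1)) * ennreal (C * r) = ennreal (4 * exp 1 * C * r)"
      using C r_pos by (subst ennreal_mult[symmetric]) (auto simp: mult.assoc)
    also have "ennreal M + ennreal (4 * exp 1 * C * r) = ennreal (M + 4 * exp 1 * C * r)"
      using M C r_pos by (intro ennreal_plus[symmetric]) auto
    also have "\<dots> \<le> ennreal ((M + 4 * exp 1 * C) * ln (1 + t))"
    proof (rule ennreal_leI)
      \<comment> \<open>\<open>ln (1 + t)\<close> dominates both \<open>r\<close> and, because
        \<open>r \<ge> 1\<close>, the constant 1, which absorbs the summand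
        \<open>M\<close>.\<close>
      have le: "r \<le> ln (1 + t)" using t_pos by (simp add: r_def)
      then have "M * 1 \<le> M * ln (1 + t)" "4 * exp 1 * C * r \<le> 4 * exp 1 * C * ln (1 + t)"
        using M C r(2) by (intro mult_left_mono; simp)+
      then show "M + 4 * exp 1 * C * r \<le> (M + 4 * exp 1 * C) * ln (1 + t)"
        unfolding distrib_right by linarith
    qed
    finally show ?thesis .
  qed
  \<comment> \<open>With \<open>K = 0\<close> the dyadic sum is empty and only the level
    \<open>M\<close> remains.\<close>
  have small: "I t \<le> ennreal (M * t)" if "0 \<le> t" for t
    using I_le[OF that, of 0] by simp
  \<comment> \<open>The first summand serves \<open>t \<le> exp r0\<close>, on both branches of
    \<open>psi1\<close>; the remaining ones come from \<open>large\<close>.\<close>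
  define B where "B = M * exp r0 / ln 2 + M + 4 * exp 1 * C"
  have r0: "1 \<le> exp r0" by (simp add: r0_def)
  have psi: "0 < psi1 t" if "0 < t" for t
    using that by (auto simp: psi1_def)
  have B: "I t \<le> ennreal (B * psi1 t)" if t: "0 < t" for t
  proof -
    have Bge: "M * exp r0 / ln 2 \<le> B" "M + 4 * exp 1 * C \<le> B"
      using M C by (simp_all add: B_def)
    consider "t \<le> 1" | "1 < t" "t \<le> exp r0" | "1 < t" "exp r0 \<le> t" by linarith
    then show ?thesis
    proof cases
      case 1
      have "M * t \<le> M * exp r0 * t" using M r0 t by simp
      also have "\<dots> = M * exp r0 / ln 2 * psi1 t" using 1 by (simp add: psi1_def)
      also have "\<dots> \<le> B * psi1 t" using Bge(1) psi[OF t] by (intro mult_right_mono) auto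
      finally show ?thesis using small[of t] t by (meson ennreal_leI order_trans less_imp_le)
    next
      case 2
      have "M * t \<le> M * exp r0" using 2 M by simp
      also have "\<dots> = M * exp r0 / ln 2 * ln 2" by simp
      \<comment> \<open>For \<open>t > 1\<close>,
        \<open>psi1 t = ln (1 + t) \<ge> ln 2\<close>.\<close>
      also have "\<dots> \<le> M * exp r0 / ln 2 * psi1 t"
        using 2 M by (intro mult_left_mono) (auto simp: psi1_def)
      also have "\<dots> \<le> B * psi1 t" using Bge(1) psi[OF t] by (intro mult_right_mono) auto
      finally show ?thesis using small[of t] t by (meson ennreal_leI order_trans less_imp_le)
    next
      case 3
      have "I t \<le> ennreal ((M + 4 * exp 1 * C) * psi1 t)"
        using large[OF 3(2)] 3(1) by (simp add: psi1_def)
      also have "\<dots> \<le> ennreal (B * psi1 t)"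
        using Bge(2) psi[OF t] by (intro ennreal_leI mult_right_mono) auto
      finally show ?thesis .
    qed
  qed
  have "(SUP t\<in>{0<..}. ennreal (1 / psi1 t) * I t) \<le> ennreal B"
  proof (rule SUP_least)
    fix t :: real assume "t \<in> {0<..}"
    then have t: "0 < t" by simp
    have "ennreal (1 / psi1 t) * I t \<le> ennreal (1 / psi1 t) * ennreal (B * psi1 t)"
      using B[OF t] by (rule mult_left_mono) simp
    also have "\<dots> = ennreal B"
      using psi[OF t] by (simp flip: ennreal_mult')
    finally show "ennreal (1 / psi1 t) * I t \<le> ennreal B" .
  qed
  also have "ennreal B < \<infinity>" by simp
  finally show ?thesis
    using assms(6) by (simp add: L_one_infinity_def I_def)
qed

end
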